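(* Let $Z\in\mathcal Z$ and $\mu\in\mathcal F_Z$. The space $L^1(\mu)$ admits a CZ decomposition with respect to the family $\mathcal D^Z$. Namely, for every $f\in L^1(\mu)$ and $\alpha>0$ there exist a family of disjoint sets $\mathcal E(f,\alpha)=\{P_j\}$ with $P_j\in\mathcal D^Z$, and functions $g,b_j$, such that $f=g+\sum_jb_j$ and (a) $|g|\le C_1\alpha$ $\mu$-almost everywhere; (b) $b_j=0$ on $G\setminus P_j$ and $\int_{P_j}b_j\,d\mu=0$; (c) $\sum_j\|b_j\|_1\le2C_1\|f\|_1$. Conversely, any set $P\in\mathcal D^Z$ belongs to $\mathcal E(f,\alpha)$ for some $f\in L^1(\mu)$ and some $\alpha>0$.
   Context: **Group setting.** $N$ is a stratified Lie group of step $S\ge 1$: simply connected, with Lie algebra $\mathfrak n=\bigoplus_{j=1}^S\mathfrak n_j$, $[\mathfrak n_i,\mathfrak n_j]\subset\mathfrak n_{i+j}$ (with $\mathfrak n_l=0$ for $l>S$), $\mathfrak n_1$ generating $\mathfrak n$. $dn$ is the Haar measure on $N$ (push-forward of Lebesgue measure by $\exp_N$). $A=(\mathbb R_+,\cdot)$ acts on $N$ by the automorphic dilations $D_a(\exp_N(\sum_j Y_j))=\exp_N(\sum_j a^jY_j)$, $Y_j\in\mathfrak n_j$. $G=N\rtimes A$ has product $(n,a)(n',a')=(nD_a(n'),aa')$ and right Haar measure $d\rho(n,a)=a^{-1}\,dn\,da$. Fix bases $\{\breve X_{j,i}:1\le i\le q_j\}$ of $\mathfrak n_j$. $d_N$ is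 the (left-invariant) Carnot–Carathéodory distance on $N$ for which $\breve X_{1,1},\dots,\breve X_{1,q_1}$ is an orthonormal horizontal frame. In the Lie algebra $\mathfrak g=\mathfrak n\oplus\mathfrak a$ of $G$, $X_0$ is the generator of $A$ with $\exp(tX_0)=(1_N,e^t)$, and $X_{j,i}$ is the left-invariant vector field on $G$ whose value at the identity is $\breve X_{j,i}$. $\langle\cdot,\cdot\rangle$ is the scalar product on $\mathfrak g$ making $\{X_0\}\cup\{X_{j,i}\}_{j,i}$ orthonormal, and $\mathcal Z=\{Z\in\mathfrak g:\langle Z,X_0\rangle=1\}$. **Flow measures.** A Borel measure $\mu$ on $G$ is a $Z$-flow measure if $d\mu=\varphi\,d\rho$ with $\varphi:G\to[0,\infty)$ satisfying $\varphi(x)=\varphi(x\exp(tZ))$ for all $x\in G$, $t\in\mathbb R$. Put $\mu_N(F)=\int_F\varphi(n,1)\,dn$ for Borel $F\subset N$. $\mathcal F_Z$ is the set of $Z$-flow measures $\mu$ such that $(N,d_N,\mu_N)$ is doubling, i.e. balls have positive finite measure and for every $C>1$ there is $D(\mu_N,C)>1$ with $\mu_N(B(x,Cr))\le D(\mu_N,C)\mu_N(B(x,r))$ for all $x\in N$, $r>0$. **Christ cubes.** For $\mu\in\mathcal F_Z$, fix a Christ decomposition of $(N,d_N,\mu_N)$: families $\mathcal Q_k$ ($k\in\mathbb Z$) of countably many pairwise disjoint open sets of $N$ ("cubes of generation $k$"), $\mathcal Q=\bigcup_k\mathcal Q_k$, and constants $\delta\in(0,1)$, $C_1,c>0$ such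 that: (i) $\mu_N(N\setminus\bigcup_{Q\in\mathcal Q_k}Q)=0$ for all $k$; (ii) each $Q\in\mathcal Q_k$ is contained in a unique $p_N(Q)\in\mathcal Q_{k-1}$ and is disjoint from every other element of $\mathcal Q_{k-1}$; (iii) for each $Q\in\mathcal Q_k$ there is $n_Q\in Q$ with $B_N(n_Q,c\delta^k)\subset Q\subset B_N(n_Q,C_1\delta^k)$; (iv) $\mu_N(p_N(Q))\le C_1\mu_N(Q)$ and $s_N(Q):=\{Q'\in\mathcal Q:p_N(Q')=Q\}$ has at most $C_1$ elements. It is assumed that $C_1\ge3$ and $\#s_N(Q)\ge2$ for all $Q$. The constant $C_1$ in the claim is this one. **Cylinders.** For $E\subset N$, $r>1$, $a\in A$: $P_{r,E}(a)=\{(n,1)\exp(tZ):n\in E,\ t\in U_r(a)\}$, $U_r(a)=(\log(a/r),\log(ar))$. Fix $\gamma\ge5$ and $\lambda>e^3/\delta$. $P_{r,Q}(a)$ with $Q\in\mathcal Q_k$ is *admissible* if either $r>e$ and $ar^2\le\delta^k\le\lambda ar^\gamma$ ( *large* ), or $1<r\le e$ and $ae^2\log r\le\delta^k\le\lambda ae^2\log r$ ( *small* ). **The family $\mathcal D^Z$.** For an admissible $P=P_{r,Q}(a)$, the set of sons is $s(P)=\{P_{\sqrt r,Q}(a/\sqrt r),P_{\sqrt r,Q}(a\sqrt r)\}$ if both of these are admissible, and $s(P)=\{P_{r,Q'}(a):Q'\in s_N(Q)\}$ otherwise; $s^1(P)=s(P)$, $s^{m+1}(P)=\bigcup_{P'\in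 s^m(P)}s(P')$. Put $p^\downarrow(P)=P_{r^3,Q}(a/r^2)$, $p^\uparrow(P)=P_{r^2,Q}(ar)$, $p^\leftrightarrow(P)=P_{r,p_N(Q)}(a)$, and $\mathcal S(P)=\{P_{r,Q'}(a):Q'\in\mathcal Q_j\}$ if $Q\in\mathcal Q_j$. Fix a large admissible $P_0=P_{r_0,Q_0}(1)$ and define recursively $P_{k+1}=p^\leftrightarrow(P_k)$ whenever this is admissible; at the successive values of $k$ for which it is not, $P_{k+1}$ is alternately $p^\uparrow(P_k)$ and $p^\downarrow(P_k)$, starting with $p^\uparrow$. For $k\ge0$ let $\mathcal S_k=\mathcal S(P_k)$; let $\widetilde{\mathcal S}_k=\emptyset$ if $P_{k+1}=p^\leftrightarrow(P_k)$ and $\widetilde{\mathcal S}_k=\mathcal S(P_{k+1}\setminus P_k)$ otherwise, where, if $P_k=P_{r,Q}(a)$, $P_{k+1}\setminus P_k$ stands (up to a null set) for the cylinder $P_{r,Q}(ar^2)$ when $P_{k+1}=p^\uparrow(P_k)$ and $P_{r^2,Q}(a/r^3)$ when $P_{k+1}=p^\downarrow(P_k)$. With $\widetilde{\mathcal S}_\ell^m=\bigcup_{P\in\widetilde{\mathcal S}_\ell}s^m(P)$, put $\mathcal D^Z_{-k}=\mathcal S_k\cup\widetilde{\mathcal S}_k\cup\bigcup_{\ell>k}\widetilde{\mathcal S}_\ell^{\ell-k}$ for $k\ge0$, $\mathcal D^Z_k=\bigcup_{P\in\mathcal D^Z_{k-1}}s(P)$ for $k\ge1$, and $\mathcal D^Z=\bigcup_{k\in\mathbb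 Z}\mathcal D^Z_k$. The "conversely" part means that the families $\mathcal E(f,\alpha)$ can be chosen so that their union over all $f,\alpha$ is the whole of $\mathcal D^Z$. *)

theory Defs
  imports "HOL-Analysis.Analysis"
begin

section \<open>Stratified Lie groups in exponential coordinates\<close>

text \<open>
  The exponential map of a simply connected nilpotent Lie group is a diffeomorphism, so a
  stratified group is represented on its Lie algebra, a finite-dimensional real vector
  space \<open>'v\<close>, with \<open>exp\<^sub>N\<close> the identity map. The fields are: the group law, the layers
  \<open>\<nn>\<^sub>j\<close> (indexed by all naturals, trivial outside \<open>{1..S}\<close>), the step \<open>S\<close>, and the fixed basis
  of each layer. The inner product of the type \<open>'v\<close> is used only through its topology and
  its Lebesgue measure.
\<close>

record 'v strat_group =
  op :: "'v \<Rightarrow> 'v \<Rightarrow> 'v"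
  layer :: "nat \<Rightarrow> 'v set"
  step :: nat
  frame :: "nat \<Rightarrow> 'v set"

primrec Ck :: "nat \<Rightarrow> ('a::real_normed_vector \<Rightarrow> 'b::real_normed_vector) \<Rightarrow> bool" where
  "Ck 0 f \<longleftrightarrow> continuous_on UNIV f"
| "Ck (Suc k) f \<longleftrightarrow> (\<forall>x. f differentiable (at x)) \<and> (\<forall>v. Ck k (\<lambda>x. frechet_derivative f (at x) v))"

definition smooth :: "('a::real_normed_vector \<Rightarrow> 'b::real_normed_vector) \<Rightarrow> bool" where
  "smooth f \<longleftrightarrow> (\<forall>k. Ck k f)"

definition left_field :: "('v::euclidean_space) strat_group \<Rightarrow> 'v \<Rightarrow> 'v \<Rightarrow> 'v" where
  "left_field N X x = vector_derivative (\<lambda>t. op N x (t *\<^sub>R X)) (at 0)"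

text \<open>The commutator at the identity of the left-invariant vector fields of \<open>X\<close> and \<open>Y\<close>.\<close>

definition bracket :: "('v::euclidean_space) strat_group \<Rightarrow> 'v \<Rightarrow> 'v \<Rightarrow> 'v" where
  "bracket N X Y = frechet_derivative (left_field N Y) (at 0) X
                 - frechet_derivative (left_field N X) (at 0) Y"

definition lie_subalgebra :: "('v::euclidean_space) strat_group \<Rightarrow> 'v set \<Rightarrow> bool" where
  "lie_subalgebra N W \<longleftrightarrow> subspace W \<and> (\<forall>x\<in>W. \<forall>y\<in>W. bracket N x y \<in> W)"

definition layer_decomp :: "('v::euclidean_space) strat_group \<Rightarrow> 'v \<Rightarrow> (nat \<Rightarrow> 'v) \<Rightarrow> bool" where
  "layer_decomp N x y \<longleftrightarrow> (\<forall>j. y j \<in> layer N j) \<and> x = (\<Sum>j=1..step N. y j)"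

definition dil :: "('v::euclidean_space) strat_group \<Rightarrow> real \<Rightarrow> 'v \<Rightarrow> 'v" where
  "dil N a x = (\<Sum>j=1..step N. a ^ j *\<^sub>R (THE y. layer_decomp N x y) j)"

text \<open>
  The equation \<open>op N (s *\<^sub>R x) (t *\<^sub>R x) = (s + t) *\<^sub>R x\<close> says that \<open>t \<mapsto> t *\<^sub>R x\<close>
  is the one-parameter subgroup with initial velocity \<open>x\<close>, i.e. that the coordinates are
  exponential; in particular the inverse of \<open>x\<close> is \<open>- x\<close>.
\<close>

definition stratified_lie_group :: "('v::euclidean_space) strat_group \<Rightarrow> bool" where
  "stratified_lie_group N \<longleftrightarrow>
     smooth (\<lambda>(x, y). op N x y) \<and>
     group (op N) 0 uminus \<and>
     (\<forall>x s t. op N (s *\<^sub>R x) (t *\<^sub>R x) = (s + t) *\<^sub>R x) \<and>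
     1 \<le> step N \<and>
     (\<forall>j. subspace (layer N j)) \<and>
     (\<forall>j. j \<notin> {1..step N} \<longrightarrow> layer N j = {0}) \<and>
     (\<forall>x. \<exists>!y. layer_decomp N x y) \<and>
     (\<forall>i j. \<forall>x\<in>layer N i. \<forall>y\<in>layer N j. bracket N x y \<in> layer N (i + j)) \<and>
     lie_subalgebra N hull layer N 1 = UNIV \<and>
     (\<forall>a>0. \<forall>x y. dil N a (op N x y) = op N (dil N a x) (dil N a y)) \<and>
     (\<forall>j. independent (frame N j) \<and> span (frame N j) = layer N j)"

subsection \<open>The Carnot--Caratheodory distance\<close>

text \<open>
  A horizontal curve \<open>c\<close> on \<open>[0,1]\<close> comes with its coefficients \<open>u\<close> in the left-invariant
  horizontal frame, whose Euclidean norm is the speed of \<open>c\<close>.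
\<close>

definition speed :: "('v::euclidean_space) strat_group \<Rightarrow> (real \<Rightarrow> 'v \<Rightarrow> real) \<Rightarrow> real \<Rightarrow> real" where
  "speed N u t = sqrt (\<Sum>X\<in>frame N 1. (u t X)\<^sup>2)"

definition horizontal ::
    "('v::euclidean_space) strat_group \<Rightarrow> (real \<Rightarrow> 'v) \<Rightarrow> (real \<Rightarrow> 'v \<Rightarrow> real) \<Rightarrow> bool" where
  "horizontal N c u \<longleftrightarrow>
     c piecewise_C1_differentiable_on {0..1} \<and>
     (\<exists>F. finite F \<and> (\<forall>t\<in>{0..1} - F.
        (c has_vector_derivative (\<Sum>X\<in>frame N 1. u t X *\<^sub>R left_field N X (c t)))
          (at t within {0..1}))) \<and>
     speed N u integrable_on {0..1}"

definition cc_dist :: "('v::euclidean_space) strat_group \<Rightarrow> 'v \<Rightarrow> 'v \<Rightarrow> real" where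
  "cc_dist N x y =
     Inf {integral {0..1} (speed N u) | c u. horizontal N c u \<and> c 0 = x \<and> c 1 = y}"

definition cc_ball :: "('v::euclidean_space) strat_group \<Rightarrow> 'v \<Rightarrow> real \<Rightarrow> 'v set" where
  "cc_ball N x r = {y. cc_dist N x y < r}"


section \<open>The solvable extension \<open>G\<close> of \<open>N\<close> by dilations\<close>

text \<open>
  The identity of \<open>G\<close> is \<open>(0, 1)\<close>, and \<open>\<gg>\<close> is its tangent space there, \<open>'v \<times> real\<close>; a
  left-invariant field is identified with its value at the identity.
\<close>

definition G_carrier :: "('v::euclidean_space \<times> real) set" where
  "G_carrier = UNIV \<times> {0<..}"

definition G_op :: "('v::euclidean_space) strat_group \<Rightarrow> 'v \<times> real \<Rightarrow> 'v \<times> real \<Rightarrow> 'v \<times> real" where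
  "G_op N x y = (op N (fst x) (dil N (snd x) (fst y)), snd x * snd y)"

definition right_haar :: "('v::euclidean_space \<times> real) measure" where
  "right_haar = density (restrict_space lborel G_carrier) (\<lambda>x. ennreal (1 / snd x))"

definition one_param_subgroup ::
    "('v::euclidean_space) strat_group \<Rightarrow> 'v \<times> real \<Rightarrow> (real \<Rightarrow> 'v \<times> real) \<Rightarrow> bool" where
  "one_param_subgroup N Z c \<longleftrightarrow>
     (\<forall>t. c t \<in> G_carrier) \<and> (\<forall>s t. c (s + t) = G_op N (c s) (c t)) \<and>
     (c has_vector_derivative Z) (at 0)"

definition G_exp :: "('v::euclidean_space) strat_group \<Rightarrow> 'v \<times> real \<Rightarrow> 'v \<times> real" where
  "G_exp N Z = (THE c. one_param_subgroup N Z c) 1"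

text \<open>\<open>X\<^sub>0\<close> is the velocity at \<open>t = 0\<close> of the curve \<open>(0, exp t)\<close>.\<close>

definition X0 :: "'v::euclidean_space \<times> real" where
  "X0 = (0, 1)"

definition g_basis :: "('v::euclidean_space) strat_group \<Rightarrow> ('v \<times> real) set" where
  "g_basis N = insert X0 ((\<lambda>X. (X, 0)) ` (\<Union>j\<in>{1..step N}. frame N j))"

definition g_inner :: "('v::euclidean_space) strat_group \<Rightarrow> 'v \<times> real \<Rightarrow> 'v \<times> real \<Rightarrow> real" where
  "g_inner N Z W =
     (\<Sum>e\<in>g_basis N. representation (g_basis N) Z e * representation (g_basis N) W e)"

definition unit_slope :: "('v::euclidean_space) strat_group \<Rightarrow> ('v \<times> real) set" where
  "unit_slope N = {Z. g_inner N Z X0 = 1}"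

subsection \<open>Flow measures\<close>

definition flow_density ::
    "('v::euclidean_space) strat_group \<Rightarrow> 'v \<times> real \<Rightarrow> ('v \<times> real \<Rightarrow> real) \<Rightarrow> bool" where
  "flow_density N Z \<phi> \<longleftrightarrow>
     \<phi> \<in> borel_measurable right_haar \<and>
     (\<forall>x\<in>G_carrier. 0 \<le> \<phi> x) \<and>
     (\<forall>x\<in>G_carrier. \<forall>t. \<phi> x = \<phi> (G_op N x (G_exp N (t *\<^sub>R Z))))"

definition flow_measure :: "('v::euclidean_space \<times> real \<Rightarrow> real) \<Rightarrow> ('v \<times> real) measure" where
  "flow_measure \<phi> = density right_haar (\<lambda>x. ennreal (\<phi> x))"

definition trace_measure :: "('v::euclidean_space \<times> real \<Rightarrow> real) \<Rightarrow> 'v measure" where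
  "trace_measure \<phi> = density lborel (\<lambda>n. ennreal (\<phi> (n, 1)))"

definition doubling :: "('v::euclidean_space) strat_group \<Rightarrow> 'v measure \<Rightarrow> bool" where
  "doubling N \<nu> \<longleftrightarrow>
     (\<forall>x. \<forall>r>0. 0 < emeasure \<nu> (cc_ball N x r) \<and> emeasure \<nu> (cc_ball N x r) < \<infinity>) \<and>
     (\<forall>C>1. \<exists>D>1. \<forall>x. \<forall>r>0.
        emeasure \<nu> (cc_ball N x (C * r)) \<le> ennreal D * emeasure \<nu> (cc_ball N x r))"

section \<open>Christ cubes\<close>

text \<open>
  A cube is recorded together with its generation, as a pair \<open>(k, Q)\<close> with \<open>Q \<in> \<Q> k\<close>.
\<close>

type_synonym 'v cube = "int \<times> 'v set"

definition cube_parent :: "(int \<Rightarrow> 'v set set) \<Rightarrow> 'v cube \<Rightarrow> 'v cube" where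
  "cube_parent \<Q> q = (fst q - 1, THE R. R \<in> \<Q> (fst q - 1) \<and> snd q \<subseteq> R)"

definition cube_sons :: "(int \<Rightarrow> 'v set set) \<Rightarrow> 'v cube \<Rightarrow> 'v cube set" where
  "cube_sons \<Q> q = {q'. snd q' \<in> \<Q> (fst q') \<and> cube_parent \<Q> q' = q}"

definition christ_cubes ::
    "('v::euclidean_space) strat_group \<Rightarrow> 'v measure \<Rightarrow> (int \<Rightarrow> 'v set set) \<Rightarrow>
     real \<Rightarrow> real \<Rightarrow> real \<Rightarrow> bool" where
  "christ_cubes N \<nu> \<Q> \<delta> C1 c \<longleftrightarrow>
     0 < \<delta> \<and> \<delta> < 1 \<and> 3 \<le> C1 \<and> 0 < c \<and>
     (\<forall>k. countable (\<Q> k) \<and> disjoint (\<Q> k) \<and> (\<forall>Q\<in>\<Q> k. open Q)) \<and>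
     (\<forall>k. emeasure \<nu> (UNIV - \<Union>(\<Q> k)) = 0) \<and>
     (\<forall>k. \<forall>Q\<in>\<Q> k. (\<exists>!R. R \<in> \<Q> (k - 1) \<and> Q \<subseteq> R) \<and>
        (\<forall>R\<in>\<Q> (k - 1). R \<noteq> snd (cube_parent \<Q> (k, Q)) \<longrightarrow> Q \<inter> R = {})) \<and>
     (\<forall>k. \<forall>Q\<in>\<Q> k. \<exists>n\<in>Q.
        cc_ball N n (c * \<delta> powi k) \<subseteq> Q \<and> Q \<subseteq> cc_ball N n (C1 * \<delta> powi k)) \<and>
     (\<forall>k. \<forall>Q\<in>\<Q> k.
        emeasure \<nu> (snd (cube_parent \<Q> (k, Q))) \<le> ennreal C1 * emeasure \<nu> Q \<and>
        finite (cube_sons \<Q> (k, Q)) \<and>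
        2 \<le> card (cube_sons \<Q> (k, Q)) \<and> real (card (cube_sons \<Q> (k, Q))) \<le> C1)"

section \<open>Cylinders and the family \<open>\<D>\<^sup>Z\<close>\<close>

text \<open>
  A cylinder \<open>P\<^sub>r\<^sub>,\<^sub>Q(a)\<close> is handled through its parameters \<open>(r, Q, a)\<close>, which it determines;
  \<open>cyl_set\<close> is the subset of \<open>G\<close> they stand for.
\<close>

type_synonym 'v cyl = "real \<times> 'v cube \<times> real"

definition cylinder ::
    "('v::euclidean_space) strat_group \<Rightarrow> 'v \<times> real \<Rightarrow> real \<Rightarrow> 'v set \<Rightarrow> real \<Rightarrow> ('v \<times> real) set" where
  "cylinder N Z r E a =
     {G_op N (n, 1) (G_exp N (t *\<^sub>R Z)) | n t. n \<in> E \<and> t \<in> {ln (a / r)<..<ln (a * r)}}"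

definition cyl_set ::
    "('v::euclidean_space) strat_group \<Rightarrow> 'v \<times> real \<Rightarrow> 'v cyl \<Rightarrow> ('v \<times> real) set" where
  "cyl_set N Z = (\<lambda>(r, q, a). cylinder N Z r (snd q) a)"

definition large_admissible :: "(int \<Rightarrow> 'v set set) \<Rightarrow> real \<Rightarrow> real \<Rightarrow> real \<Rightarrow> 'v cyl \<Rightarrow> bool" where
  "large_admissible \<Q> \<delta> gam lam = (\<lambda>(r, (k, Q), a).
     Q \<in> \<Q> k \<and> 0 < a \<and> exp 1 < r \<and>
     a * r\<^sup>2 \<le> \<delta> powi k \<and> \<delta> powi k \<le> lam * a * r powr gam)"

definition small_admissible :: "(int \<Rightarrow> 'v set set) \<Rightarrow> real \<Rightarrow> real \<Rightarrow> 'v cyl \<Rightarrow> bool" where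
  "small_admissible \<Q> \<delta> lam = (\<lambda>(r, (k, Q), a).
     Q \<in> \<Q> k \<and> 0 < a \<and> 1 < r \<and> r \<le> exp 1 \<and>
     a * (exp 1)\<^sup>2 * ln r \<le> \<delta> powi k \<and> \<delta> powi k \<le> lam * a * (exp 1)\<^sup>2 * ln r)"

definition admissible :: "(int \<Rightarrow> 'v set set) \<Rightarrow> real \<Rightarrow> real \<Rightarrow> real \<Rightarrow> 'v cyl \<Rightarrow> bool" where
  "admissible \<Q> \<delta> gam lam P \<longleftrightarrow>
     large_admissible \<Q> \<delta> gam lam P \<or> small_admissible \<Q> \<delta> lam P"

definition cyl_sons :: "(int \<Rightarrow> 'v set set) \<Rightarrow> real \<Rightarrow> real \<Rightarrow> real \<Rightarrow> 'v cyl \<Rightarrow> 'v cyl set" where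
  "cyl_sons \<Q> \<delta> gam lam = (\<lambda>(r, q, a).
     let P1 = (sqrt r, q, a / sqrt r); P2 = (sqrt r, q, a * sqrt r)
     in if admissible \<Q> \<delta> gam lam P1 \<and> admissible \<Q> \<delta> gam lam P2
        then {P1, P2} else {(r, q', a) | q'. q' \<in> cube_sons \<Q> q})"

definition all_sons ::
    "(int \<Rightarrow> 'v set set) \<Rightarrow> real \<Rightarrow> real \<Rightarrow> real \<Rightarrow> 'v cyl set \<Rightarrow> 'v cyl set" where
  "all_sons \<Q> \<delta> gam lam F = (\<Union>P\<in>F. cyl_sons \<Q> \<delta> gam lam P)"

definition parent_down :: "'v cyl \<Rightarrow> 'v cyl" where
  "parent_down = (\<lambda>(r, q, a). (r ^ 3, q, a / r\<^sup>2))"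

definition parent_up :: "'v cyl \<Rightarrow> 'v cyl" where
  "parent_up = (\<lambda>(r, q, a). (r\<^sup>2, q, a * r))"

definition parent_side :: "(int \<Rightarrow> 'v set set) \<Rightarrow> 'v cyl \<Rightarrow> 'v cyl" where
  "parent_side \<Q> = (\<lambda>(r, q, a). (r, cube_parent \<Q> q, a))"

definition translates :: "(int \<Rightarrow> 'v set set) \<Rightarrow> 'v cyl \<Rightarrow> 'v cyl set" where
  "translates \<Q> = (\<lambda>(r, q, a). {(r, (fst q, Q'), a) | Q'. Q' \<in> \<Q> (fst q)})"

text \<open>
  \<open>P\<^sub>k\<close>, paired with a flag telling whether the next vertical enlargement is upwards.
\<close>

primrec chain_state ::
    "(int \<Rightarrow> 'v set set) \<Rightarrow> real \<Rightarrow> real \<Rightarrow> real \<Rightarrow> 'v cyl \<Rightarrow> nat \<Rightarrow> 'v cyl \<times> bool" where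
  "chain_state \<Q> \<delta> gam lam P0 0 = (P0, True)"
| "chain_state \<Q> \<delta> gam lam P0 (Suc k) =
     (let (P, up) = chain_state \<Q> \<delta> gam lam P0 k
      in if admissible \<Q> \<delta> gam lam (parent_side \<Q> P) then (parent_side \<Q> P, up)
         else if up then (parent_up P, False) else (parent_down P, True))"

definition chain ::
    "(int \<Rightarrow> 'v set set) \<Rightarrow> real \<Rightarrow> real \<Rightarrow> real \<Rightarrow> 'v cyl \<Rightarrow> nat \<Rightarrow> 'v cyl" where
  "chain \<Q> \<delta> gam lam P0 k = fst (chain_state \<Q> \<delta> gam lam P0 k)"

text \<open>
  The cylinder that, up to a null set, is \<open>P' - P\<close> for \<open>P' = parent_up P\<close> or
  \<open>P' = parent_down P\<close>.
\<close>

definition cyl_diff :: "'v cyl \<Rightarrow> 'v cyl \<Rightarrow> 'v cyl" where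
  "cyl_diff P' P = (case P of (r, q, a) \<Rightarrow>
     if P' = parent_up P then (r, q, a * r\<^sup>2) else (r\<^sup>2, q, a / r ^ 3))"

definition side_family ::
    "(int \<Rightarrow> 'v set set) \<Rightarrow> real \<Rightarrow> real \<Rightarrow> real \<Rightarrow> 'v cyl \<Rightarrow> nat \<Rightarrow> 'v cyl set" where
  "side_family \<Q> \<delta> gam lam P0 k =
     (let P = chain \<Q> \<delta> gam lam P0 k; P' = chain \<Q> \<delta> gam lam P0 (Suc k)
      in if P' = parent_side \<Q> P then {} else translates \<Q> (cyl_diff P' P))"

definition D_family ::
    "(int \<Rightarrow> 'v set set) \<Rightarrow> real \<Rightarrow> real \<Rightarrow> real \<Rightarrow> 'v cyl \<Rightarrow> int \<Rightarrow> 'v cyl set" where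
  "D_family \<Q> \<delta> gam lam P0 i =
     (let s = all_sons \<Q> \<delta> gam lam;
          Dneg = (\<lambda>k. translates \<Q> (chain \<Q> \<delta> gam lam P0 k) \<union> side_family \<Q> \<delta> gam lam P0 k
                    \<union> (\<Union>l\<in>{k<..}. (s ^^ (l - k)) (side_family \<Q> \<delta> gam lam P0 l)))
      in if i \<le> 0 then Dneg (nat (- i)) else (s ^^ nat i) (Dneg 0))"

definition DZ ::
    "('v::euclidean_space) strat_group \<Rightarrow> 'v \<times> real \<Rightarrow> (int \<Rightarrow> 'v set set) \<Rightarrow>
     real \<Rightarrow> real \<Rightarrow> real \<Rightarrow> 'v cyl \<Rightarrow> ('v \<times> real) set set" where
  "DZ N Z \<Q> \<delta> gam lam P0 = cyl_set N Z ` (\<Union>i. D_family \<Q> \<delta> gam lam P0 i)"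

end

theory Submission
  imports Defs
begin

text \<open>
  In the coordinates \<open>\<Phi> (n, t) = (n, 1) exp (t Z)\<close> a flow measure is the product of its trace on \<open>N\<close> and
  Lebesgue measure, since \<open>\<phi>\<close> is constant in \<open>t\<close> and right translations of \<open>N\<close> preserve Lebesgue measure.
  Cylinders become products of a cube and an interval, and the generations of \<open>\<D>\<^sup>Z\<close> become nested
  partitions, in which the measure grows from a set to its parent by a factor between \<open>C1 / (C1 - 1)\<close> and
  \<open>C1\<close>. Because of this growth every set with \<open>|f|\<close>-average above \<open>\<alpha>\<close> lies in a maximal one; the maximal sets
  form \<open>E f \<alpha>\<close>. Outside them \<open>|f| \<le> \<alpha>\<close> almost everywhere, because the partitions shrink to points. For the
  converse, \<open>f\<close> is the indicator function of \<open>P\<close>.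
\<close>

section \<open>Stopping times in nested partitions\<close>

text \<open>What travels through the generations is not admissibility, which is two-sided and
  changes form at radius exp 1, but only the lower bound \<open>high\<close>. Sons inherit it, and
  an upper bound is recovered whenever a vertical subdivision takes place, because its halves are
  admissible by definition. The constants have these origins. If the sideways parent of a chain
  cylinder with radius r, center a and generation k is not admissible, \<open>gam\<close> \<ge> 5
  and \<delta> * \<open>lam\<close> > exp 3 give exp 3 * a * r^5 \<le> \<delta>^k. The fifth power
  is what the upward parent needs, as (a r) (r^2)^2 = a r^5; exp 3 is what the cylinders added above
  need when r \<le> exp 2. Vertical moves multiply the length of the time interval by 3/2, 2 or 3,
  and C1 \<ge> 3 places these factors between C1 / (C1 - 1) and C1, the bounds valid for cubes. The
  second component of Z is 1, and every such vector is the image of X0 under conjugation by a point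
  of N. Hence exp (t Z) has an explicit formula, and its uniqueness is all that remains to be proved
  about it.\<close>

locale dyadic_system =
  fixes M :: "'a::polish_space measure" and \<Omega> :: "'a set" and D :: "int \<Rightarrow> 'a set set"
    and C \<theta> :: real
  assumes Omega: "\<Omega> \<in> sets borel"
    and sets_M: "sets M = sets (restrict_space borel \<Omega>)"
    and countable_D: "countable (D i)"
    and disjoint_D: "disjoint (D i)"
    and sets_D: "P \<in> D i \<Longrightarrow> P \<in> sets M"
    and pos_D: "P \<in> D i \<Longrightarrow> 0 < emeasure M P"
    and finite_D: "P \<in> D i \<Longrightarrow> emeasure M P < \<infinity>"
    and theta: "1 < \<theta>"
    and parent_D: "P \<in> D i \<Longrightarrow>
      \<exists>R\<in>D (i - 1). P \<subseteq> R \<and> \<theta> * measure M P \<le> measure M R \<and> measure M R \<le> C * measure M P"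
    and shrink_D: "AE x in M. \<forall>U. open U \<longrightarrow> x \<in> U \<longrightarrow> (\<exists>i. \<exists>P\<in>D i. x \<in> P \<and> P \<subseteq> U)"
begin

definition "DD = (\<Union>i. D i)"

lemma countable_DD: "countable DD"
  unfolding DD_def using countable_D by auto

lemma DD_props:
  assumes "P \<in> DD"
  shows "P \<in> sets M" "0 < emeasure M P" "emeasure M P < \<infinity>" "0 < measure M P"
    "emeasure M P = ennreal (measure M P)"
proof -
  show "P \<in> sets M" "0 < emeasure M P" "emeasure M P < \<infinity>"
    using assms sets_D pos_D finite_D unfolding DD_def by auto
  then show "emeasure M P = ennreal (measure M P)"
    by (simp add: emeasure_eq_ennreal_measure)
  then show "0 < measure M P"
    using \<open>0 < emeasure M P\<close> by (simp)
qed

lemma DD_nonempty: "P \<in> DD \<Longrightarrow> P \<noteq> {}"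
  using DD_props(2) by force

lemma ancestor:
  assumes "P \<in> D i"
  shows "\<exists>R\<in>D (i - int n). P \<subseteq> R \<and> (0 < n \<longrightarrow> \<theta> * measure M P \<le> measure M R)"
proof (induction n)
  case 0
  then show ?case using assms by auto
next
  case (Suc n)
  then obtain R where R: "R \<in> D (i - int n)" "P \<subseteq> R" "0 < n \<longrightarrow> \<theta> * measure M P \<le> measure M R"
    by auto
  obtain R' where R': "R' \<in> D (i - int n - 1)" "R \<subseteq> R'" "\<theta> * measure M R \<le> measure M R'"
    using parent_D[OF R(1)] by auto
  have PR: "measure M P \<le> measure M R"
    using measure_mono_fmeasurable[OF R(2)] sets_D[OF assms] sets_D[OF R(1)] finite_D[OF R(1)]
    by (auto simp: fmeasurable_def)
  have "\<theta> * measure M P \<le> \<theta> * measure M R" using PR theta by simp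
  then show ?case using R R' by (intro bexI[of _ R']) (auto simp: algebra_simps)
qed

text \<open>The ancestor of P in the generation of R is either R itself or disjoint from R, and this
  decides the alternative.\<close>

lemma level_cases:
  assumes "P \<in> D i" "R \<in> D j" "j \<le> i"
  shows "P \<inter> R = {} \<or> (P \<subseteq> R \<and> (j = i \<longrightarrow> P = R) \<and> (j < i \<longrightarrow> \<theta> * measure M P \<le> measure M R))"
proof -
  obtain S where S: "S \<in> D j" "P \<subseteq> S" "j < i \<longrightarrow> \<theta> * measure M P \<le> measure M S"
    using ancestor[OF assms(1), of "nat (i - j)"] assms(3) by auto
  show ?thesis
  proof (cases "S = R")
    case True
    then show ?thesis
      using S assms disjointD[OF disjoint_D[of i], of P R] by blast
  next
    case False
    then show ?thesis using disjointD[OF disjoint_D S(1) assms(2)] S(2) by blast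
  qed
qed

lemma nested:
  assumes "P \<in> DD" "R \<in> DD"
  shows "P \<inter> R = {} \<or> P \<subseteq> R \<or> R \<subseteq> P"
proof -
  obtain i j where "P \<in> D i" "R \<in> D j" using assms by (auto simp: DD_def)
  then show ?thesis using level_cases[of P i R j] level_cases[of R j P i]
    by (cases "j \<le> i") (auto simp: Int_commute)
qed

text \<open>Members are nonempty, so a strict inclusion leaves only the case of
  \<open>level_cases\<close> in which P belongs to a strictly finer generation than R.\<close>

lemma growth:
  assumes "P \<in> DD" "R \<in> DD" "P \<subset> R"
  shows "\<theta> * measure M P \<le> measure M R"
proof -
  obtain i j where ij: "P \<in> D i" "R \<in> D j" using assms by (auto simp: DD_def)
  have "P \<inter> R \<noteq> {}" using DD_nonempty assms by auto
  then show ?thesis using level_cases[of P i R j] level_cases[of R j P i] ij assms(3)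
    by (cases "j \<le> i") (auto simp: Int_commute)
qed

lemma parent_DD:
  assumes "P \<in> DD"
  shows "\<exists>R\<in>DD. P \<subset> R \<and> measure M R \<le> C * measure M P"
proof -
  obtain i where i: "P \<in> D i" using assms by (auto simp: DD_def)
  obtain R where R: "R \<in> D (i - 1)" "P \<subseteq> R" "\<theta> * measure M P \<le> measure M R"
    "measure M R \<le> C * measure M P" using parent_D[OF i] by auto
  have "P \<noteq> R" using R(3) theta DD_props(4)[OF assms] by auto
  then show ?thesis using R by (auto simp: DD_def)
qed

section \<open>Maximal members of a subfamily\<close>

definition maxs :: "'a set set \<Rightarrow> 'a set set" where
  "maxs F = {R\<in>F. \<forall>R'\<in>F. R \<subseteq> R' \<longrightarrow> R' = R}"

lemma maxs_subset: "maxs F \<subseteq> F" by (auto simp: maxs_def)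

lemma disjoint_maxs:
  assumes "F \<subseteq> DD"
  shows "disjoint (maxs F)"
proof (rule disjointI)
  fix P R assume "P \<in> maxs F" "R \<in> maxs F" "P \<noteq> R"
  then show "P \<inter> R = {}" using nested[of P R] assms by (auto simp: maxs_def)
qed

text \<open>Above P there is a member of F whose measure exceeds the supremum divided by \<theta>.
  It is maximal, since a strictly larger member would have measure above the supremum by
  \<open>growth\<close>.\<close>

lemma maxs_above:
  assumes "F \<subseteq> DD" "\<And>P. P \<in> F \<Longrightarrow> measure M P \<le> K" "P \<in> F"
  shows "\<exists>R\<in>maxs F. P \<subseteq> R"
proof -
  define S where "S = measure M ` {R\<in>F. P \<subseteq> R}"
  have bdd: "bdd_above S" using assms(2) by (auto simp: S_def bdd_above_def)
  have inS: "measure M P \<in> S" using assms(3) by (auto simp: S_def)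
  have pos: "0 < measure M P" using DD_props(4) assms by auto
  then have SP: "0 < Sup S" using cSup_upper[OF inS bdd] by linarith
  then have "Sup S / \<theta> < Sup S" using theta by (simp add: field_simps)
  then obtain s where "s \<in> S" "Sup S / \<theta> < s"
    using less_cSup_iff[of S] bdd inS by blast
  then obtain R where R: "R \<in> F" "P \<subseteq> R" "Sup S / \<theta> < measure M R" by (auto simp: S_def)
  have "R' = R" if "R' \<in> F" "R \<subseteq> R'" for R'
  proof (rule ccontr)
    assume "R' \<noteq> R"
    then have "\<theta> * measure M R \<le> measure M R'" using growth[of R R'] that R assms(1) by auto
    moreover have "measure M R' \<le> Sup S"
      using that R by (intro cSup_upper[OF _ bdd]) (auto simp: S_def)
    ultimately show False using R(3) theta by (simp add: field_simps)
  qed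
  then show ?thesis using R by (auto simp: maxs_def)
qed

lemma Union_maxs:
  assumes "F \<subseteq> DD" "\<And>P. P \<in> F \<Longrightarrow> measure M P \<le> K"
  shows "\<Union>(maxs F) = \<Union>F"
proof
  show "\<Union>(maxs F) \<subseteq> \<Union>F" using maxs_subset[of F] by blast
  show "\<Union>F \<subseteq> \<Union>(maxs F)" using maxs_above[OF assms] by (meson Sup_least Sup_upper order_trans)
qed

section \<open>Stopped sets for the averages of the norm of f\<close>

definition mass :: "('a \<Rightarrow> 'k::{real_normed_field, banach, second_countable_topology}) \<Rightarrow> 'a measure" where
  "mass f = density M (\<lambda>x. ennreal (norm (f x)))"

text \<open>The averages are compared through the measure \<open>mass f\<close> instead of through
  integrals of f, so that the stopped family visibly depends only on the class of f modulo null
  sets, as used in \<open>stop_cong_AE\<close>.\<close>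

definition bad :: "('a \<Rightarrow> 'k::{real_normed_field, banach, second_countable_topology}) \<Rightarrow> real \<Rightarrow> 'a set set" where
  "bad f \<alpha> = {P\<in>DD. ennreal \<alpha> * emeasure M P < emeasure (mass f) P}"

definition stop :: "('a \<Rightarrow> 'k::{real_normed_field, banach, second_countable_topology}) \<Rightarrow> real \<Rightarrow> 'a set set" where
  "stop f \<alpha> = maxs (bad f \<alpha>)"

lemma emeasure_mass:
  assumes "integrable M f" "P \<in> sets M"
  shows "emeasure (mass f) P = ennreal (LINT x:P|M. norm (f x))"
proof -
  have "emeasure (mass f) P = (\<integral>\<^sup>+x. ennreal (norm (f x)) * indicator P x \<partial>M)"
    unfolding mass_def using assms by (subst emeasure_density) auto
  also have "\<dots> = (\<integral>\<^sup>+x. ennreal (indicator P x *\<^sub>R norm (f x)) \<partial>M)"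
    by (intro nn_integral_cong) (auto simp: indicator_def)
  also have "\<dots> = ennreal (LINT x:P|M. norm (f x))"
    unfolding set_lebesgue_integral_def using assms
    by (intro nn_integral_eq_integral integrable_mult_indicator) auto
  finally show ?thesis .
qed

lemma sets_mass [simp]: "sets (mass f) = sets M" by (simp add: mass_def)

lemma set_integral_norm_le:
  fixes f :: "'a \<Rightarrow> 'k::{real_normed_field, banach, second_countable_topology}"
  assumes "integrable M f" "P \<in> sets M"
  shows "(LINT x:P|M. norm (f x)) \<le> (LINT x|M. norm (f x))"
  unfolding set_lebesgue_integral_def using assms
  by (intro integral_mono integrable_mult_indicator) (auto simp: indicator_def)

lemma bad_iff:
  assumes "integrable M f" "P \<in> DD" "0 < \<alpha>"
  shows "P \<in> bad f \<alpha> \<longleftrightarrow> \<alpha> * measure M P < (LINT x:P|M. norm (f x))"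
  using assms DD_props(4,5)[OF assms(2)] emeasure_mass[OF assms(1) DD_props(1)[OF assms(2)]]
  by (auto simp: bad_def ennreal_mult[symmetric] ennreal_less_iff)

lemma bad_subset: "bad f \<alpha> \<subseteq> DD" by (auto simp: bad_def)

text \<open>Chebyshev's bound. It supplies the uniform bound on measures without which maximal bad
  sets might not exist.\<close>

lemma bad_bounded:
  assumes "integrable M f" "0 < \<alpha>" "P \<in> bad f \<alpha>"
  shows "measure M P \<le> (LINT x|M. norm (f x)) / \<alpha>"
proof -
  have P: "P \<in> DD" using assms by (auto simp: bad_def)
  then have "\<alpha> * measure M P < (LINT x:P|M. norm (f x))" using bad_iff assms by blast
  also have "\<dots> \<le> (LINT x|M. norm (f x))"
    using set_integral_norm_le[OF assms(1) DD_props(1)[OF P]] .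
  finally show ?thesis using assms(2) by (simp add: field_simps)
qed

lemma Union_stop:
  assumes "integrable M f" "0 < \<alpha>"
  shows "\<Union>(stop f \<alpha>) = \<Union>(bad f \<alpha>)"
  unfolding stop_def by (rule Union_maxs[OF bad_subset bad_bounded[OF assms]])

lemma stop_subset: "stop f \<alpha> \<subseteq> DD"
  unfolding stop_def using maxs_subset[of "bad f \<alpha>"] bad_subset[of f \<alpha>] by (rule subset_trans)

lemma countable_stop: "countable (stop f \<alpha>)"
  using countable_subset[OF stop_subset countable_DD] .

text \<open>By maximality the next larger member is not bad, and passing to it multiplies the
  measure by at most C.\<close>

lemma stop_average:
  assumes "integrable M f" "0 < \<alpha>" "P \<in> stop f \<alpha>"
  shows "(LINT x:P|M. norm (f x)) \<le> C * \<alpha> * measure M P"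
proof -
  have P: "P \<in> DD" using assms(3) stop_subset by auto
  obtain R where R: "R \<in> DD" "P \<subset> R" "measure M R \<le> C * measure M P" using parent_DD[OF P] by auto
  have "R \<notin> bad f \<alpha>" using assms(3) R(2) by (auto simp: stop_def maxs_def)
  then have "(LINT x:R|M. norm (f x)) \<le> \<alpha> * measure M R"
    using bad_iff[OF assms(1) R(1) assms(2)] by simp
  moreover have "(LINT x:P|M. norm (f x)) \<le> (LINT x:R|M. norm (f x))"
    using assms(1) R(2) DD_props(1)[OF P] DD_props(1)[OF R(1)] unfolding set_lebesgue_integral_def
    by (intro integral_mono integrable_mult_indicator) (auto simp: indicator_def)
  moreover have "\<alpha> * measure M R \<le> \<alpha> * (C * measure M P)" using R(3) assms(2) by simp
  ultimately show ?thesis by (simp add: algebra_simps)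
qed

lemma mass_le_Union:
  assumes "F \<subseteq> DD" "disjoint F" "\<And>P. P \<in> F \<Longrightarrow> P \<notin> bad f \<alpha>"
  shows "emeasure (mass f) (\<Union>F) \<le> ennreal \<alpha> * emeasure M (\<Union>F)"
proof -
  have cF: "countable F" using countable_subset[OF assms(1) countable_DD] .
  have dF: "disjoint_family_on (\<lambda>P. P) F"
    using assms(2) by (auto simp: disjoint_family_on_def disjoint_def)
  have sF: "P \<in> sets M" if "P \<in> F" for P using that assms(1) DD_props(1) by auto
  have "emeasure (mass f) (\<Union>F) = (\<integral>\<^sup>+P. emeasure (mass f) P \<partial>count_space F)"
    using emeasure_UN_countable[of F "\<lambda>P. P" "mass f"] cF dF sF by auto
  also have "\<dots> \<le> (\<integral>\<^sup>+P. ennreal \<alpha> * emeasure M P \<partial>count_space F)"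
    using assms by (intro nn_integral_mono) (force simp: bad_def not_less)
  also have "\<dots> = ennreal \<alpha> * (\<integral>\<^sup>+P. emeasure M P \<partial>count_space F)"
    by (intro nn_integral_cmult) auto
  also have "(\<integral>\<^sup>+P. emeasure M P \<partial>count_space F) = emeasure M (\<Union>F)"
    using emeasure_UN_countable[of F "\<lambda>P. P" M] cF dF sF by auto
  finally show ?thesis .
qed

text \<open>This replaces Lebesgue differentiation: a set on which \<open>norm f > \<alpha>\<close> outside the stopped sets is
  covered, within a slightly larger open set, by disjoint members whose averages are at most \<open>\<alpha>\<close>.\<close>

lemma AE_norm_le_outside_stop:
  assumes f: "integrable M f" and \<alpha>: "0 < \<alpha>"
  shows "AE x in M. x \<notin> \<Union>(stop f \<alpha>) \<longrightarrow> norm (f x) \<le> \<alpha>"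
proof -
  have fm [measurable]: "f \<in> borel_measurable M" using f by auto
  have setsU: "\<Union>(stop f \<alpha>) \<in> sets M"
    using countable_stop stop_subset[of f \<alpha>] DD_props(1) by (intro sets.countable_Union) auto
  define A where "A = {x\<in>space M. \<alpha> < norm (f x)} - \<Union>(stop f \<alpha>)"
  have A: "A \<in> sets M" unfolding A_def using setsU by measurable
  obtain Nu where Nu: "Nu \<in> null_sets M"
    and shrink: "\<And>x U. x \<in> space M - Nu \<Longrightarrow> open U \<Longrightarrow> x \<in> U \<Longrightarrow> \<exists>P\<in>DD. x \<in> P \<and> P \<subseteq> U"
  proof -
    obtain Nu where "Nu \<in> null_sets M" "{x\<in>space M. \<not> (\<forall>U. open U \<longrightarrow> x \<in> U \<longrightarrow> (\<exists>i. \<exists>P\<in>D i. x \<in> P \<and> P \<subseteq> U))} \<subseteq> Nu"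
      using shrink_D by (rule AE_E) (use null_setsI in blast)
    then have sub: "\<forall>U. open U \<longrightarrow> x \<in> U \<longrightarrow> (\<exists>i. \<exists>P\<in>D i. x \<in> P \<and> P \<subseteq> U)" if "x \<in> space M - Nu" for x
      using that by blast
    show thesis
    proof (rule that[OF \<open>Nu \<in> null_sets M\<close>])
      fix x U assume x: "x \<in> space M - Nu" and U: "open U" "x \<in> U"
      obtain i P where "P \<in> D i" "x \<in> P" "P \<subseteq> U" using sub[OF x, rule_format, OF U] by blast
      then show "\<exists>P\<in>DD. x \<in> P \<and> P \<subseteq> U" unfolding DD_def by (intro bexI[of _ P]) auto
    qed
  qed
  \<comment> \<open>A point of A lies in no stopped set, and by \<open>Union_stop\<close> these
    cover every bad set.\<close>
  have notbad: "P \<notin> bad f \<alpha>" if "P \<in> DD" "P \<inter> A \<noteq> {}" for P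
    using that Union_stop[OF f \<alpha>] unfolding A_def by blast
  \<comment> \<open>The claim is localized to a single member R, of finite measure; countably many
    of them cover A up to a null set.\<close>
  have null: "emeasure M (A \<inter> R) = 0" if R: "R \<in> DD" for R
  proof -
    define B where "B = A \<inter> R - Nu"
    have B: "B \<in> sets M" using A DD_props(1)[OF R] Nu by (auto simp: B_def)
    have BR: "B \<subseteq> R" by (auto simp: B_def)
    have Bfin: "emeasure M B < \<infinity>"
      using emeasure_mono[OF BR DD_props(1)[OF R]] DD_props(3)[OF R] by auto
    have Bborel: "B \<in> sets borel" using B Omega sets_M
      by (auto simp: sets_restrict_space)
    \<comment> \<open>The restriction of M to R, pushed forward to the whole space, is a finite
      Borel measure on a Polish space and hence outer regular.\<close>
    define M' where "M' = distr (density M (indicator R)) borel (\<lambda>x. x)"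
    have idm: "(\<lambda>x. x) \<in> M \<rightarrow>\<^sub>M borel"
      using sets_M measurable_cong_sets[OF sets_M refl] measurable_restrict_space1[of "\<lambda>x. x" borel borel \<Omega>] by auto
    have eM': "emeasure M' S = emeasure M (R \<inter> S)" if "S \<in> sets borel" for S
    proof -
      have S': "S \<inter> space M \<in> sets M" using measurable_sets[OF idm that] by simp
      have "emeasure M' S = emeasure (density M (indicator R)) (S \<inter> space M)"
        unfolding M'_def using that idm by (subst emeasure_distr) auto
      also have "\<dots> = (\<integral>\<^sup>+x. indicator R x * indicator (S \<inter> space M) x \<partial>M)"
        using S' DD_props(1)[OF R] by (subst emeasure_density) auto
      also have "\<dots> = (\<integral>\<^sup>+x. indicator (R \<inter> (S \<inter> space M)) x \<partial>M)"
        by (intro nn_integral_cong) (auto simp: indicator_def)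
      also have "\<dots> = emeasure M (R \<inter> (S \<inter> space M))"
        using S' DD_props(1)[OF R] by (intro nn_integral_indicator) auto
      also have "R \<inter> (S \<inter> space M) = R \<inter> S" using sets.sets_into_space[OF DD_props(1)[OF R]] by auto
      finally show ?thesis .
    qed
    have "emeasure M' (space M') \<noteq> \<infinity>"
      using eM'[of UNIV] DD_props(3)[OF R] by (simp add: M'_def)
    have setsM': "sets M' = sets borel" by (simp add: M'_def)
    have le: "emeasure (mass f) B \<le> ennreal \<alpha> * emeasure M B + ennreal \<alpha> * ennreal e" if e: "0 < e" for e
    proof -
      have MB: "emeasure M' B = emeasure M B" using eM'[OF Bborel] BR by (simp add: Int_absorb1)
      have "(INF U\<in>{U. B \<subseteq> U \<and> open U}. emeasure M' U) = emeasure M' B"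
        by (rule outer_regular[symmetric]) (use setsM' \<open>emeasure M' (space M') \<noteq> \<infinity>\<close> Bborel in auto)
      also have "\<dots> < emeasure M B + ennreal e" using MB e Bfin by (simp add: ennreal_add_left_cancel_less)
      finally obtain U where U: "B \<subseteq> U" "open U" "emeasure M' U < emeasure M B + ennreal e"
        by (auto simp: INF_less_iff)
      define F where "F = {P\<in>DD. P \<subseteq> U \<inter> R \<and> P \<inter> A \<noteq> {}}"
      have FD: "F \<subseteq> DD" by (auto simp: F_def)
      have bF: "measure M P \<le> measure M R" if "P \<in> F" for P
        using that DD_props[OF R] DD_props[of P]
        by (intro measure_mono_fmeasurable) (auto simp: F_def fmeasurable_def)
      define V where "V = \<Union>(maxs F)"
      have VF: "V = \<Union>F" unfolding V_def by (rule Union_maxs[OF FD bF])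
      have BV: "B \<subseteq> V"
      proof
        fix x assume x: "x \<in> B"
        then have "x \<in> space M - Nu" using sets.sets_into_space[OF B] by (auto simp: B_def)
        then obtain P where P: "P \<in> DD" "x \<in> P" "P \<subseteq> U" using shrink U x by blast
        have xR: "x \<in> R" "x \<in> A" using x by (auto simp: B_def)
        \<comment> \<open>The small member P found by \<open>shrink\<close> may be larger than R; in
          that case R itself lies in U and belongs to F.\<close>
        have "P \<subseteq> R \<or> R \<subseteq> P" using nested[OF P(1) R] P(2) xR by auto
        then have "P \<in> F \<or> R \<in> F" using P R xR by (auto simp: F_def)
        then show "x \<in> V" using VF P xR by auto
      qed
      have mF: "maxs F \<subseteq> DD" using maxs_subset FD by auto
      have V: "V \<in> sets M" unfolding V_def
        using countable_subset[OF mF countable_DD] mF DD_props(1)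
        by (intro sets.countable_Union) auto
      have VU: "V \<subseteq> R \<inter> U" using VF by (auto simp: F_def)
      have Um: "R \<inter> U \<in> sets M"
      proof -
        have "U \<inter> space M \<in> sets M" using measurable_sets[OF idm, of U] U(2) by auto
        then have "R \<inter> (U \<inter> space M) \<in> sets M" using DD_props(1)[OF R] by auto
        moreover have "R \<inter> (U \<inter> space M) = R \<inter> U" using sets.sets_into_space[OF DD_props(1)[OF R]] by auto
        ultimately show ?thesis by simp
      qed
      have "emeasure (mass f) B \<le> emeasure (mass f) V"
        using BV V by (intro emeasure_mono) auto
      also have "\<dots> \<le> ennreal \<alpha> * emeasure M V" unfolding V_def
      proof (rule mass_le_Union[OF mF disjoint_maxs[OF FD]])
        show "P \<notin> bad f \<alpha>" if "P \<in> maxs F" for P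
          using that notbad maxs_subset by (auto simp: F_def maxs_def)
      qed
      also have "\<dots> \<le> ennreal \<alpha> * (emeasure M B + ennreal e)"
        using emeasure_mono[OF VU Um] U(3) eM'[of U] U(2) by (intro mult_left_mono) auto
      finally show ?thesis by (simp add: distrib_left)
    qed
    have le': "emeasure (mass f) B \<le> ennreal \<alpha> * emeasure M B"
    proof (rule ennreal_le_epsilon)
      fix e :: real assume e: "0 < e"
      then show "emeasure (mass f) B \<le> ennreal \<alpha> * emeasure M B + ennreal e"
        using le[of "e / \<alpha>"] \<alpha> by (simp add: ennreal_mult[symmetric])
    qed
    have intB: "set_integrable M B (\<lambda>x. norm (f x))"
      unfolding set_integrable_def using f B by (intro integrable_mult_indicator) auto
    have intB': "set_integrable M B (\<lambda>x. \<alpha>)"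
      unfolding set_integrable_def using B Bfin by auto
    have "(LINT x:B|M. norm (f x)) \<le> \<alpha> * measure M B"
    proof -
      have "ennreal (LINT x:B|M. norm (f x)) \<le> ennreal (\<alpha> * measure M B)"
        using le' emeasure_mass[OF f B] \<alpha> Bfin
        by (simp add: emeasure_eq_ennreal_measure ennreal_mult)
      then show ?thesis using \<alpha> by (simp add: ennreal_le_iff)
    qed
    \<comment> \<open>On B the integrand \<open>norm (f x) - \<alpha>\<close> is strictly positive,
      so a nonpositive integral forces B to be null.\<close>
    then have le0: "(LINT x:B|M. norm (f x) - \<alpha>) \<le> 0"
      using set_integral_diff(2)[OF intB intB'] B Bfin
      by (simp add: set_lebesgue_integral_def mult.commute)
    have nn: "0 \<le> indicator B x *\<^sub>R (norm (f x) - \<alpha>)" for x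
      by (auto simp: indicator_def B_def A_def)
    have int: "integrable M (\<lambda>x. indicator B x *\<^sub>R (norm (f x) - \<alpha>))"
      using set_integral_diff(1)[OF intB intB'] by (simp add: set_integrable_def)
    have "(LINT x|M. indicator B x *\<^sub>R (norm (f x) - \<alpha>)) = 0"
      using le0 integral_nonneg_AE[of "\<lambda>x. indicator B x *\<^sub>R (norm (f x) - \<alpha>)" M] nn
      unfolding set_lebesgue_integral_def by (auto intro: antisym)
    then have "AE x in M. indicator B x *\<^sub>R (norm (f x) - \<alpha>) = 0"
      using integral_nonneg_eq_0_iff_AE[OF int] nn by auto
    then have "AE x in M. x \<notin> B"
      by eventually_elim (auto simp: indicator_def B_def A_def split: if_splits)
    then have "B \<in> null_sets M" using AE_iff_null_sets[OF B] by simp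
    then have "B \<union> Nu \<in> null_sets M" using Nu by auto
    then have "A \<inter> R \<in> null_sets M"
      by (rule null_sets_subset) (use A DD_props(1)[OF R] in \<open>auto simp: B_def\<close>)
    then show ?thesis by auto
  qed
  have "(\<Union>R\<in>DD. A \<inter> R) \<in> null_sets M"
    using null A DD_props(1) by (intro null_sets_UN' countable_DD) (auto simp: null_sets_def)
  then have "(\<Union>R\<in>DD. A \<inter> R) \<union> Nu \<in> null_sets M" using Nu by auto
  moreover have "A \<subseteq> (\<Union>R\<in>DD. A \<inter> R) \<union> Nu"
  proof
    fix x assume x: "x \<in> A"
    then have "x \<in> space M" by (auto simp: A_def)
    then show "x \<in> (\<Union>R\<in>DD. A \<inter> R) \<union> Nu" using shrink[of x UNIV] x by auto
  qed
  ultimately have "A \<in> null_sets M" using A null_sets_subset by blast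
  then have "AE x in M. x \<notin> A" by (rule AE_not_in)
  then show ?thesis using AE_space by eventually_elim (auto simp: A_def)
qed

section \<open>Averages, the functions b and g, and the decomposition\<close>

definition avg :: "('a \<Rightarrow> 'k::{real_normed_field, banach, second_countable_topology}) \<Rightarrow> 'a set \<Rightarrow> 'k" where
  "avg f P = (LINT x:P|M. f x) /\<^sub>R measure M P"

definition osc :: "('a \<Rightarrow> 'k::{real_normed_field, banach, second_countable_topology}) \<Rightarrow> 'a set \<Rightarrow> 'a \<Rightarrow> 'k" where
  "osc f P x = indicator P x *\<^sub>R (f x - avg f P)"

lemma norm_avg:
  assumes "P \<in> DD"
  shows "measure M P * norm (avg f P) \<le> (LINT x:P|M. norm (f x))"
proof -
  have "norm (LINT x:P|M. f x) \<le> (LINT x:P|M. norm (f x))"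
    unfolding set_lebesgue_integral_def
    using integral_norm_bound[of M "\<lambda>x. indicator P x *\<^sub>R f x"] by simp
  then show ?thesis using DD_props(4)[OF assms] by (simp add: avg_def mult.assoc[symmetric])
qed

lemma osc_props:
  assumes f: "integrable M f" and P: "P \<in> DD"
  shows "integrable M (osc f P)" "(LINT x:P|M. osc f P x) = 0"
    "(\<integral>\<^sup>+x. ennreal (norm (osc f P x)) \<partial>M) \<le> 2 * emeasure (mass f) P"
proof -
  have i1: "set_integrable M P f"
    unfolding set_integrable_def using f DD_props[OF P] by (intro integrable_mult_indicator) auto
  have i2: "set_integrable M P (\<lambda>x. avg f P)"
    unfolding set_integrable_def using DD_props[OF P] by auto
  show int: "integrable M (osc f P)"
    using set_integral_diff(1)[OF i1 i2] unfolding osc_def set_integrable_def .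
  have "(LINT x:P|M. osc f P x) = (LINT x:P|M. f x - avg f P)"
    unfolding set_lebesgue_integral_def osc_def by (intro Bochner_Integration.integral_cong) (auto simp: indicator_def)
  also have "\<dots> = (LINT x:P|M. f x) - (LINT x:P|M. avg f P)" by (rule set_integral_diff(2)[OF i1 i2])
  also have "(LINT x:P|M. avg f P) = measure M P *\<^sub>R avg f P"
    unfolding set_lebesgue_integral_def using DD_props[OF P] by simp
  also have "\<dots> = (LINT x:P|M. f x)" using DD_props(4)[OF P] by (simp add: avg_def)
  finally show "(LINT x:P|M. osc f P x) = 0" by simp
  have n: "integrable M (\<lambda>x. norm (osc f P x))" using int by auto
  have i3: "set_integrable M P (\<lambda>x. norm (f x))"
    unfolding set_integrable_def using f DD_props[OF P] by (intro integrable_mult_indicator) auto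
  have i4: "set_integrable M P (\<lambda>x. norm (avg f P))"
    unfolding set_integrable_def using DD_props[OF P] by auto
  have "(\<integral>\<^sup>+x. ennreal (norm (osc f P x)) \<partial>M) = ennreal (LINT x|M. norm (osc f P x))"
    by (intro nn_integral_eq_integral n) auto
  also have "\<dots> \<le> ennreal (2 * (LINT x:P|M. norm (f x)))"
  proof (rule ennreal_leI)
    have "(LINT x|M. norm (osc f P x)) \<le> (LINT x:P|M. norm (f x) + norm (avg f P))"
      unfolding set_lebesgue_integral_def
      using n set_integral_add(1)[OF i3 i4]
      by (intro integral_mono) (auto simp: osc_def set_integrable_def norm_triangle_ineq4 indicator_def)
    also have "\<dots> = (LINT x:P|M. norm (f x)) + measure M P * norm (avg f P)"
      using set_integral_add(2)[OF i3 i4] DD_props[OF P] by (simp add: set_lebesgue_integral_def)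
    \<comment> \<open>By \<open>norm_avg\<close> the subtracted constant contributes no more than f
      does: this is the origin of the factor 2.\<close>
    also have "\<dots> \<le> 2 * (LINT x:P|M. norm (f x))" using norm_avg[OF P, of f] by simp
    finally show "(LINT x|M. norm (osc f P x)) \<le> 2 * (LINT x:P|M. norm (f x))" .
  qed
  also have "\<dots> = 2 * emeasure (mass f) P"
    using emeasure_mass[OF f DD_props(1)[OF P]]
    by (simp add: ennreal_mult' )
  finally show "(\<integral>\<^sup>+x. ennreal (norm (osc f P x)) \<partial>M) \<le> 2 * emeasure (mass f) P" .
qed

lemma disjoint_stop: "disjoint (stop f \<alpha>)"
  unfolding stop_def by (rule disjoint_maxs[OF bad_subset])

text \<open>At each point at most one term is nonzero, so the infinite sum of the functions b raises
  no question of convergence.\<close>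

lemma infsum_osc:
  assumes "P \<in> stop f \<alpha>" "x \<in> P"
  shows "(\<Sum>\<^sub>\<infinity>P\<in>stop f \<alpha>. osc f P x) = osc f P x"
proof -
  have "osc f R x = 0" if "R \<in> stop f \<alpha> - {P}" for R
    using that assms disjointD[OF disjoint_stop, of R f \<alpha> P] by (auto simp: osc_def indicator_def)
  then have "(\<Sum>\<^sub>\<infinity>R\<in>stop f \<alpha>. osc f R x) = (\<Sum>\<^sub>\<infinity>R\<in>{P}. osc f R x)"
    by (intro infsum_cong_neutral) (use assms in auto)
  then show ?thesis by simp
qed

lemma infsum_osc_outside:
  assumes "x \<notin> \<Union>(stop f \<alpha>)"
  shows "(\<Sum>\<^sub>\<infinity>P\<in>stop f \<alpha>. osc f P x) = 0"
  using assms by (intro infsum_0) (auto simp: osc_def indicator_def)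

definition good_part :: "('a \<Rightarrow> 'k::{real_normed_field, banach, second_countable_topology}) \<Rightarrow> real \<Rightarrow> 'a \<Rightarrow> 'k" where
  "good_part f \<alpha> x = f x - (\<Sum>\<^sub>\<infinity>P\<in>stop f \<alpha>. osc f P x)"

lemma good_part_inside:
  assumes "P \<in> stop f \<alpha>" "x \<in> P"
  shows "good_part f \<alpha> x = avg f P"
  using infsum_osc[OF assms] assms(2) by (simp add: good_part_def osc_def)

lemma good_part_outside:
  assumes "x \<notin> \<Union>(stop f \<alpha>)"
  shows "good_part f \<alpha> x = f x"
  using infsum_osc_outside[OF assms] by (simp add: good_part_def)

text \<open>Measurability is read off from countably many pieces: g is constant on every stopped set
  and equals f outside their union.\<close>

lemma good_part_measurable:
  assumes f: "integrable M f"
  shows "good_part f \<alpha> \<in> borel_measurable M"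
proof (rule measurable_piecewise_restrict[of "insert (space M - \<Union>(stop f \<alpha>)) (stop f \<alpha>)"])
  have [measurable]: "f \<in> borel_measurable M" using f by auto
  have U: "\<Union>(stop f \<alpha>) \<in> sets M"
    using countable_stop stop_subset[of f \<alpha>] DD_props(1) by (intro sets.countable_Union) auto
  show "countable (insert (space M - \<Union>(stop f \<alpha>)) (stop f \<alpha>))"
    using countable_stop by auto
  show "\<Omega> \<inter> space M \<in> sets M" if "\<Omega> \<in> insert (space M - \<Union>(stop f \<alpha>)) (stop f \<alpha>)" for \<Omega>
    using that U stop_subset[of f \<alpha>] DD_props(1) by auto
  show "space M \<subseteq> \<Union>(insert (space M - \<Union>(stop f \<alpha>)) (stop f \<alpha>))" by auto
  fix S assume S: "S \<in> insert (space M - \<Union>(stop f \<alpha>)) (stop f \<alpha>)"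
  show "good_part f \<alpha> \<in> borel_measurable (restrict_space M S)"
  proof (cases "S \<in> stop f \<alpha>")
    case True
    have "good_part f \<alpha> \<in> borel_measurable (restrict_space M S) \<longleftrightarrow>
      (\<lambda>_. avg f S) \<in> borel_measurable (restrict_space M S)"
      by (intro measurable_cong) (auto simp: space_restrict_space good_part_inside[OF True])
    then show ?thesis by simp
  next
    case False
    then have S: "S = space M - \<Union>(stop f \<alpha>)" using S by auto
    have "good_part f \<alpha> \<in> borel_measurable (restrict_space M S) \<longleftrightarrow>
      f \<in> borel_measurable (restrict_space M S)"
      by (intro measurable_cong good_part_outside) (auto simp: space_restrict_space S)
    then show ?thesis by (simp add: measurable_restrict_space1)
  qed
qed

theorem CZ_decomposition:
  fixes f :: "'a \<Rightarrow> 'k::{real_normed_field, banach, second_countable_topology}"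
  assumes f: "integrable M f" and \<alpha>: "0 < \<alpha>" and C: "1 \<le> C"
  shows "stop f \<alpha> \<subseteq> DD \<and> disjoint (stop f \<alpha>) \<and>
       (\<exists>g b. g \<in> borel_measurable M \<and> (\<forall>P\<in>stop f \<alpha>. integrable M (b P)) \<and>
          (AE x in M. f x = g x + (\<Sum>\<^sub>\<infinity>P\<in>stop f \<alpha>. b P x)) \<and>
          (AE x in M. norm (g x) \<le> C * \<alpha>) \<and>
          (\<forall>P\<in>stop f \<alpha>. (\<forall>x\<in>space M - P. b P x = 0) \<and> (LINT x:P|M. b P x) = 0) \<and>
          (\<Sum>\<^sub>\<infinity>P\<in>stop f \<alpha>. \<integral>\<^sup>+x. ennreal (norm (b P x)) \<partial>M)
            \<le> ennreal (2 * C) * (\<integral>\<^sup>+x. ennreal (norm (f x)) \<partial>M))"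
proof (intro conjI exI[of _ "good_part f \<alpha>"] exI[of _ "osc f"] ballI)
  show "stop f \<alpha> \<subseteq> DD" by (rule stop_subset)
  show "disjoint (stop f \<alpha>)" by (rule disjoint_stop)
  show "good_part f \<alpha> \<in> borel_measurable M" using good_part_measurable[OF f] .
  show "integrable M (osc f P)" "(LINT x:P|M. osc f P x) = 0" if "P \<in> stop f \<alpha>" for P
    using osc_props[OF f, of P] that stop_subset[of f \<alpha>] by auto
  show "AE x in M. f x = good_part f \<alpha> x + (\<Sum>\<^sub>\<infinity>P\<in>stop f \<alpha>. osc f P x)"
    by (simp add: good_part_def)
  show "osc f P x = 0" if "P \<in> stop f \<alpha>" "x \<in> space M - P" for P x
    using that by (auto simp: osc_def)
  show "AE x in M. norm (good_part f \<alpha> x) \<le> C * \<alpha>"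
    using AE_norm_le_outside_stop[OF f \<alpha>]
  proof eventually_elim
    case (elim x)
    show ?case
    proof (cases "x \<in> \<Union>(stop f \<alpha>)")
      case True
      then obtain P where P: "P \<in> stop f \<alpha>" "x \<in> P" by auto
      have PD: "P \<in> DD" using P stop_subset by auto
      have "measure M P * norm (avg f P) \<le> measure M P * (C * \<alpha>)"
        using norm_avg[OF PD, of f] stop_average[OF f \<alpha> P(1)] by (simp add: algebra_simps)
      then show ?thesis using good_part_inside[OF P] DD_props(4)[OF PD] by simp
    next
      case False
      then have "norm (good_part f \<alpha> x) \<le> 1 * \<alpha>" using elim good_part_outside[OF False] by simp
      also have "\<dots> \<le> C * \<alpha>" using C \<alpha> by (intro mult_right_mono) auto
      finally show ?thesis .
    qed
  qed
  show "(\<Sum>\<^sub>\<infinity>P\<in>stop f \<alpha>. \<integral>\<^sup>+x. ennreal (norm (osc f P x)) \<partial>M)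
            \<le> ennreal (2 * C) * (\<integral>\<^sup>+x. ennreal (norm (f x)) \<partial>M)"
  proof (rule infsum_le_finite_sums)
    show "(\<lambda>P. \<integral>\<^sup>+x. ennreal (norm (osc f P x)) \<partial>M) summable_on stop f \<alpha>"
      by (simp add: nonneg_summable_on_complete)
    fix F assume F: "finite F" "F \<subseteq> stop f \<alpha>"
    have sF: "P \<in> sets M" if "P \<in> F" for P using that F stop_subset DD_props(1) by blast
    have "(\<Sum>P\<in>F. \<integral>\<^sup>+x. ennreal (norm (osc f P x)) \<partial>M) \<le> (\<Sum>P\<in>F. 2 * emeasure (mass f) P)"
      using osc_props(3)[OF f] F stop_subset by (intro sum_mono) blast
    also have "\<dots> = 2 * (\<Sum>P\<in>F. emeasure (mass f) P)" by (simp add: sum_distrib_left)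
    also have "(\<Sum>P\<in>F. emeasure (mass f) P) = emeasure (mass f) (\<Union>P\<in>F. P)"
      using F sF disjoint_stop[of f \<alpha>]
      by (intro sum_emeasure) (auto simp: disjoint_family_on_def dest: disjointD)
    also have "\<dots> \<le> emeasure (mass f) (space M)"
      using sF[THEN sets.sets_into_space] by (intro emeasure_mono) auto
    also have "\<dots> = (\<integral>\<^sup>+x. ennreal (norm (f x)) \<partial>M)"
      unfolding mass_def using f by (subst emeasure_density) (auto intro!: nn_integral_cong)
    finally have "(\<Sum>P\<in>F. \<integral>\<^sup>+x. ennreal (norm (osc f P x)) \<partial>M) \<le> 2 * (\<integral>\<^sup>+x. ennreal (norm (f x)) \<partial>M)"
      by (simp add: mult_left_mono)
    also have "\<dots> \<le> ennreal (2 * C) * (\<integral>\<^sup>+x. ennreal (norm (f x)) \<partial>M)"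
      using C ennreal_leI[of 2 "2 * C"] by (intro mult_right_mono) auto
    finally show "(\<Sum>P\<in>F. \<integral>\<^sup>+x. ennreal (norm (osc f P x)) \<partial>M)
      \<le> ennreal (2 * C) * (\<integral>\<^sup>+x. ennreal (norm (f x)) \<partial>M)" .
  qed
qed

lemma stop_cong_AE:
  assumes "integrable M f" "integrable M f'" "AE x in M. f x = f' x"
  shows "stop f \<alpha> = stop f' \<alpha>"
proof -
  have "mass f = mass f'" unfolding mass_def
    using assms by (intro density_cong) auto
  then show ?thesis by (simp add: stop_def bad_def)
qed

text \<open>Every strictly larger member has measure at least \<open>\<theta>\<close> times that of \<open>P\<close>, so the averages of the
  indicator function of \<open>P\<close> drop below \<open>1 / \<theta>\<close>.\<close>

lemma stop_converse:
  assumes P: "P \<in> DD"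
  shows "integrable M (indicator P :: 'a \<Rightarrow> 'k::{real_normed_field, banach, second_countable_topology})"
    "P \<in> stop (indicator P :: 'a \<Rightarrow> 'k::{real_normed_field, banach, second_countable_topology}) (1 / \<theta>)"
proof -
  let ?f = "indicator P :: 'a \<Rightarrow> 'k"
  show f: "integrable M ?f"
  proof -
    have "?f = (\<lambda>x. indicator P x *\<^sub>R 1)" by (auto simp: indicator_def)
    then show ?thesis using integrable_indicator[OF DD_props(1)[OF P], of 1] DD_props(3)[OF P] by simp
  qed
  have \<theta>: "0 < 1 / \<theta>" using theta by simp
  have I: "(LINT x:R|M. norm (?f x)) = measure M P" if "P \<subseteq> R" for R
  proof -
    have "(LINT x:R|M. norm (?f x)) = (LINT x|M. indicator P x)"
      unfolding set_lebesgue_integral_def using that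
      by (intro Bochner_Integration.integral_cong) (auto simp: indicator_def)
    then show ?thesis using DD_props(1)[OF P] sets.sets_into_space[OF DD_props(1)[OF P]]
      by (simp add: Int_absorb2)
  qed
  have "P \<in> bad ?f (1 / \<theta>)"
    using bad_iff[OF f P \<theta>] I[of P] DD_props(4)[OF P] theta by (simp add: field_simps)
  moreover have "R = P" if "R \<in> bad ?f (1 / \<theta>)" "P \<subseteq> R" for R
  proof (rule ccontr)
    assume "R \<noteq> P"
    have R: "R \<in> DD" using that by (auto simp: bad_def)
    have "\<theta> * measure M P \<le> measure M R" using growth[OF P R] that(2) \<open>R \<noteq> P\<close> by auto
    then show False using bad_iff[OF f R \<theta>] that I[OF that(2)] theta by (simp add: field_simps)
  qed
  ultimately show "P \<in> stop ?f (1 / \<theta>)" by (auto simp: stop_def maxs_def)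
qed

end

section \<open>Cylinders and the partitions they generate\<close>

text \<open>In the coordinates \<open>(n, 1) exp (t Z)\<close> a cylinder is the product of its cell and a time interval.\<close>

fun rad :: "'v cyl \<Rightarrow> real" where "rad (r, (k, E), a) = r"
fun gen :: "'v cyl \<Rightarrow> int" where "gen (r, (k, E), a) = k"
fun cell :: "'v cyl \<Rightarrow> 'v set" where "cell (r, (k, E), a) = E"
fun cen :: "'v cyl \<Rightarrow> real" where "cen (r, (k, E), a) = a"

definition tint :: "'v cyl \<Rightarrow> real set" where
  "tint P = {ln (cen P / rad P)<..<ln (cen P * rad P)}"

definition cyl_box :: "'v cyl \<Rightarrow> ('v \<times> real) set" where
  "cyl_box P = cell P \<times> tint P"

lemma tint_eq: "0 < a \<Longrightarrow> 0 < r \<Longrightarrow> tint (r, (k, E), a) = {ln a - ln r<..<ln a + ln r}"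
  by (simp add: tint_def ln_div ln_mult)

lemma cyl_cases: obtains r k E a where "P = (r, (k, E), a)"
  by (metis prod_cases4 surj_pair)

locale cube_system =
  fixes N :: "('v::euclidean_space) strat_group" and \<nu> :: "'v measure"
    and \<Q> :: "int \<Rightarrow> 'v set set" and \<delta> C1 c gam lam :: real
  assumes christ: "christ_cubes N \<nu> \<Q> \<delta> C1 c"
    and sets_nu: "sets \<nu> = sets borel"
    and nu_cube: "E \<in> \<Q> k \<Longrightarrow> 0 < emeasure \<nu> E \<and> emeasure \<nu> E < \<infinity>"
    and gam: "5 \<le> gam"
    and lam: "exp 3 / \<delta> < lam"
begin

lemma delta: "0 < \<delta>" "\<delta> < 1" and C1: "3 \<le> C1"
  using christ unfolding christ_cubes_def by auto

lemma lam_pos: "0 < lam" and lam_delta: "exp 3 < \<delta> * lam"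
proof -
  have "0 < exp 3 / \<delta>" using delta by simp
  then show "0 < lam" using lam by linarith
  show "exp 3 < \<delta> * lam" using lam delta by (simp add: field_simps)
qed

lemma cubes: "countable (\<Q> k)" "disjoint (\<Q> k)" "E \<in> \<Q> k \<Longrightarrow> open E"
  using christ unfolding christ_cubes_def by auto

lemma cube_disjoint: "E \<in> \<Q> k \<Longrightarrow> R \<in> \<Q> k \<Longrightarrow> x \<in> E \<Longrightarrow> x \<in> R \<Longrightarrow> E = R"
  using cubes(2) by (auto dest: disjointD)

lemma cube_sets: "E \<in> \<Q> k \<Longrightarrow> E \<in> sets \<nu>"
  using cubes(3) sets_nu by auto

lemma cube_measure:
  assumes "E \<in> \<Q> k"
  shows "0 < measure \<nu> E" "emeasure \<nu> E = ennreal (measure \<nu> E)"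
proof -
  show *: "emeasure \<nu> E = ennreal (measure \<nu> E)"
    using nu_cube[OF assms] by (intro emeasure_eq_ennreal_measure) auto
  then show "0 < measure \<nu> E" using nu_cube[OF assms] by simp
qed

definition par :: "int \<Rightarrow> 'v set \<Rightarrow> 'v set" where
  "par k E = snd (cube_parent \<Q> (k, E))"

lemma cube_parent_eq: "cube_parent \<Q> (k, E) = (k - 1, par k E)"
  by (simp add: par_def cube_parent_def)

lemma christ_parent:
  "\<forall>k. \<forall>E\<in>\<Q> k. (\<exists>!R. R \<in> \<Q> (k - 1) \<and> E \<subseteq> R) \<and>
     (\<forall>R\<in>\<Q> (k - 1). R \<noteq> snd (cube_parent \<Q> (k, E)) \<longrightarrow> E \<inter> R = {})"
  using christ unfolding christ_cubes_def by (elim conjE) assumption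

lemma christ_sons:
  "\<forall>k. \<forall>E\<in>\<Q> k. emeasure \<nu> (snd (cube_parent \<Q> (k, E))) \<le> ennreal C1 * emeasure \<nu> E \<and>
     finite (cube_sons \<Q> (k, E)) \<and> 2 \<le> card (cube_sons \<Q> (k, E)) \<and>
     real (card (cube_sons \<Q> (k, E))) \<le> C1"
  using christ unfolding christ_cubes_def by (elim conjE) assumption

lemma par:
  assumes "E \<in> \<Q> k"
  shows "par k E \<in> \<Q> (k - 1)" "E \<subseteq> par k E" "measure \<nu> (par k E) \<le> C1 * measure \<nu> E"
proof -
  have ex: "\<exists>!R. R \<in> \<Q> (k - 1) \<and> E \<subseteq> R"
    by (rule christ_parent[rule_format, OF assms, THEN conjunct1])
  have "par k E \<in> \<Q> (k - 1) \<and> E \<subseteq> par k E"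
    using theI'[OF ex] by (simp add: par_def cube_parent_def)
  then show 1: "par k E \<in> \<Q> (k - 1)" and "E \<subseteq> par k E" by auto
  have "emeasure \<nu> (par k E) \<le> ennreal C1 * emeasure \<nu> E"
    unfolding par_def by (rule christ_sons[rule_format, OF assms, THEN conjunct1])
  then have "ennreal (measure \<nu> (par k E)) \<le> ennreal (C1 * measure \<nu> E)"
    using cube_measure(2)[OF 1] cube_measure(2)[OF assms] C1 by (simp add: ennreal_mult)
  then show "measure \<nu> (par k E) \<le> C1 * measure \<nu> E"
    using C1 by (simp add: ennreal_le_iff)
qed

lemma cube_sons_eq:
  "cube_sons \<Q> (k, E) = {(k + 1, E') | E'. E' \<in> \<Q> (k + 1) \<and> par (k + 1) E' = E}"
  by (auto simp: cube_sons_def cube_parent_eq)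

lemma card_sons:
  assumes "E \<in> \<Q> k"
  shows "finite (cube_sons \<Q> (k, E))" "2 \<le> card (cube_sons \<Q> (k, E))"
  using christ_sons[rule_format, OF assms] by simp_all

definition "\<theta> = C1 / (C1 - 1)"

text \<open>The bound 3/2 comes from C1 \<ge> 3. It is also the smallest factor by which a vertical
  move enlarges a time interval, namely from radius r^2 to radius r^3, so one \<theta> serves for
  both kinds of parents.\<close>

lemma theta: "1 < \<theta>" "\<theta> \<le> 3 / 2"
  using C1 by (simp_all add: \<theta>_def field_simps)

text \<open>E has a sibling, which is disjoint from it and carries at least the fraction 1 / C1 of
  the parent. Thus at most the fraction 1 - 1 / C1 is left for E.\<close>

lemma par_growth:
  assumes "E \<in> \<Q> k"
  shows "\<theta> * measure \<nu> E \<le> measure \<nu> (par k E)"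
proof -
  let ?R = "par k E"
  note R = par[OF assms]
  have "(k, E) \<in> cube_sons \<Q> (k - 1, ?R)" using assms by (auto simp: cube_sons_eq)
  moreover have "\<not> cube_sons \<Q> (k - 1, ?R) \<subseteq> {(k, E)}"
  proof
    assume "cube_sons \<Q> (k - 1, ?R) \<subseteq> {(k, E)}"
    then have "card (cube_sons \<Q> (k - 1, ?R)) \<le> card {(k, E)}" by (intro card_mono) auto
    then show False using card_sons(2)[OF R(1)] by simp
  qed
  ultimately obtain E' where E': "E' \<in> \<Q> k" "par k E' = ?R" "E' \<noteq> E"
    by (auto simp: cube_sons_eq)
  have disj: "E \<inter> E' = {}" using cube_disjoint[OF assms E'(1)] E'(3) by auto
  have "emeasure \<nu> E + emeasure \<nu> E' = emeasure \<nu> (E \<union> E')"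
    using cube_sets assms E' disj by (intro plus_emeasure) auto
  also have "\<dots> \<le> emeasure \<nu> ?R"
    using R par(2)[OF E'(1)] E'(2) cube_sets[OF R(1)] by (intro emeasure_mono) auto
  finally have "measure \<nu> E + measure \<nu> E' \<le> measure \<nu> ?R"
    using cube_measure[OF assms] cube_measure[OF E'(1)] cube_measure[OF R(1)]
    by (simp flip: ennreal_plus)
  moreover have "measure \<nu> ?R \<le> C1 * measure \<nu> E'" using par(3)[OF E'(1)] E'(2) by simp
  ultimately have "C1 * measure \<nu> E \<le> (C1 - 1) * measure \<nu> ?R"
    using C1 mult_left_mono[of "measure \<nu> E + measure \<nu> E'" "measure \<nu> ?R" C1] by (simp add: algebra_simps)
  then show ?thesis using C1 by (simp add: \<theta>_def field_simps)
qed

text \<open>A set of full measure (\<open>AE_good\<close>). Coverings are stated pointwise on it, so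
  that tilings can be handled without mentioning null sets of N.\<close>

definition good :: "'v set" where
  "good = (\<Inter>k. \<Union>(\<Q> k))"

lemma good_son:
  assumes "n \<in> good" "E \<in> \<Q> k" "n \<in> E"
  shows "\<exists>E'\<in>\<Q> (k + 1). n \<in> E' \<and> par (k + 1) E' = E"
proof -
  obtain E' where E': "E' \<in> \<Q> (k + 1)" "n \<in> E'" using assms(1) by (auto simp: good_def)
  then show ?thesis using cube_disjoint[of "par (k + 1) E'" k E n] par[OF E'(1)] assms by auto
qed

section \<open>Sons of cylinders and tilings by cylinders\<close>

definition valid :: "'v cyl \<Rightarrow> bool" where
  "valid P \<longleftrightarrow> cell P \<in> \<Q> (gen P) \<and> 1 < rad P \<and> 0 < cen P"

text \<open>The flow measure of the cylinder, by \<open>cset_measure\<close>: the trace measure of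
  the cell times the length of the time interval.\<close>

definition weight :: "'v cyl \<Rightarrow> real" where
  "weight P = measure \<nu> (cell P) * (2 * ln (rad P))"

text \<open>The condition \<open>parent_D\<close> of \<open>dyadic_system\<close>, expressed in the
  parameters of cylinders.\<close>

definition refines :: "'v cyl \<Rightarrow> 'v cyl \<Rightarrow> bool" where
  "refines P R \<longleftrightarrow> cyl_box P \<subseteq> cyl_box R \<and> \<theta> * weight P \<le> weight R \<and> weight R \<le> C1 * weight P"

abbreviation "sons \<equiv> cyl_sons \<Q> \<delta> gam lam"
abbreviation "adm \<equiv> admissible \<Q> \<delta> gam lam"

lemma sons_cases:
  assumes "valid (r, (k, E), a)"
  obtains (vertical) "adm (sqrt r, (k, E), a / sqrt r)" "adm (sqrt r, (k, E), a * sqrt r)"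
      "sons (r, (k, E), a) = {(sqrt r, (k, E), a / sqrt r), (sqrt r, (k, E), a * sqrt r)}"
  | (horizontal) "\<not> (adm (sqrt r, (k, E), a / sqrt r) \<and> adm (sqrt r, (k, E), a * sqrt r))"
      "sons (r, (k, E), a) = {(r, (k + 1, E'), a) | E'. E' \<in> \<Q> (k + 1) \<and> par (k + 1) E' = E}"
proof (cases "adm (sqrt r, (k, E), a / sqrt r) \<and> adm (sqrt r, (k, E), a * sqrt r)")
  case True
  then show ?thesis using vertical by (auto simp: cyl_sons_def Let_def)
next
  case False
  then have "sons (r, (k, E), a) = {(r, q', a) |q'. q' \<in> cube_sons \<Q> (k, E)}"
    by (auto simp: cyl_sons_def Let_def)
  also have "\<dots> = {(r, (k + 1, E'), a) | E'. E' \<in> \<Q> (k + 1) \<and> par (k + 1) E' = E}"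
    unfolding cube_sons_eq by blast
  finally show ?thesis using horizontal False by blast
qed

lemma ln_sqrt_pos: "0 < r \<Longrightarrow> ln (sqrt r) = ln r / 2"
  by (simp add: ln_sqrt)

lemma tint_halves:
  assumes "1 < r" "0 < a"
  shows "tint (sqrt r, (k, E), a / sqrt r) = {ln a - ln r<..<ln a}"
    "tint (sqrt r, (k, E), a * sqrt r) = {ln a<..<ln a + ln r}"
  using assms by (auto simp: tint_eq ln_div ln_mult ln_sqrt_pos)

text \<open>For vertical halves the weight doubles, and \<theta> \<le> 2 \<le> C1; for sons of the
  cell the bounds are those of the cubes.\<close>

lemma sons_refine:
  assumes P: "valid P" and S: "S \<in> sons P"
  shows "valid S" "refines S P" "tint S \<subseteq> tint P"
proof -
  obtain r k E a where Pe: "P = (r, (k, E), a)" by (rule cyl_cases)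
  have v: "E \<in> \<Q> k" "1 < r" "0 < a" using P by (auto simp: valid_def Pe)
  have lnr: "0 < ln r" using v by simp
  have tP: "tint P = {ln a - ln r<..<ln a + ln r}" unfolding Pe using v by (intro tint_eq) auto
  have "valid (r, (k, E), a)" using P Pe by simp
  then have "valid S \<and> refines S P \<and> tint S \<subseteq> tint P"
  proof (cases rule: sons_cases)
    case vertical
    then have "S = (sqrt r, (k, E), a / sqrt r) \<or> S = (sqrt r, (k, E), a * sqrt r)" using S Pe by auto
    moreover have "\<theta> * (measure \<nu> E * ln r) \<le> measure \<nu> E * (2 * ln r)"
      using theta cube_measure[OF v(1)] lnr
        mult_right_mono[of \<theta> 2 "measure \<nu> E * ln r"] by (simp add: mult_ac)
    moreover have "measure \<nu> E * (2 * ln r) \<le> C1 * (measure \<nu> E * ln r)"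
      using C1 cube_measure[OF v(1)] lnr
        mult_right_mono[of 2 C1 "measure \<nu> E * ln r"] by (simp add: mult_ac)
    ultimately show ?thesis using v
      by (elim disjE) (auto simp: valid_def refines_def cyl_box_def weight_def tP tint_halves ln_sqrt_pos real_less_rsqrt lnr, auto simp: Pe weight_def lnr)
  next
    case horizontal
    then obtain E' where S: "S = (r, (k + 1, E'), a)" "E' \<in> \<Q> (k + 1)" "par (k + 1) E' = E"
      using S Pe by auto
    have "\<theta> * (measure \<nu> E' * (2 * ln r)) \<le> measure \<nu> E * (2 * ln r)"
      using par_growth[OF S(2)] S(3) lnr mult_right_mono[of "\<theta> * measure \<nu> E'" "measure \<nu> E" "2 * ln r"]
      by (simp add: mult_ac)
    moreover have "measure \<nu> E * (2 * ln r) \<le> C1 * (measure \<nu> E' * (2 * ln r))"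
      using par(3)[OF S(2)] S(3) lnr mult_right_mono[of "measure \<nu> E" "C1 * measure \<nu> E'" "2 * ln r"]
      by (simp add: mult_ac)
    moreover have "tint S = tint P" by (simp add: tint_def S Pe)
    ultimately show ?thesis using v S par(2)[OF S(2)]
      by (auto simp: valid_def refines_def cyl_box_def weight_def Pe)
  qed
  then show "valid S" "refines S P" "tint S \<subseteq> tint P" by auto
qed

lemma sons_disjoint:
  assumes P: "valid P" and S: "S \<in> sons P" "S' \<in> sons P" "S \<noteq> S'"
  shows "cyl_box S \<inter> cyl_box S' = {}"
proof -
  obtain r k E a where Pe: "P = (r, (k, E), a)" by (rule cyl_cases)
  have v: "E \<in> \<Q> k" "1 < r" "0 < a" using P by (auto simp: valid_def Pe)
  have "valid (r, (k, E), a)" using P Pe by simp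
  then show ?thesis
  proof (cases rule: sons_cases)
    case vertical
    then show ?thesis using S Pe v by (auto simp: cyl_box_def tint_halves)
  next
    case horizontal
    then obtain E1 E2 where "S = (r, (k + 1, E1), a)" "E1 \<in> \<Q> (k + 1)"
      "S' = (r, (k + 1, E2), a)" "E2 \<in> \<Q> (k + 1)" "E1 \<noteq> E2" using S Pe by auto
    then show ?thesis using cube_disjoint[of E1 "k + 1" E2] by (auto simp: cyl_box_def)
  qed
qed

text \<open>The excluded time is the common endpoint of the two open halves.\<close>

lemma sons_cover:
  assumes P: "valid P" and x: "(n, t) \<in> cyl_box P" "n \<in> good" "t \<noteq> ln (cen P)"
  shows "\<exists>S\<in>sons P. (n, t) \<in> cyl_box S"
proof -
  obtain r k E a where Pe: "P = (r, (k, E), a)" by (rule cyl_cases)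
  have v: "E \<in> \<Q> k" "1 < r" "0 < a" using P by (auto simp: valid_def Pe)
  have vP: "valid (r, (k, E), a)" using P Pe by simp
  have tP: "tint P = {ln a - ln r<..<ln a + ln r}" unfolding Pe using v by (intro tint_eq) auto
  show ?thesis using vP
  proof (cases rule: sons_cases)
    case vertical
    have "n \<in> E" "t \<in> {ln a - ln r<..<ln a} \<or> t \<in> {ln a<..<ln a + ln r}"
      using x tP by (auto simp: cyl_box_def Pe)
    then show ?thesis using vertical Pe v by (auto simp: cyl_box_def tint_halves)
  next
    case horizontal
    obtain E' where E': "E' \<in> \<Q> (k + 1)" "n \<in> E'" "par (k + 1) E' = E"
      using good_son[OF x(2) v(1)] x(1) Pe by (auto simp: cyl_box_def)
    then have "(r, (k + 1, E'), a) \<in> sons P" using horizontal Pe by auto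
    moreover have "(n, t) \<in> cyl_box (r, (k + 1, E'), a)"
      using x(1) E' by (simp add: cyl_box_def tint_def Pe)
    ultimately show ?thesis by blast
  qed
qed

lemma countable_sons:
  assumes "valid P"
  shows "countable (sons P)"
proof -
  obtain r k E a where Pe: "P = (r, (k, E), a)" by (rule cyl_cases)
  have "valid (r, (k, E), a)" using assms Pe by simp
  then show ?thesis
  proof (cases rule: sons_cases)
    case horizontal
    then have "sons P \<subseteq> (\<lambda>E'. (r, (k + 1, E'), a)) ` \<Q> (k + 1)" using Pe by auto
    then show ?thesis by (rule countable_subset) (simp add: cubes(1))
  qed (simp add: Pe)
qed

text \<open>A partition of N times V up to null sets. The exceptional set is the complement of
  \<open>good\<close> together with countably many times, a description stable under subdivision and
  under countable unions.\<close>

definition tiling :: "'v cyl set \<Rightarrow> real set \<Rightarrow> bool" where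
  "tiling F V \<longleftrightarrow> countable F \<and> (\<forall>P\<in>F. valid P \<and> tint P \<subseteq> V) \<and>
     (\<forall>P\<in>F. \<forall>R\<in>F. P \<noteq> R \<longrightarrow> cyl_box P \<inter> cyl_box R = {}) \<and>
     (\<exists>T. countable T \<and> (\<forall>n\<in>good. \<forall>t\<in>V - T. \<exists>P\<in>F. (n, t) \<in> cyl_box P))"

abbreviation "allsons \<equiv> all_sons \<Q> \<delta> gam lam"

lemma tiling_allsons:
  assumes "tiling F V"
  shows "tiling (allsons F) V"
proof -
  from assms have F: "countable F" "\<And>P. P \<in> F \<Longrightarrow> valid P" "\<And>P. P \<in> F \<Longrightarrow> tint P \<subseteq> V"
    "\<And>P R. P \<in> F \<Longrightarrow> R \<in> F \<Longrightarrow> P \<noteq> R \<Longrightarrow> cyl_box P \<inter> cyl_box R = {}"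
    by (auto simp: tiling_def)
  from assms obtain T where T: "countable T" "\<And>n t. n \<in> good \<Longrightarrow> t \<in> V - T \<Longrightarrow> \<exists>P\<in>F. (n, t) \<in> cyl_box P"
    by (auto simp: tiling_def)
  have in_sons: "\<exists>P\<in>F. S \<in> sons P" if "S \<in> allsons F" for S
    using that unfolding all_sons_def by (rule UN_E) (rule bexI)
  show ?thesis unfolding tiling_def
  proof (intro conjI ballI impI)
    show "countable (allsons F)" unfolding all_sons_def by (intro countable_UN F(1) countable_sons F(2))
    show "valid S" "tint S \<subseteq> V" if "S \<in> allsons F" for S
      using in_sons[OF that] sons_refine F(2,3) by blast+
    show "cyl_box S \<inter> cyl_box S' = {}" if SS: "S \<in> allsons F" "S' \<in> allsons F" "S \<noteq> S'" for S S'
    proof -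
      obtain P P' where P: "P \<in> F" "S \<in> sons P" "P' \<in> F" "S' \<in> sons P'"
        using in_sons SS by blast
      have "cyl_box S \<subseteq> cyl_box P" "cyl_box S' \<subseteq> cyl_box P'"
        using sons_refine(2)[OF F(2)] P by (auto simp: refines_def)
      then show ?thesis
        using F(4)[OF P(1,3)] sons_disjoint[OF F(2)[OF P(1)] P(2), of S'] P SS(3)
        by (cases "P = P'") auto
    qed
    show "\<exists>T. countable T \<and> (\<forall>n\<in>good. \<forall>t\<in>V - T. \<exists>P\<in>allsons F. (n, t) \<in> cyl_box P)"
    \<comment> \<open>Each member of F may lose its central time when it is split, and F is
      countable.\<close>
    proof (intro exI[of _ "T \<union> (\<lambda>P. ln (cen P)) ` F"] conjI ballI)
      show "countable (T \<union> (\<lambda>P. ln (cen P)) ` F)" using T(1) F(1) by auto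
      fix n t assume nt: "n \<in> good" "t \<in> V - (T \<union> (\<lambda>P. ln (cen P)) ` F)"
      then obtain P where P: "P \<in> F" "(n, t) \<in> cyl_box P" using T(2)[of n t] by auto
      then have "t \<noteq> ln (cen P)" using nt(2) by blast
      then obtain S where "S \<in> sons P" "(n, t) \<in> cyl_box S"
        using sons_cover[OF F(2)[OF P(1)] P(2) nt(1)] by blast
      then show "\<exists>P\<in>allsons F. (n, t) \<in> cyl_box P" using P(1) unfolding all_sons_def by (intro bexI UN_I)
    qed
  qed
qed

lemma tiling_funpow: "tiling F V \<Longrightarrow> tiling ((allsons ^^ m) F) V"
  by (induction m) (auto intro: tiling_allsons)

lemma tiling_empty: "tiling {} {}"
  by (auto simp: tiling_def)

lemma tiling_translates:
  assumes "valid P"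
  shows "tiling (translates \<Q> P) (tint P)"
proof -
  obtain r k E a where Pe: "P = (r, (k, E), a)" by (rule cyl_cases)
  have tr: "translates \<Q> P = (\<lambda>E'. (r, (k, E'), a)) ` \<Q> k" by (auto simp: translates_def Pe)
  have "cyl_box (r, (k, E1), a) \<inter> cyl_box (r, (k, E2), a) = {}"
    if "E1 \<in> \<Q> k" "E2 \<in> \<Q> k" "E1 \<noteq> E2" for E1 E2
    using cube_disjoint that by (auto simp: cyl_box_def)
  then show ?thesis using assms cubes(1) unfolding tiling_def tr
    by (auto simp: Pe valid_def tint_def cyl_box_def good_def intro!: exI[of _ "{}"])
qed

lemma tiling_Union:
  fixes F :: "nat \<Rightarrow> 'v cyl set"
  assumes "\<And>i. tiling (F i) (V i)" and disj: "\<And>i j. i < j \<Longrightarrow> V i \<inter> V j = {}"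
    and T: "countable T" "UNIV - T \<subseteq> (\<Union>i. V i)"
  shows "tiling (\<Union>i. F i) UNIV"
proof -
  have F: "countable (F i)" "\<And>P. P \<in> F i \<Longrightarrow> valid P" "\<And>P. P \<in> F i \<Longrightarrow> tint P \<subseteq> V i"
    "\<And>P R. P \<in> F i \<Longrightarrow> R \<in> F i \<Longrightarrow> P \<noteq> R \<Longrightarrow> cyl_box P \<inter> cyl_box R = {}" for i
    using assms(1)[of i] by (auto simp: tiling_def)
  have "\<forall>i. \<exists>T. countable T \<and> (\<forall>n\<in>good. \<forall>t\<in>V i - T. \<exists>P\<in>F i. (n, t) \<in> cyl_box P)"
    using assms(1) by (auto simp: tiling_def)
  then obtain T' where T': "\<And>i. countable (T' i)"
    "\<And>i n t. n \<in> good \<Longrightarrow> t \<in> V i - T' i \<Longrightarrow> \<exists>P\<in>F i. (n, t) \<in> cyl_box P" by metis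
  have disj': "V i \<inter> V j = {}" if "i \<noteq> j" for i j
    using disj[of i j] disj[of j i] that by (auto simp: neq_iff)
  show ?thesis unfolding tiling_def
  proof (intro conjI ballI impI)
    show "countable (\<Union>i. F i)" using F by auto
    show "valid S" "tint S \<subseteq> UNIV" if "S \<in> (\<Union>i. F i)" for S using that F(2) by blast+
    show "cyl_box S \<inter> cyl_box S' = {}" if SS: "S \<in> (\<Union>i. F i)" "S' \<in> (\<Union>i. F i)" "S \<noteq> S'" for S S'
    proof -
      obtain i j where ij: "S \<in> F i" "S' \<in> F j" using SS by blast
      show ?thesis
      proof (cases "i = j")
        case True
        then show ?thesis using F(4)[of S i S'] ij SS by auto
      next
        case False
        then show ?thesis using disj'[OF False] F(3)[OF ij(1)] F(3)[OF ij(2)] by (auto simp: cyl_box_def)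
      qed
    qed
    show "\<exists>T. countable T \<and> (\<forall>n\<in>good. \<forall>t\<in>UNIV - T. \<exists>P\<in>\<Union>i. F i. (n, t) \<in> cyl_box P)"
    proof (intro exI[of _ "T \<union> (\<Union>i. T' i)"] conjI ballI)
      show "countable (T \<union> (\<Union>i. T' i))" using T T' by auto
      fix n t assume nt: "n \<in> good" "t \<in> UNIV - (T \<union> (\<Union>i. T' i))"
      then obtain i where "t \<in> V i" using T by blast
      then show "\<exists>P\<in>\<Union>i. F i. (n, t) \<in> cyl_box P" using T'(2)[OF nt(1), of t i] nt(2) by blast
    qed
  qed
qed

end

section \<open>Admissibility, and the shrinking of cylinders along sons\<close>

context cube_system
begin

lemma powi_pos: "0 < \<delta> powi k"
  using delta by simp

lemma powi_Suc: "\<delta> powi (k + 1) = \<delta> * \<delta> powi k"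
  using delta by (simp add: power_int_add)

lemma powi_pred: "\<delta> * \<delta> powi (k - 1) = \<delta> powi k"
  using powi_Suc[of "k - 1"] by simp

definition chain_ok :: "'v cyl \<Rightarrow> bool" where
  "chain_ok P \<longleftrightarrow> valid P \<and> exp 1 < rad P \<and> cen P * (rad P)\<^sup>2 \<le> \<delta> powi gen P"

lemma powr_gam:
  assumes "1 \<le> r"
  shows "r ^ 5 \<le> r powr gam"
proof -
  have "r powr 5 \<le> r powr gam" using assms gam by (intro powr_mono) auto
  then show ?thesis using assms by (simp add: powr_numeral)
qed

text \<open>The parent cube only enlarges the scale, so the lower condition survives and the upper
  one must fail: \<delta>^(k-1) > \<open>lam\<close> a r^\<open>gam\<close>. Multiplying by \<delta>
  brings in the product \<delta> * \<open>lam\<close> > exp 3, and r^\<open>gam\<close> \<ge>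
  r^5.\<close>

lemma not_adm_side:
  assumes ok: "chain_ok (r, (k, E), a)" and na: "\<not> adm (parent_side \<Q> (r, (k, E), a))"
  shows "exp 3 * a * r ^ 5 \<le> \<delta> powi k"
proof -
  from ok have v: "E \<in> \<Q> k" "exp 1 < r" "0 < a" "a * r\<^sup>2 \<le> \<delta> powi k"
    by (auto simp: chain_ok_def valid_def)
  have r1: "1 \<le> r" using v(2) exp_ge_add_one_self[of 1] by linarith
  have "\<delta> powi k \<le> \<delta> powi (k - 1)"
    using powi_pred[of k] delta powi_pos[of "k - 1"] mult_right_mono[of \<delta> 1 "\<delta> powi (k - 1)"] by simp
  then have "a * r\<^sup>2 \<le> \<delta> powi (k - 1)" using v(4) by simp
  then have "lam * a * r powr gam < \<delta> powi (k - 1)"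
    using na v par(1)[OF v(1)]
    by (auto simp: parent_side_def admissible_def large_admissible_def cube_parent_eq not_le)
  then have "\<delta> * (lam * a * r powr gam) \<le> \<delta> powi k"
    using powi_pred[of k] delta mult_left_mono[of "lam * a * r powr gam" "\<delta> powi (k - 1)" \<delta>] by simp
  moreover have "exp 3 * a * r ^ 5 \<le> \<delta> * lam * a * r powr gam"
    using lam_delta powr_gam[OF r1] v(3) r1 delta lam_pos by (intro mult_mono) auto
  ultimately show ?thesis by (simp add: mult_ac)
qed

text \<open>Both vertical halves of \<open>P\<close> are admissible as soon as \<open>\<delta> powi gen P\<close> lies between \<open>low P\<close> and \<open>upp P\<close>;
  this window is wider than a factor \<open>1 / \<delta>\<close>, so that passing to sons of cells cannot jump over it.\<close>

definition low :: "'v cyl \<Rightarrow> real" where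
  "low P = (if exp 2 < rad P then cen P * rad P powr (3/2)
            else cen P * sqrt (rad P) * (exp 1)\<^sup>2 * (ln (rad P) / 2))"

definition upp :: "'v cyl \<Rightarrow> real" where
  "upp P = (if exp 2 < rad P then lam * (cen P / sqrt (rad P)) * sqrt (rad P) powr gam
            else lam * (cen P / sqrt (rad P)) * (exp 1)\<^sup>2 * (ln (rad P) / 2))"

definition high :: "'v cyl \<Rightarrow> bool" where
  "high P \<longleftrightarrow> low P \<le> \<delta> powi gen P"

text \<open>The halves have radius sqrt r, so r = exp 2 is where they change from small to
  large.\<close>

lemma sqrt_exp2: "exp 1 < sqrt r \<longleftrightarrow> exp 2 < (r::real)"
proof -
  have "sqrt (exp 2) = exp (1::real)"
    using exp_double[of "1::real"] by (intro real_sqrt_unique) auto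
  then show ?thesis using real_sqrt_less_iff[of "exp 2" r] by simp
qed

text \<open>\<open>low\<close> is the lower bound required for the upper half, with center a * sqrt
  r, and \<open>upp\<close> the upper bound required for the lower half, with center a / sqrt r. As
  both requirements increase with the center, these are the stricter ones.\<close>

lemma halves_adm:
  assumes v: "valid (r, (k, E), a)" and h: "high (r, (k, E), a)" and u: "\<delta> powi k \<le> upp (r, (k, E), a)"
  shows "adm (sqrt r, (k, E), a / sqrt r)" "adm (sqrt r, (k, E), a * sqrt r)"
proof -
  have v: "E \<in> \<Q> k" "1 < r" "0 < a" using v by (auto simp: valid_def)
  have s: "1 < sqrt r" "0 < a / sqrt r" "0 < a * sqrt r" "sqrt r * sqrt r = r" using v by auto
  have aa: "a / sqrt r \<le> a * sqrt r"
  proof -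
    have "a / sqrt r \<le> a / 1" using s v by (intro divide_left_mono) auto
    also have "\<dots> \<le> a * sqrt r" using s v by simp
    finally show ?thesis .
  qed
  have ls: "0 < ln r / 2" "ln (sqrt r) = ln r / 2" using v by (auto simp: ln_sqrt)
  have "adm (sqrt r, (k, E), a / sqrt r) \<and> adm (sqrt r, (k, E), a * sqrt r)"
  proof (cases "exp 2 < r")
    case True
    have "r powr (3/2) = r * sqrt r"
    proof -
      have "r powr (3/2) = r powr (1 + 1/2)" by simp
      also have "\<dots> = r powr 1 * r powr (1/2)" by (rule powr_add)
      finally show ?thesis using v by (simp add: powr_half_sqrt)
    qed
    then have l: "a * sqrt r * (sqrt r)\<^sup>2 \<le> \<delta> powi k"
      using h True v by (simp add: high_def low_def mult_ac)
    have l': "a / sqrt r * (sqrt r)\<^sup>2 \<le> a * sqrt r * (sqrt r)\<^sup>2"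
      using aa by (intro mult_right_mono) auto
    have u1: "\<delta> powi k \<le> lam * (a / sqrt r) * sqrt r powr gam"
      using u True by (simp add: upp_def)
    have u2: "lam * (a / sqrt r) * sqrt r powr gam \<le> lam * (a * sqrt r) * sqrt r powr gam"
      using aa lam_pos by (intro mult_right_mono mult_left_mono) auto
    have e: "exp 1 < sqrt r" using sqrt_exp2 True by simp
    show ?thesis
      using l l' u1 u2 e v s by (auto simp: admissible_def large_admissible_def)
  next
    case False
    have l: "a * sqrt r * (exp 1)\<^sup>2 * ln (sqrt r) \<le> \<delta> powi k"
      using h False unfolding ls(2) by (simp add: high_def low_def)
    have l': "a / sqrt r * (exp 1)\<^sup>2 * ln (sqrt r) \<le> a * sqrt r * (exp 1)\<^sup>2 * ln (sqrt r)"
      using aa ls by (intro mult_right_mono) auto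
    have u1: "\<delta> powi k \<le> lam * (a / sqrt r) * (exp 1)\<^sup>2 * ln (sqrt r)"
      using u False unfolding ls(2) by (simp add: upp_def)
    have u2: "lam * (a / sqrt r) * (exp 1)\<^sup>2 * ln (sqrt r) \<le> lam * (a * sqrt r) * (exp 1)\<^sup>2 * ln (sqrt r)"
      using aa lam_pos ls by (intro mult_right_mono mult_left_mono) auto
    have e: "sqrt r \<le> exp 1" using sqrt_exp2[of r] False by simp
    show ?thesis
      using l l' u1 u2 e v s by (auto simp: admissible_def small_admissible_def)
  qed
  then show "adm (sqrt r, (k, E), a / sqrt r)" "adm (sqrt r, (k, E), a * sqrt r)" by auto
qed

text \<open>For r > exp 2 the two sides are a (sqrt r)^3 and \<delta> \<open>lam\<close> a (sqrt
  r)^(\<open>gam\<close> - 1), and \<open>gam\<close> - 1 \<ge> 4. Otherwise they differ by the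
  factor \<delta> \<open>lam\<close> / r, which is at least 1 since r \<le> exp 2 < exp 3 < \<delta>
  \<open>lam\<close>.\<close>

lemma low_le_upp:
  assumes "valid P"
  shows "low P \<le> \<delta> * upp P"
proof -
  obtain r k E a where Pe: "P = (r, (k, E), a)" by (rule cyl_cases)
  have v: "1 < r" "0 < a" using assms by (auto simp: valid_def Pe)
  have s: "1 < sqrt r" "sqrt r * sqrt r = r" using v by auto
  have dl: "exp 3 \<le> \<delta> * lam" using lam_delta by simp
  have dl1: "1 \<le> \<delta> * lam" using dl exp_ge_add_one_self[of 3] by linarith
  have a_eq: "a * sqrt r = (a / sqrt r) * r" using s v by (simp add: field_simps)
  show ?thesis
  proof (cases "exp 2 < r")
    case True
    have "r powr (3/2) = sqrt r ^ 3"
    proof -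
      have "r powr (3/2) = (r powr (1/2)) powr 3" by (simp add: powr_powr)
      then show ?thesis using v by (simp add: powr_half_sqrt powr_numeral)
    qed
    then have "low P = a * sqrt r ^ 3" using True by (simp add: low_def Pe)
    also have "\<dots> = 1 * (a / sqrt r) * sqrt r ^ 4" using s v by (simp add: field_simps power_def numeral_eq_Suc)
    also have "\<dots> \<le> (\<delta> * lam) * (a / sqrt r) * sqrt r powr gam"
    proof (intro mult_mono)
      have "sqrt r ^ 4 \<le> sqrt r ^ 5" using s by (intro power_increasing) auto
      also have "\<dots> \<le> sqrt r powr gam" using powr_gam[of "sqrt r"] s by simp
      finally show "sqrt r ^ 4 \<le> sqrt r powr gam" .
    qed (use dl1 v in auto)
    also have "\<dots> = \<delta> * upp P" using True by (simp add: upp_def Pe mult_ac)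
    finally show ?thesis .
  next
    case False
    have "r \<le> exp 3" using False exp_le_cancel_iff[of 2 "3::real"] by (auto intro: order_trans[of _ "exp 2"])
    then have r: "r \<le> \<delta> * lam" using dl by simp
    have "low P = r * ((a / sqrt r) * (exp 1)\<^sup>2 * (ln r / 2))"
      using False a_eq by (simp add: low_def Pe mult_ac)
    also have "\<dots> \<le> (\<delta> * lam) * ((a / sqrt r) * (exp 1)\<^sup>2 * (ln r / 2))"
      using r v by (intro mult_right_mono) auto
    also have "\<dots> = \<delta> * upp P" using False by (simp add: upp_def Pe mult_ac)
    finally show ?thesis .
  qed
qed

text \<open>Admissibility bounds the scale from below for P itself; this is enough for its vertical
  halves too, so that only a scale above \<open>upp\<close> can prevent a vertical
  subdivision.\<close>

lemma adm_high:
  assumes "adm P" "valid P"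
  shows "high P"
proof -
  obtain r k E a where Pe: "P = (r, (k, E), a)" by (rule cyl_cases)
  have v: "1 < r" "0 < a" using assms(2) by (auto simp: valid_def Pe)
  have s: "1 < sqrt r" "sqrt r * sqrt r = r" using v by auto
  show ?thesis
  proof (cases "exp 1 < r")
    case True
    then have ad: "a * r\<^sup>2 \<le> \<delta> powi k"
      using assms by (auto simp: admissible_def large_admissible_def small_admissible_def Pe)
    have "low P \<le> a * r\<^sup>2"
    proof (cases "exp 2 < r")
      case True
      have "r powr (3/2) \<le> r powr 2" using v by (intro powr_mono) auto
      then show ?thesis using True v by (simp add: low_def Pe powr_numeral)
    next
      case False
      let ?u = "sqrt r"
      \<comment> \<open>The line u / exp 1 is tangent to ln at exp 1. For exp 1 < r \<le> exp 2 it
        gives sqrt r * (exp 1)^2 * ln (sqrt r) \<le> exp 1 * r \<le> r^2.\<close>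
      have lu: "ln ?u \<le> ?u / exp 1"
      proof -
        have "ln (?u / exp 1) \<le> ?u / exp 1 - 1" using s by (intro ln_le_minus_one) auto
        then show ?thesis using s by (simp add: ln_div)
      qed
      have "?u * (exp 1)\<^sup>2 * ln ?u \<le> ?u * (exp 1)\<^sup>2 * (?u / exp 1)"
        using lu s by (intro mult_left_mono) auto
      also have "\<dots> = exp 1 * r" using s by (simp add: power2_eq_square)
      also have "\<dots> \<le> r * r" using \<open>exp 1 < r\<close> v by (intro mult_right_mono) auto
      finally have "a * (?u * (exp 1)\<^sup>2 * ln ?u) \<le> a * r\<^sup>2"
        using v by (intro mult_left_mono) (auto simp: power2_eq_square)
      then show ?thesis using False v by (simp add: low_def Pe ln_sqrt mult_ac)
    qed
    then show ?thesis using ad by (simp add: high_def Pe)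
  next
    case False
    then have ad: "a * (exp 1)\<^sup>2 * ln r \<le> \<delta> powi k"
      using assms by (auto simp: admissible_def large_admissible_def small_admissible_def Pe)
    have "r \<le> 4" using False exp_le by linarith
    then have "sqrt r \<le> sqrt 4" by (rule real_sqrt_le_mono)
    then have s2: "sqrt r \<le> 2" by simp
    have "\<not> exp 2 < r" using False exp_less_cancel_iff[of 1 "2::real"] by linarith
    then have "low P = (a * (exp 1)\<^sup>2 * ln r) * (sqrt r / 2)" by (simp add: low_def Pe mult_ac)
    also have "\<dots> \<le> (a * (exp 1)\<^sup>2 * ln r) * 1"
      using s2 v by (intro mult_left_mono) auto
    finally show ?thesis using ad by (simp add: high_def Pe)
  qed
qed

text \<open>If a cylinder satisfying \<open>high\<close> is not split vertically, its scale exceeds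
  \<open>upp\<close>. By \<open>low_le_upp\<close> one factor \<delta> cannot bring it below
  \<open>low\<close>, which depends only on radius and center and hence is the same for the
  sons.\<close>

lemma sons_high:
  assumes P: "valid P" "high P" and S: "S \<in> sons P"
  shows "high S"
    "(adm S \<and> gen S = gen P \<and> ln (rad S) = ln (rad P) / 2) \<or> (gen S = gen P + 1 \<and> rad S = rad P)"
proof -
  obtain r k E a where Pe: "P = (r, (k, E), a)" by (rule cyl_cases)
  have v: "E \<in> \<Q> k" "1 < r" "0 < a" using P by (auto simp: valid_def Pe)
  have vP: "valid (r, (k, E), a)" using P Pe by simp
  from vP have "high S \<and> ((adm S \<and> gen S = gen P \<and> ln (rad S) = ln (rad P) / 2) \<or> (gen S = gen P + 1 \<and> rad S = rad P))"
  proof (cases rule: sons_cases)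
    case vertical
    then have a: "adm S" using S Pe by auto
    have "high S" using adm_high[OF a sons_refine(1)[OF P(1) S]] .
    then show ?thesis using a S Pe vertical(3) v by (auto simp: ln_sqrt)
  next
    case horizontal
    then obtain E' where Se: "S = (r, (k + 1, E'), a)" using S Pe by auto
    have "upp P < \<delta> powi k"
      using halves_adm[OF vP] horizontal(1) P(2) Pe by (meson not_le)
    then have "\<delta> * upp P \<le> \<delta> powi (k + 1)" using delta by (simp add: powi_Suc)
    then have "low P \<le> \<delta> powi (k + 1)" using low_le_upp[OF P(1)] by simp
    moreover have "low P = low S" by (simp add: low_def Se Pe)
    ultimately show ?thesis by (simp add: high_def Se Pe)
  qed
  then show "high S" "(adm S \<and> gen S = gen P \<and> ln (rad S) = ln (rad P) / 2) \<or> (gen S = gen P + 1 \<and> rad S = rad P)"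
    by auto
qed

lemma allsons_high:
  assumes "\<And>P. P \<in> F \<Longrightarrow> valid P \<and> high P" "S \<in> allsons F"
  shows "valid S \<and> high S"
proof -
  obtain P where P: "P \<in> F" "S \<in> sons P" using assms(2) unfolding all_sons_def by blast
  then show ?thesis using sons_refine(1) sons_high(1) assms(1) by blast
qed

lemma funpow_high:
  assumes "\<And>P. P \<in> F \<Longrightarrow> valid P \<and> high P"
  shows "\<And>S. S \<in> (allsons ^^ m) F \<Longrightarrow> valid S \<and> high S"
proof (induction m)
  case (Suc m)
  then show ?case using allsons_high[of "(allsons ^^ m) F" S] by simp
qed (use assms in simp)

text \<open>A weaker consequence of \<open>high\<close>, linear in ln r and uniform over both ranges
  of the radius, which is all that the shrinking argument uses.\<close>

lemma high_lower:
  assumes "valid P" "high P"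
  shows "cen P * ln (rad P) \<le> \<delta> powi gen P"
proof -
  obtain r k E a where Pe: "P = (r, (k, E), a)" by (rule cyl_cases)
  have v: "1 < r" "0 < a" using assms by (auto simp: valid_def Pe)
  have s: "1 < sqrt r" "sqrt r * sqrt r = r" using v by auto
  have "a * ln r \<le> low P"
  proof (cases "exp 2 < r")
    case True
    have "ln r \<le> r - 1" using v by (intro ln_le_minus_one) auto
    also have "\<dots> \<le> r powr 1" using v by simp
    also have "\<dots> \<le> r powr (3/2)" using v by (intro powr_mono) auto
    finally show ?thesis using v True by (simp add: low_def Pe)
  next
    case False
    have "2 \<le> exp (1::real)" using exp_ge_add_one_self[of 1] by simp
    then have "2 * 1 \<le> exp (1::real) * exp 1" by (intro mult_mono) auto
    then have "2 * 1 \<le> (exp 1)\<^sup>2 * sqrt r"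
      unfolding power2_eq_square using s by (intro mult_mono) auto
    then have "(a * (ln r / 2)) * 2 \<le> (a * (ln r / 2)) * ((exp 1)\<^sup>2 * sqrt r)"
      using v by (intro mult_left_mono) auto
    then show ?thesis using False by (simp add: low_def Pe mult_ac)
  qed
  then show ?thesis using assms(2) by (simp add: high_def Pe)
qed

text \<open>With \<open>L = ln (rad P)\<close> and \<open>H = \<delta> powi gen P\<close> the product \<open>L * H\<close> decreases geometrically along
  sons, while \<open>high\<close> gives \<open>H \<ge> const * L\<close>. Hence \<open>L\<close> tends to 0, there are infinitely many vertical
  subdivisions, and admissibility after such a subdivision bounds \<open>H\<close> by a multiple of \<open>L\<close>.\<close>

lemma sons_shrink:
  fixes Ps :: "nat \<Rightarrow> 'v cyl"
  assumes 0: "valid (Ps 0)" "high (Ps 0)" and step: "\<And>i. Ps (Suc i) \<in> sons (Ps i)" and e: "0 < e"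
  shows "\<exists>i. ln (rad (Ps i)) < e \<and> \<delta> powi gen (Ps i) < e"
proof -
  define L where "L i = ln (rad (Ps i))" for i
  define H where "H i = \<delta> powi gen (Ps i)" for i
  have vh: "valid (Ps i) \<and> high (Ps i)" for i
    by (induction i) (use 0 step sons_refine(1) sons_high(1) in blast)+
  have Lpos: "0 < L i" for i using vh[of i] by (auto simp: L_def valid_def)
  have Hpos: "0 < H i" for i using powi_pos by (simp add: H_def)
  have st: "(adm (Ps (Suc i)) \<and> H (Suc i) = H i \<and> L (Suc i) = L i / 2) \<or> (H (Suc i) = \<delta> * H i \<and> L (Suc i) = L i)" for i
    using sons_high(2)[of "Ps i", OF _ _ step] vh[of i] by (auto simp: H_def L_def powi_Suc)
  \<comment> \<open>A vertical son halves L and a son of the cell multiplies H by \<delta>; q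
    dominates both factors.\<close>
  define q where "q = max \<delta> (1/2)"
  have q: "0 < q" "q < 1" "\<delta> \<le> q" "1/2 \<le> q" using delta by (auto simp: q_def)
  have LH: "L i * H i \<le> q ^ i * (L 0 * H 0)" for i
  proof (induction i)
    case (Suc i)
    have p: "0 < L i * H i" using Lpos Hpos by simp
    have "L (Suc i) * H (Suc i) \<le> q * (L i * H i)"
    proof -
      have "L (Suc i) * H (Suc i) = (1/2) * (L i * H i) \<or> L (Suc i) * H (Suc i) = \<delta> * (L i * H i)"
        using st[of i] by (auto simp: mult_ac)
      then show ?thesis using mult_right_mono[OF q(3), of "L i * H i"] mult_right_mono[OF q(4), of "L i * H i"] p by auto
    qed
    also have "\<dots> \<le> q * (q ^ i * (L 0 * H 0))" using Suc q by (intro mult_left_mono) auto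
    finally show ?case by simp
  qed simp
  \<comment> \<open>The time intervals stay inside the first one, so the centers remain between two
    positive constants a0 and a1 and the bounds on L and H are uniform.\<close>
  have tin: "tint (Ps i) \<subseteq> tint (Ps 0)" for i
    by (induction i) (use sons_refine(3) vh step in blast)+
  have cen_in: "ln (cen (Ps i)) \<in> tint (Ps i)" for i
    using vh[of i] by (auto simp: valid_def tint_def ln_div ln_mult)
  define a0 where "a0 = cen (Ps 0) / rad (Ps 0)"
  define a1 where "a1 = cen (Ps 0) * rad (Ps 0)"
  have a01: "0 < a0" "0 < a1" using vh[of 0] by (auto simp: a0_def a1_def valid_def)
  have cen: "a0 \<le> cen (Ps i) \<and> cen (Ps i) \<le> a1" for i
  proof -
    have "ln (cen (Ps i)) \<in> tint (Ps 0)" using cen_in tin by blast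
    moreover have "0 < cen (Ps i)" using vh[of i] by (auto simp: valid_def)
    ultimately show ?thesis using a01
      by (auto simp: tint_def a0_def[symmetric] a1_def[symmetric])
  qed
  have LH': "a0 * L i \<le> H i" for i
  proof -
    have "a0 * L i \<le> cen (Ps i) * L i" using cen[of i] Lpos[of i] by (intro mult_right_mono) auto
    also have "\<dots> \<le> H i" using high_lower[of "Ps i"] vh[of i] by (simp add: L_def H_def)
    finally show ?thesis .
  qed
  have sq: "a0 * (L i)\<^sup>2 \<le> q ^ i * (L 0 * H 0)" for i
  proof -
    have "a0 * (L i)\<^sup>2 = L i * (a0 * L i)" by (simp add: power2_eq_square)
    also have "\<dots> \<le> L i * H i" using LH' Lpos[of i] by (intro mult_left_mono) auto
    finally show ?thesis using LH[of i] by simp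
  qed
  have small: "\<exists>i. \<forall>j\<ge>i. L j < e'" if e': "0 < e'" for e'
  proof -
    have "(\<lambda>i. q ^ i * (L 0 * H 0)) \<longlonglongrightarrow> 0 * (L 0 * H 0)"
      using q by (intro tendsto_mult LIMSEQ_realpow_zero) auto
    moreover have "0 * (L 0 * H 0) < a0 * e'\<^sup>2" using a01 e' by simp
    ultimately have "\<forall>\<^sub>F i in sequentially. q ^ i * (L 0 * H 0) < a0 * e'\<^sup>2"
      by (rule order_tendstoD(2))
    then obtain i where i: "\<And>j. j \<ge> i \<Longrightarrow> q ^ j * (L 0 * H 0) < a0 * e'\<^sup>2"
      by (auto simp: eventually_sequentially)
    have "L j < e'" if "j \<ge> i" for j
    proof -
      have "a0 * (L j)\<^sup>2 < a0 * e'\<^sup>2" using sq[of j] i[OF that] by simp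
      then have "(L j)\<^sup>2 < e'\<^sup>2" using a01 by simp
      then show ?thesis using e' by (simp add: power2_less_imp_less)
    qed
    then show ?thesis by auto
  qed
  \<comment> \<open>The constant in the upper bound of small admissibility, with the center replaced
    by its bound a1. In e' the entry 1 forces the radius below exp 1, so that admissibility is of
    the small kind, and e / K turns the bound into H < e.\<close>
  define K where "K = lam * a1 * (exp 1)\<^sup>2"
  have K: "0 < K" using lam_pos a01 by (simp add: K_def)
  define e' where "e' = min (min e 1) (e / K)"
  have e': "0 < e'" "e' \<le> e" "e' \<le> 1" "e' \<le> e / K" using e K by (auto simp: e'_def)
  obtain i where i: "\<And>j. j \<ge> i \<Longrightarrow> L j < e'" using small[OF e'(1)] by auto
  have "\<exists>j\<ge>i. L (Suc j) \<noteq> L j"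
  proof (rule ccontr)
    assume c: "\<not> ?thesis"
    have "L (i + m) = L i" for m by (induction m) (use c in auto)
    moreover obtain i' where "\<And>j. j \<ge> i' \<Longrightarrow> L j < L i" using small[OF Lpos[of i]] by auto
    ultimately show False by (metis le_add2 less_irrefl)
  qed
  then obtain j where j: "j \<ge> i" "L (Suc j) \<noteq> L j" by auto
  then have ad: "adm (Ps (Suc j))" using st[of j] by auto
  have Lj: "L (Suc j) < e'" using i j by simp
  obtain r k E a where Pe: "Ps (Suc j) = (r, (k, E), a)" by (rule cyl_cases)
  have lr: "ln r < 1" "0 < ln r" "0 < a" "1 < r"
    using Lj e'(3) Lpos[of "Suc j"] vh[of "Suc j"] by (auto simp: L_def Pe valid_def)
  then have "r < exp 1" by (metis exp_less_mono exp_ln less_trans zero_less_one)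
  then have "\<delta> powi k \<le> lam * a * (exp 1)\<^sup>2 * ln r"
    using ad by (auto simp: Pe admissible_def large_admissible_def small_admissible_def)
  also have "\<dots> \<le> lam * a1 * (exp 1)\<^sup>2 * ln r"
    using cen[of "Suc j"] lam_pos lr by (intro mult_right_mono mult_left_mono) (auto simp: Pe)
  also have "\<dots> < K * (e / K)" unfolding K_def[symmetric]
    using Lj e'(4) K by (intro mult_strict_left_mono) (auto simp: L_def Pe)
  finally have "\<delta> powi gen (Ps (Suc j)) < e" using K by (simp add: Pe)
  moreover have "ln (rad (Ps (Suc j))) < e" using Lj e'(2) by (simp add: L_def)
  ultimately show ?thesis by blast
qed

end

section \<open>The increasing chain of cylinders and its time intervals\<close>

locale cylinder_chain = cube_system +
  fixes P0 :: "'a cyl"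
  assumes P0: "large_admissible \<Q> \<delta> gam lam P0"
begin

definition "ch k = chain \<Q> \<delta> gam lam P0 k"
definition "up k = snd (chain_state \<Q> \<delta> gam lam P0 k)"
definition "side k = side_family \<Q> \<delta> gam lam P0 k"

lemma chain_0: "ch 0 = P0" "up 0"
  by (simp_all add: ch_def up_def chain_def)

lemma chain_Suc:
  "ch (Suc k) = (if adm (parent_side \<Q> (ch k)) then parent_side \<Q> (ch k)
     else if up k then parent_up (ch k) else parent_down (ch k))"
  "up (Suc k) = (if adm (parent_side \<Q> (ch k)) then up k else \<not> up k)"
  by (auto simp: ch_def up_def chain_def Let_def split: prod.splits)

text \<open>The upward parent needs (a r) (r^2)^2 = a r^5 below the scale, the downward one only (a
  / r^2) (r^3)^2 = a r^4. Both follow from \<open>not_adm_side\<close>, and the first accounts for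
  the condition \<open>gam\<close> \<ge> 5.\<close>

lemma chain_ok_step:
  assumes "chain_ok (r, (k, E), a)"
  shows "adm (parent_side \<Q> (r, (k, E), a)) \<Longrightarrow> chain_ok (parent_side \<Q> (r, (k, E), a))"
    "\<not> adm (parent_side \<Q> (r, (k, E), a)) \<Longrightarrow> chain_ok (parent_up (r, (k, E), a))"
    "\<not> adm (parent_side \<Q> (r, (k, E), a)) \<Longrightarrow> chain_ok (parent_down (r, (k, E), a))"
proof -
  from assms have v: "E \<in> \<Q> k" "exp 1 < r" "0 < a" "a * r\<^sup>2 \<le> \<delta> powi k"
    by (auto simp: chain_ok_def valid_def)
  have r1: "1 < r" using v(2) exp_ge_add_one_self[of 1] by linarith
  have "\<delta> powi k \<le> \<delta> powi (k - 1)"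
    using powi_pred[of k] delta powi_pos[of "k - 1"] mult_right_mono[of \<delta> 1 "\<delta> powi (k - 1)"] by simp
  then show "chain_ok (parent_side \<Q> (r, (k, E), a))"
    using v par(1)[OF v(1)] r1
    by (auto simp: chain_ok_def valid_def parent_side_def cube_parent_eq)
  assume na: "\<not> adm (parent_side \<Q> (r, (k, E), a))"
  have "1 * (a * r ^ 5) \<le> exp 3 * (a * r ^ 5)" using v(3) r1 by (intro mult_right_mono) auto
  then have r5: "a * r ^ 5 \<le> \<delta> powi k" using not_adm_side[OF assms na] by (simp add: mult_ac)
  have "r ^ 1 \<le> r ^ 2" "r ^ 1 \<le> r ^ 3" using r1 by (intro power_increasing; simp)+
  then have e: "exp 1 < r\<^sup>2" "exp 1 < r ^ 3" "1 < r\<^sup>2" "1 < r ^ 3" using v r1 by auto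
  have "a * r * (r\<^sup>2)\<^sup>2 = a * r ^ 5" by (simp add: power_def numeral_eq_Suc)
  then have "a * r * (r\<^sup>2)\<^sup>2 \<le> \<delta> powi k" using r5 by (simp only:)
  then show "chain_ok (parent_up (r, (k, E), a))"
    using v e r1 by (auto simp: chain_ok_def valid_def parent_up_def)
  have "a / r\<^sup>2 * (r ^ 3)\<^sup>2 = a * r ^ 4" using r1 by (simp add: power_def numeral_eq_Suc)
  also have "\<dots> \<le> a * r ^ 5" using v(3) r1 by (intro mult_left_mono power_increasing) auto
  finally have "a / r\<^sup>2 * (r ^ 3)\<^sup>2 \<le> \<delta> powi k" using r5 by simp
  then show "chain_ok (parent_down (r, (k, E), a))"
    using v e r1 by (auto simp: chain_ok_def valid_def parent_down_def)
qed

lemma chain_ok: "chain_ok (ch k)"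
proof (induction k)
  case 0
  obtain r k E a where Pe: "P0 = (r, (k, E), a)" by (rule cyl_cases)
  have "1 < r" if "exp 1 < r" using that exp_ge_add_one_self[of 1] by linarith
  moreover have "large_admissible \<Q> \<delta> gam lam (r, (k, E), a)" using P0 Pe by simp
  moreover have "ch 0 = (r, (k, E), a)" using chain_0 Pe by simp
  ultimately show ?case by (simp add: chain_ok_def valid_def large_admissible_def)
next
  case (Suc k)
  obtain r j E a where Pe: "ch k = (r, (j, E), a)" by (rule cyl_cases)
  show ?case using chain_ok_step[of r j E a] Suc unfolding chain_Suc Pe by auto
qed

text \<open>The open time interval gained when passing from the k-th chain cylinder to the next
  one.\<close>

definition vint :: "nat \<Rightarrow> real set" where
  "vint k = (if adm (parent_side \<Q> (ch k)) then {} else tint (cyl_diff (ch (Suc k)) (ch k)))"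

lemma chain_step:
  assumes Pe: "ch k = (r, (j, E), a)"
  obtains
    (side) "adm (parent_side \<Q> (ch k))" "ch (Suc k) = (r, (j - 1, par j E), a)" "up (Suc k) = up k" "side k = {}" "vint k = {}"
  | (up) "\<not> adm (parent_side \<Q> (ch k))" "up k" "\<not> up (Suc k)" "ch (Suc k) = (r\<^sup>2, (j, E), a * r)"
      "side k = translates \<Q> (r, (j, E), a * r\<^sup>2)" "vint k = tint (r, (j, E), a * r\<^sup>2)"
  | (down) "\<not> adm (parent_side \<Q> (ch k))" "\<not> up k" "up (Suc k)" "ch (Suc k) = (r ^ 3, (j, E), a / r\<^sup>2)"
      "side k = translates \<Q> (r\<^sup>2, (j, E), a / r ^ 3)" "vint k = tint (r\<^sup>2, (j, E), a / r ^ 3)"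
proof -
  from chain_ok[of k] have v: "E \<in> \<Q> j" "exp 1 < r" "0 < a" "1 < r"
    by (auto simp: chain_ok_def valid_def Pe)
  \<comment> \<open>\<open>side_family\<close> and \<open>cyl_diff\<close> recognize the kind of
    move by comparing cylinders; the radii r, r^2 and r^3 differ, so the comparison gives the
    intended answer.\<close>
  have "r ^ 1 < r ^ 2" "r ^ 1 < r ^ 3" "r ^ 2 < r ^ 3" using v(4) by (intro power_strict_increasing; simp)+
  then have ne: "r \<noteq> r\<^sup>2" "r \<noteq> r ^ 3" "r\<^sup>2 \<noteq> r ^ 3" by auto
  have sk: "side k = (if ch (Suc k) = parent_side \<Q> (ch k) then {} else translates \<Q> (cyl_diff (ch (Suc k)) (ch k)))"
    by (simp add: side_def side_family_def ch_def Let_def)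
  consider "adm (parent_side \<Q> (ch k))" | "\<not> adm (parent_side \<Q> (ch k))" "up k"
    | "\<not> adm (parent_side \<Q> (ch k))" "\<not> up k" by blast
  then show thesis
  proof cases
    case 1
    show ?thesis
      by (rule side) (use 1 in \<open>auto simp: chain_Suc sk vint_def, auto simp: Pe parent_side_def cube_parent_eq\<close>)
  next
    case 2
    then have c: "ch (Suc k) = parent_up (ch k)" by (simp add: chain_Suc)
    have d: "cyl_diff (parent_up (ch k)) (ch k) = (r, (j, E), a * r\<^sup>2)" by (simp add: cyl_diff_def Pe)
    have n: "parent_up (ch k) \<noteq> parent_side \<Q> (ch k)" using ne by (simp add: parent_up_def parent_side_def Pe)
    show ?thesis
      by (rule up) (use 2 n in \<open>auto simp: c sk vint_def d chain_Suc(2)\<close>, simp add: Pe parent_up_def)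
  next
    case 3
    then have c: "ch (Suc k) = parent_down (ch k)" by (simp add: chain_Suc)
    have d: "cyl_diff (parent_down (ch k)) (ch k) = (r\<^sup>2, (j, E), a / r ^ 3)"
      using ne by (simp add: cyl_diff_def Pe parent_up_def parent_down_def)
    have n: "parent_down (ch k) \<noteq> parent_side \<Q> (ch k)" using ne by (simp add: parent_down_def parent_side_def Pe)
    show ?thesis
      by (rule down) (use 3 n in \<open>auto simp: c sk vint_def d chain_Suc(2)\<close>, simp add: Pe parent_down_def)
  qed
qed

lemma ch_facts:
  assumes "ch k = (r, (j, E), a)"
  shows "E \<in> \<Q> j" "exp 1 < r" "0 < a" "1 < r" "1 < ln r" "valid (ch k)"
proof -
  show v: "E \<in> \<Q> j" "exp 1 < r" "0 < a" "1 < r" "valid (ch k)"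
    using chain_ok[of k] by (auto simp: chain_ok_def valid_def assms)
  have "ln (exp 1) < ln r" using v by (subst ln_less_cancel_iff) auto
  then show "1 < ln r" by simp
qed

definition "lo k = ln (cen (ch k)) - ln (rad (ch k))"
definition "hi k = ln (cen (ch k)) + ln (rad (ch k))"

lemma tint_ch: "tint (ch k) = {lo k<..<hi k}"
proof -
  obtain r j E a where Pe: "ch k = (r, (j, E), a)" by (rule cyl_cases)
  show ?thesis using ch_facts[OF Pe] by (simp add: Pe tint_eq lo_def hi_def)
qed

text \<open>Chain radii satisfy ln r > 1, so each vertical move widens the interval at one end by at
  least 2. This uniform gain makes the intervals exhaust the line.\<close>

lemma side_facts:
  "tiling (side k) (vint k) \<and> (\<forall>S\<in>side k. valid S \<and> high S) \<and>
    ((vint k = {} \<and> lo (Suc k) = lo k \<and> hi (Suc k) = hi k \<and> up (Suc k) = up k \<and> adm (parent_side \<Q> (ch k)))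
    \<or> (vint k = {hi k<..<hi (Suc k)} \<and> lo (Suc k) = lo k \<and> hi k + 2 \<le> hi (Suc k) \<and> up k \<and> \<not> up (Suc k))
    \<or> (vint k = {lo (Suc k)<..<lo k} \<and> hi (Suc k) = hi k \<and> lo (Suc k) + 2 \<le> lo k \<and> \<not> up k \<and> up (Suc k)))"
proof -
  obtain r j E a where Pe: "ch k = (r, (j, E), a)" by (rule cyl_cases)
  note v = ch_facts[OF Pe]
  have r2: "1 < r\<^sup>2" "1 < r ^ 3" using v(4) by auto
  have ln: "ln (a * r) = ln a + ln r" "ln (a * r\<^sup>2) = ln a + 2 * ln r" "ln (r\<^sup>2) = 2 * ln r" "ln (r ^ 3) = 3 * ln r"
    "ln (a / r ^ 3) = ln a - 3 * ln r" "ln (a / r\<^sup>2) = ln a - 2 * ln r"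
    using v by (simp_all add: ln_mult ln_div ln_realpow)
  show ?thesis
    using Pe
  proof (cases rule: chain_step)
    case side
    then show ?thesis using tiling_empty by (auto simp: lo_def hi_def Pe)
  next
    case up
    have h: "high (r, (j, E'), a * r\<^sup>2)" for E'
    proof -
      have "low (r, (j, E'), a * r\<^sup>2) \<le> exp 3 * a * r ^ 5"
      proof (cases "exp 2 < r")
        case True
        have "r powr (3/2) \<le> r powr 3" using v by (intro powr_mono) auto
        then have "a * r\<^sup>2 * r powr (3/2) \<le> a * r\<^sup>2 * r ^ 3"
          using v by (intro mult_left_mono) (auto simp: powr_numeral)
        also have "\<dots> = 1 * (a * r ^ 5)" by (simp add: power_def numeral_eq_Suc)
        also have "\<dots> \<le> exp 3 * (a * r ^ 5)" using v by (intro mult_right_mono) auto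
        finally show ?thesis using True by (simp add: low_def mult_ac)
      next
        case False
        \<comment> \<open>In this range sqrt r \<le> exp 1 and ln r / 2 \<le> 1, so the small-radius
          form of \<open>low\<close> costs exp 1 * (exp 1)^2 = exp 3. This is the exp 3 in the
          condition on \<open>lam\<close>.\<close>
        have l: "ln r / 2 \<le> 1"
        proof -
          have "ln r \<le> ln (exp 2)" using False v by (subst ln_le_cancel_iff) auto
          then show ?thesis by simp
        qed
        have s: "sqrt r \<le> exp 1" using False sqrt_exp2[of r] by simp
        have "a * r\<^sup>2 * sqrt r * (exp 1)\<^sup>2 * (ln r / 2) \<le> a * r\<^sup>2 * exp 1 * (exp 1)\<^sup>2 * 1"
          using l s v by (intro mult_mono) auto
        also have "\<dots> = exp 3 * (a * r\<^sup>2)"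
          by (simp add: exp_add[symmetric] power2_eq_square mult_ac)
        also have "\<dots> \<le> exp 3 * (a * r ^ 5)"
          using v by (intro mult_left_mono power_increasing) auto
        finally show ?thesis using False by (simp add: low_def mult_ac)
      qed
      then show ?thesis using not_adm_side[of r j E a] chain_ok[of k] up(1) Pe by (simp add: high_def)
    qed
    have val: "valid (r, (j, E), a * r\<^sup>2)" using v by (simp add: valid_def)
    have "\<forall>S\<in>side k. valid S \<and> high S"
      unfolding up(5) using h v by (auto simp: translates_def valid_def)
    moreover have "vint k = {hi k<..<hi (Suc k)} \<and> lo (Suc k) = lo k \<and> hi k + 2 \<le> hi (Suc k)"
      using v r2 by (auto simp: up(4,6) lo_def hi_def Pe tint_eq ln)
    ultimately show ?thesis using tiling_translates[OF val] up by simp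
  next
    case down
    have h: "high (r\<^sup>2, (j, E'), a / r ^ 3)" for E'
    proof -
      have "(exp 1)\<^sup>2 < r\<^sup>2" using v by (intro power_strict_mono) auto
      then have "exp 2 < r\<^sup>2" by (simp add: exp_add[symmetric] power2_eq_square)
      moreover have "(r\<^sup>2) powr (3/2) = r ^ 3"
      proof -
        have "(r\<^sup>2) powr (3/2) = (r powr 2) powr (3/2)" using v by (simp add: powr_numeral)
        also have "\<dots> = r powr 3" by (simp add: powr_powr)
        finally show ?thesis using v by (simp add: powr_numeral)
      qed
      \<comment> \<open>Radius r^2 and center a / r^3 make the threshold exactly a, so the lower
        bound in \<open>chain_ok\<close> suffices.\<close>
      ultimately have "low (r\<^sup>2, (j, E'), a / r ^ 3) = a" using v by (simp add: low_def)
      also have "\<dots> \<le> a * r\<^sup>2" using v r2 by simp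
      also have "\<dots> \<le> \<delta> powi j" using chain_ok[of k] by (simp add: chain_ok_def Pe)
      finally show ?thesis by (simp add: high_def)
    qed
    have val: "valid (r\<^sup>2, (j, E), a / r ^ 3)" using v by (simp add: valid_def)
    have "\<forall>S\<in>side k. valid S \<and> high S"
      unfolding down(5) using h v by (auto simp: translates_def valid_def)
    moreover have "vint k = {lo (Suc k)<..<lo k} \<and> hi (Suc k) = hi k \<and> lo (Suc k) + 2 \<le> lo k"
      using v r2 by (auto simp: down(4,6) lo_def hi_def Pe tint_eq ln)
    ultimately show ?thesis using tiling_translates[OF val] down by simp
  qed
qed

lemmas side_tiling = side_facts[THEN conjunct1]
  and side_high = side_facts[THEN conjunct2, THEN conjunct1, rule_format]
  and vint_split = side_facts[THEN conjunct2, THEN conjunct2]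

lemma lo_hi_Suc: "lo (Suc k) \<le> lo k" "hi k \<le> hi (Suc k)"
  using vint_split[of k] by (elim disjE conjE; simp)+

lemma lo_hi_mono: "i \<le> j \<Longrightarrow> lo j \<le> lo i" "i \<le> j \<Longrightarrow> hi i \<le> hi j"
  by (rule lift_Suc_antimono_le[of lo], rule lo_hi_Suc, assumption)
     (rule lift_Suc_mono_le[of hi], rule lo_hi_Suc, assumption)

lemma vint_sub: "vint k \<subseteq> {lo (Suc k)<..<hi (Suc k)}" "vint k \<inter> {lo k<..<hi k} = {}"
proof -
  obtain r j E a where Pe: "ch k = (r, (j, E), a)" by (rule cyl_cases)
  have "lo k < hi k" using ch_facts[OF Pe] by (simp add: lo_def hi_def Pe)
  then show "vint k \<subseteq> {lo (Suc k)<..<hi (Suc k)}" "vint k \<inter> {lo k<..<hi k} = {}"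
    using vint_split[of k] by auto
qed

text \<open>Sideways moves keep radius and center and multiply the scale by 1 / \<delta> each time,
  so they end by violating the upper bound \<open>lam\<close> a r^\<open>gam\<close>. The small kind
  of admissibility does not apply, as r > exp 1.\<close>

lemma vertical_step: "\<exists>l\<ge>k. \<not> adm (parent_side \<Q> (ch l))"
proof (rule ccontr)
  assume "\<not> ?thesis"
  then have a: "\<And>l. l \<ge> k \<Longrightarrow> adm (parent_side \<Q> (ch l))" by auto
  obtain r j E a where Pe: "ch k = (r, (j, E), a)" by (rule cyl_cases)
  have eq: "\<exists>E'. ch (k + m) = (r, (j - int m, E'), a)" for m
  proof (induction m)
    case (Suc m)
    then obtain E' where "ch (k + m) = (r, (j - int m, E'), a)" by auto
    then show ?case using a[of "k + m"] by (auto simp: chain_Suc parent_side_def cube_parent_eq algebra_simps)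
  qed (simp add: Pe)
  note v = ch_facts[OF Pe]
  have le: "\<delta> powi (j - int m - 1) \<le> lam * a * r powr gam" for m
  proof -
    obtain E' where "ch (k + m) = (r, (j - int m, E'), a)" using eq by blast
    then show ?thesis using a[of "k + m"] v
      by (auto simp: parent_side_def cube_parent_eq admissible_def large_admissible_def small_admissible_def)
  qed
  have p: "\<delta> powi j * (1 / \<delta>) ^ Suc m \<le> lam * a * r powr gam" for m
  proof -
    have "\<delta> powi (j - int m - 1) = \<delta> powi j / \<delta> powi (int (Suc m))"
      using delta power_int_diff[of \<delta> j "int (Suc m)"] by (simp add: algebra_simps)
    also have "\<dots> = \<delta> powi j * (1 / \<delta>) ^ Suc m" by (simp only: power_int_of_nat power_inverse divide_inverse mult_1)
    finally show ?thesis using le[of m] by simp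
  qed
  have "1 < 1 / \<delta>" using delta by simp
  then obtain m where "lam * a * r powr gam / \<delta> powi j < (1 / \<delta>) ^ m"
    using real_arch_pow by blast
  also have "\<dots> \<le> (1 / \<delta>) ^ Suc m" using delta by (intro power_increasing) auto
  finally show False using p[of m] powi_pos[of j] by (simp add: field_simps)
qed

lemma flip: "\<exists>l>k. up l \<noteq> up k \<and> (if up k then hi k + 2 \<le> hi l else lo l + 2 \<le> lo k)"
proof -
  define l where "l = (LEAST l. l \<ge> k \<and> \<not> adm (parent_side \<Q> (ch l)))"
  have l: "l \<ge> k \<and> \<not> adm (parent_side \<Q> (ch l))" unfolding l_def using vertical_step[of k] by (rule LeastI_ex)
  have before: "adm (parent_side \<Q> (ch i))" if "k \<le> i" "i < l" for i
    using not_less_Least[of i "\<lambda>l. l \<ge> k \<and> \<not> adm (parent_side \<Q> (ch l))"] that by (auto simp: l_def)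
  have same: "k + m \<le> l \<Longrightarrow> up (k + m) = up k" for m
    by (induction m) (use before in \<open>auto simp: chain_Suc\<close>)
  have "up l = up k" using same[of "l - k"] l by simp
  then show ?thesis using vint_split[of l] l lo_hi_mono[of k l]
    by (intro exI[of _ "Suc l"]) (auto split: if_splits)
qed

text \<open>Upward and downward enlargements alternate, so each round of two extends both ends.
  Starting rounds where the flag is up makes the induction uniform.\<close>

lemma exhaust_aux: "\<exists>l\<ge>k. up l \<and> hi k + real m \<le> hi l \<and> lo l + real m \<le> lo k"
proof (induction m)
  case 0
  show ?case
  proof (cases "up k")
    case True
    then show ?thesis by auto
  next
    case False
    then obtain l where "l > k" "up l" using flip[of k] by auto
    then show ?thesis using lo_hi_mono[of k l] by (intro exI[of _ l]) auto
  qed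
next
  case (Suc m)
  then obtain l where l: "l \<ge> k" "up l" "hi k + real m \<le> hi l" "lo l + real m \<le> lo k" by auto
  obtain l' where l': "l' > l" "\<not> up l'" "hi l + 2 \<le> hi l'" using flip[of l] l by auto
  obtain l'' where l'': "l'' > l'" "up l''" "lo l'' + 2 \<le> lo l'" using flip[of l'] l' by auto
  show ?case using l l' l'' lo_hi_mono[of l l'] lo_hi_mono[of l' l''] by (intro exI[of _ l'']) auto
qed

lemma exhaust: "\<exists>l\<ge>k. t \<in> {lo l<..<hi l}"
proof -
  obtain m :: nat where m: "\<bar>t\<bar> + \<bar>lo k\<bar> + \<bar>hi k\<bar> < real m" using reals_Archimedean2 by blast
  obtain l where "l \<ge> k" "hi k + real m \<le> hi l \<and> lo l + real m \<le> lo k" using exhaust_aux by blast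
  then show ?thesis using m by (intro exI[of _ l]) auto
qed

text \<open>The term for \<open>j = 0\<close> is the family \<open>side k\<close> itself.\<close>

definition Dneg :: "nat \<Rightarrow> 'a cyl set" where
  "Dneg k = translates \<Q> (ch k) \<union> (\<Union>j. (allsons ^^ j) (side (k + j)))"

section \<open>The generations as nested tilings\<close>

abbreviation "D \<equiv> D_family \<Q> \<delta> gam lam P0"

lemma D_neg: "D (- int k) = Dneg k"
proof -
  have "(\<Union>l\<in>{k<..}. (allsons ^^ (l - k)) (side l)) \<union> side k = (\<Union>j. (allsons ^^ j) (side (k + j)))"
    (is "?A = ?B")
  proof
    show "?A \<subseteq> ?B"
    proof
      fix x assume "x \<in> ?A"
      then have "x \<in> side k \<or> (\<exists>l>k. x \<in> (allsons ^^ (l - k)) (side l))" by blast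
      then obtain l where "l \<ge> k" "x \<in> (allsons ^^ (l - k)) (side l)"
      proof
        assume "x \<in> side k"
        then show thesis using that[of k] by simp
      next
        assume "\<exists>l>k. x \<in> (allsons ^^ (l - k)) (side l)"
        then show thesis using that by (meson less_imp_le)
      qed
      then have "x \<in> (allsons ^^ (l - k)) (side (k + (l - k)))" by simp
      then show "x \<in> ?B" by blast
    qed
    show "?B \<subseteq> ?A"
    proof
      fix x assume "x \<in> ?B"
      then obtain j where j: "x \<in> (allsons ^^ j) (side (k + j))" by blast
      show "x \<in> ?A"
      proof (cases j)
        case 0
        then show ?thesis using j by simp
      next
        case (Suc i)
        then have "k + j \<in> {k<..}" "x \<in> (allsons ^^ (k + j - k)) (side (k + j))" using j by auto
        then show ?thesis by blast
      qed
    qed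
  qed
  then show ?thesis
    unfolding Dneg_def D_family_def Let_def ch_def[symmetric] side_def[symmetric] by auto
qed

lemma D_pos: "D (int n) = (allsons ^^ n) (Dneg 0)"
proof (cases n)
  case 0
  then show ?thesis using D_neg[of 0] by simp
next
  case (Suc m)
  have "D (int n) = (allsons ^^ nat (int n)) (D 0)"
    unfolding D_family_def Let_def using Suc by (simp del: nat_int)
  then show ?thesis using D_neg[of 0] by simp
qed

text \<open>The line is cut into the interval of the k-th chain cylinder and the intervals gained at
  later steps, omitting the countably many endpoints. A gained interval is disjoint from all earlier
  ones, and iterated sons of a tiling of a slab still tile that slab.\<close>

lemma tiling_Dneg: "tiling (Dneg k) UNIV"
proof -
  define F where "F i = (case i of 0 \<Rightarrow> translates \<Q> (ch k) | Suc j \<Rightarrow> (allsons ^^ j) (side (k + j)))" for i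
  define V where "V i = (case i of 0 \<Rightarrow> {lo k<..<hi k} | Suc j \<Rightarrow> vint (k + j))" for i
  have "Dneg k = (\<Union>i. F i)"
  proof -
    have "(\<Union>i. F i) = F 0 \<union> (\<Union>j. F (Suc j))" by (subst UNIV_nat_eq) auto
    then show ?thesis by (simp add: Dneg_def F_def)
  qed
  moreover have "tiling (\<Union>i. F i) UNIV"
  proof (rule tiling_Union[where V = V])
    show "tiling (F i) (V i)" for i
    proof (cases i)
      case 0
      obtain r j E a where Pe: "ch k = (r, (j, E), a)" by (rule cyl_cases)
      show ?thesis using tiling_translates[OF ch_facts(6)[OF Pe]] tint_ch[of k] 0 by (simp add: F_def V_def)
    next
      case (Suc j)
      then show ?thesis using tiling_funpow[OF side_tiling] by (simp add: F_def V_def)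
    qed
    have sub: "V i \<subseteq> {lo (k + i)<..<hi (k + i)}" for i
      by (cases i) (use vint_sub(1)[of "k + (i - 1)"] in \<open>auto simp: V_def\<close>)
    show "V i \<inter> V j = {}" if "i < j" for i j
    proof -
      obtain j' where j': "j = Suc j'" using \<open>i < j\<close> by (cases j) auto
      then have "{lo (k + i)<..<hi (k + i)} \<subseteq> {lo (k + j')<..<hi (k + j')}"
        using lo_hi_mono[of "k + i" "k + j'"] that by auto
      moreover have "V j \<inter> {lo (k + j')<..<hi (k + j')} = {}"
        using vint_sub(2)[of "k + j'"] by (simp add: V_def j')
      ultimately show ?thesis using sub[of i] by blast
    qed
    show "countable (range lo \<union> range hi)" by auto
    show "UNIV - (range lo \<union> range hi) \<subseteq> (\<Union>i. V i)"
    proof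
      fix t assume t: "t \<in> UNIV - (range lo \<union> range hi)"
      \<comment> \<open>The first chain interval containing t; unless it is the initial one, t was
        gained at the step leading to it.\<close>
      define l where "l = (LEAST l. l \<ge> k \<and> t \<in> {lo l<..<hi l})"
      have l: "l \<ge> k \<and> t \<in> {lo l<..<hi l}" unfolding l_def using exhaust[of k t] by (rule LeastI_ex)
      show "t \<in> (\<Union>i. V i)"
      proof (cases "l = k")
        case True
        then have "t \<in> V 0" using l by (simp add: V_def)
        then show ?thesis by blast
      next
        case False
        then obtain m where m: "l = Suc m" "m \<ge> k" using l by (cases l) auto
        have "m < (LEAST l. l \<ge> k \<and> t \<in> {lo l<..<hi l})" using m(1) unfolding l_def by simp
        then have "\<not> (k \<le> m \<and> t \<in> {lo m<..<hi m})" by (rule not_less_Least)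
        then have "t \<notin> {lo m<..<hi m}" using m(2) by blast
        moreover have "t \<noteq> lo m" "t \<noteq> hi m" using t by auto
        ultimately have "t < lo m \<or> hi m < t" by auto
        moreover have "lo (Suc m) < t" "t < hi (Suc m)" using l m by auto
        ultimately have "t \<in> vint m" using vint_split[of m] by (elim disjE conjE) auto
        then have "t \<in> V (Suc (m - k))" using m by (simp add: V_def)
        then show ?thesis by blast
      qed
    qed
  qed
  ultimately show ?thesis by simp
qed

lemma tiling_D: "tiling (D i) UNIV"
proof (cases i rule: int_cases2)
  case (nonneg n)
  then show ?thesis using D_pos tiling_funpow[OF tiling_Dneg] by simp
next
  case (nonpos n)
  then show ?thesis using D_neg tiling_Dneg by simp
qed

lemma Dneg_high: "S \<in> Dneg 0 \<Longrightarrow> valid S \<and> high S"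
proof -
  assume S: "S \<in> Dneg 0"
  obtain r j E a where Pe: "P0 = (r, (j, E), a)" by (rule cyl_cases)
  consider "S \<in> translates \<Q> (ch 0)" | m where "S \<in> (allsons ^^ m) (side (0 + m))"
    using S unfolding Dneg_def by blast
  then show ?thesis
  proof cases
    case 1
    moreover have "ch 0 = (r, (j, E), a)" using chain_0 Pe by simp
    ultimately obtain E' where S': "S = (r, (j, E'), a)" "E' \<in> \<Q> j" by (auto simp: translates_def)
    have la: "large_admissible \<Q> \<delta> gam lam (r, (j, E), a)" using P0 Pe by simp
    have "1 < r" if "exp 1 < r" using that exp_ge_add_one_self[of 1] by linarith
    then have "adm S" "valid S" using la S' by (auto simp: valid_def admissible_def large_admissible_def)
    then show ?thesis using adm_high by blast
  next
    case 2
    show ?thesis by (rule funpow_high[OF side_high 2])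
  qed
qed

text \<open>The vertical moves. From radius r the parent has radius r^2 or r^3; from the added
  cylinders it has radius r^2 over r, or r^3 over r^2. So the logarithms are multiplied by 2, 3 or
  3/2.\<close>

lemma translates_refine:
  assumes "S \<in> translates \<Q> (r, (j, E), a)" "1 < r" "0 < a" "1 < r'" "0 < a'"
    "ln a' - ln r' \<le> ln a - ln r" "ln a + ln r \<le> ln a' + ln r'" "3 / 2 * ln r \<le> ln r'" "ln r' \<le> 3 * ln r"
  shows "\<exists>R\<in>translates \<Q> (r', (j, E), a'). refines S R"
proof -
  obtain E' where S: "S = (r, (j, E'), a)" "E' \<in> \<Q> j" using assms(1) by (auto simp: translates_def)
  have m: "0 < measure \<nu> E'" using cube_measure[OF S(2)] by simp
  have "\<theta> * ln r \<le> 3 / 2 * ln r" using theta assms(2) by (intro mult_right_mono) auto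
  then have 1: "\<theta> * ln r \<le> ln r'" using assms(8) by linarith
  have "3 * ln r \<le> C1 * ln r" using C1 assms(2) by (intro mult_right_mono) auto
  then have 2: "ln r' \<le> C1 * ln r" using assms(9) by linarith
  have "refines S (r', (j, E'), a')"
    using assms m mult_left_mono[OF 1, of "measure \<nu> E'"] mult_left_mono[OF 2, of "measure \<nu> E'"]
    by (auto simp: refines_def S cyl_box_def weight_def tint_eq mult_ac)
  then show ?thesis using S(2) by (auto simp: translates_def)
qed

text \<open>Translates of the chain cylinder and those of the cylinder added at step k both have
  their parents among the translates of the next chain cylinder. A set reached by m + 1 generations
  of sons from a later added family has its parent at m generations.\<close>

lemma Dneg_refine:
  assumes "S \<in> Dneg k"
  shows "\<exists>R\<in>Dneg (Suc k). refines S R"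
proof -
  obtain r j E a where Pe: "ch k = (r, (j, E), a)" by (rule cyl_cases)
  note v = ch_facts[OF Pe]
  have ln: "ln (a * r) = ln a + ln r" "ln (a * r\<^sup>2) = ln a + 2 * ln r" "ln (r\<^sup>2) = 2 * ln r" "ln (r ^ 3) = 3 * ln r"
    "ln (a / r ^ 3) = ln a - 3 * ln r" "ln (a / r\<^sup>2) = ln a - 2 * ln r"
    using v by (simp_all add: ln_mult ln_div ln_realpow)
  have r2: "1 < r\<^sup>2" "1 < r ^ 3" using v(4) by auto
  consider "S \<in> translates \<Q> (ch k)" | "S \<in> side k" | m where "S \<in> (allsons ^^ Suc m) (side (k + Suc m))"
  proof -
    assume "S \<in> translates \<Q> (ch k) \<Longrightarrow> thesis" "S \<in> side k \<Longrightarrow> thesis"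
      "\<And>m. S \<in> (allsons ^^ Suc m) (side (k + Suc m)) \<Longrightarrow> thesis"
    moreover have "S \<in> translates \<Q> (ch k) \<or> (\<exists>m. S \<in> (allsons ^^ m) (side (k + m)))"
      using assms unfolding Dneg_def by blast
    ultimately show thesis by (metis add.right_neutral funpow_0 not0_implies_Suc)
  qed
  then show ?thesis
  proof cases
    case 1
    have "\<exists>R\<in>translates \<Q> (ch (Suc k)). refines S R" using Pe
    proof (cases rule: chain_step)
      case side
      obtain E' where S: "S = (r, (j, E'), a)" "E' \<in> \<Q> j" using 1 by (auto simp: Pe translates_def)
      have "\<theta> * measure \<nu> E' * (2 * ln r) \<le> measure \<nu> (par j E') * (2 * ln r)"
        using par_growth[OF S(2)] v by (intro mult_right_mono) auto
      moreover have "measure \<nu> (par j E') * (2 * ln r) \<le> C1 * measure \<nu> E' * (2 * ln r)"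
        using par(3)[OF S(2)] v by (intro mult_right_mono) auto
      ultimately have "refines S (r, (j - 1, par j E'), a)"
        using par(2)[OF S(2)] by (auto simp: refines_def S cyl_box_def weight_def tint_def mult_ac)
      then show ?thesis using par(1)[OF S(2)] by (auto simp: side translates_def)
    next
      case up
      show ?thesis unfolding up(4)
        by (rule translates_refine[of S r j E a]) (use 1 v r2 in \<open>auto simp: Pe ln\<close>)
    next
      case down
      show ?thesis unfolding down(4)
        by (rule translates_refine[of S r j E a]) (use 1 v r2 in \<open>auto simp: Pe ln\<close>)
    qed
    then show ?thesis unfolding Dneg_def by blast
  next
    case 2
    have "\<exists>R\<in>translates \<Q> (ch (Suc k)). refines S R" using Pe
    proof (cases rule: chain_step)
      case side
      then show ?thesis using 2 by simp
    next
      case up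
      show ?thesis unfolding up(4)
        by (rule translates_refine[of S r j E "a * r\<^sup>2"]) (use 2 up(5) v r2 in \<open>auto simp: Pe ln\<close>)
    next
      case down
      show ?thesis unfolding down(4)
        by (rule translates_refine[of S "r\<^sup>2" j E "a / r ^ 3"]) (use 2 down(5) v r2 in \<open>auto simp: Pe ln\<close>)
    qed
    then show ?thesis unfolding Dneg_def by blast
  next
    case 3
    let ?F = "(allsons ^^ m) (side (k + Suc m))"
    have "S \<in> allsons ?F" using 3 by simp
    then obtain P where P: "P \<in> ?F" "S \<in> sons P" unfolding all_sons_def by blast
    have "valid P" using funpow_high[of "side (k + Suc m)" P m] side_high P(1) by blast
    then have "refines S P" using sons_refine(2) P(2) by blast
    moreover have "P \<in> (allsons ^^ m) (side (Suc k + m))" using P(1) by simp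
    ultimately show ?thesis unfolding Dneg_def by blast
  qed
qed

lemma D_valid: "P \<in> D i \<Longrightarrow> valid P"
  using tiling_D[of i, unfolded tiling_def, THEN conjunct2, THEN conjunct1] by (blast dest: bspec)

lemma D_sons: "S \<in> D (int n + 1) \<Longrightarrow> \<exists>P\<in>D (int n). S \<in> sons P"
proof -
  assume "S \<in> D (int n + 1)"
  then have "S \<in> D (int (Suc n))" by (simp add: add.commute)
  then have "S \<in> allsons (D (int n))" by (simp only: D_pos funpow.simps comp_def)
  then show ?thesis unfolding all_sons_def by blast
qed

lemma D_refine:
  assumes "S \<in> D i"
  shows "\<exists>R\<in>D (i - 1). refines S R"
proof (cases "i \<le> 0")
  case True
  then obtain k where i: "i = - int k" by (metis nonpos_int_cases)
  then have "S \<in> Dneg k" using assms D_neg by simp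
  then obtain R where "R \<in> Dneg (Suc k)" "refines S R" using Dneg_refine by blast
  moreover have "i - 1 = - int (Suc k)" using i by simp
  then have "Dneg (Suc k) = D (i - 1)" using D_neg[of "Suc k"] by (simp only:)
  ultimately show ?thesis by blast
next
  case False
  then obtain n where i: "i = int n + 1" using zero_less_imp_eq_int[of i] by (metis gr0_conv_Suc not_le of_nat_Suc add.commute)
  then obtain P where "P \<in> D (int n)" "S \<in> sons P" using D_sons assms by blast
  then show ?thesis using sons_refine(2)[OF D_valid] i by (intro bexI[of _ P]) simp_all
qed

text \<open>The members of the nonnegative generations containing x form a path along sons, since
  each generation has only one member containing x; \<open>sons_shrink\<close> applies to this
  path.\<close>

lemma D_shrink:
  assumes x: "\<And>i. \<exists>P\<in>D i. x \<in> cyl_box P" and e: "0 < e"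
  shows "\<exists>i. \<exists>P\<in>D i. x \<in> cyl_box P \<and> ln (rad P) < e \<and> \<delta> powi gen P < e"
proof -
  have "\<forall>i. \<exists>P. P \<in> D (int i) \<and> x \<in> cyl_box P" using x by blast
  then obtain Ps where Ps: "\<And>i. Ps i \<in> D (int i)" "\<And>i. x \<in> cyl_box (Ps i)" by metis
  have step: "Ps (Suc i) \<in> sons (Ps i)" for i
  proof -
    have "Ps (Suc i) \<in> D (int i + 1)" using Ps(1)[of "Suc i"] by (simp add: add.commute)
    then obtain P where P: "P \<in> D (int i)" "Ps (Suc i) \<in> sons P" using D_sons by blast
    then have "x \<in> cyl_box P" using sons_refine(2)[OF D_valid[OF P(1)] P(2)] Ps(2)[of "Suc i"]
      unfolding refines_def by blast
    then have "P = Ps i" using tiling_D[of "int i"] P(1) Ps(1)[of i] Ps(2)[of i] unfolding tiling_def by blast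
    then show ?thesis using P by simp
  qed
  have "Ps 0 \<in> Dneg 0" using Ps(1)[of 0] D_neg[of 0] by simp
  then obtain i where "ln (rad (Ps i)) < e" "\<delta> powi gen (Ps i) < e"
    using sons_shrink[of Ps, OF _ _ step e] Dneg_high by blast
  then show ?thesis using Ps by blast
qed

end

section \<open>Lebesgue measure on a stratified group\<close>

text \<open>Countable subadditivity in the form in which the balls of a Vitali covering are summed,
  with the sum as an integral over \<open>count_space\<close>.\<close>

lemma emeasure_UN_countable_le:
  assumes C: "countable C" and A: "\<And>i. i \<in> C \<Longrightarrow> A i \<in> sets M"
  shows "emeasure M (\<Union>i\<in>C. A i) \<le> (\<integral>\<^sup>+i. emeasure M (A i) \<partial>count_space C)"
proof -
  have U: "(\<Union>i\<in>C. A i) \<in> sets M" using A C by auto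
  have "emeasure M (\<Union>i\<in>C. A i) = (\<integral>\<^sup>+x. indicator (\<Union>i\<in>C. A i) x \<partial>M)"
    using U by simp
  also have "\<dots> \<le> (\<integral>\<^sup>+x. (\<integral>\<^sup>+i. indicator (A i) x \<partial>count_space C) \<partial>M)"
  proof (rule nn_integral_mono)
    fix x
    show "indicator (\<Union>i\<in>C. A i) x \<le> (\<integral>\<^sup>+i. (indicator (A i) x :: ennreal) \<partial>count_space C)"
    proof (cases "x \<in> (\<Union>i\<in>C. A i)")
      case True
      then obtain i where i: "i \<in> C" "x \<in> A i" by auto
      have "indicator (A i) x \<le> (\<integral>\<^sup>+i. (indicator (A i) x :: ennreal) \<partial>count_space C)"
        by (rule nn_integral_ge_point[OF i(1)])
      then show ?thesis using True i by simp
    qed simp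
  qed
  also have "\<dots> = (\<integral>\<^sup>+i. (\<integral>\<^sup>+x. indicator (A i) x \<partial>M) \<partial>count_space C)"
    using A C nn_integral_count_space_nn_integral[of C "\<lambda>i. indicator (A i)" M] by auto
  also have "\<dots> = (\<integral>\<^sup>+i. emeasure M (A i) \<partial>count_space C)"
    using A by (intro nn_integral_cong) simp
  finally show ?thesis .
qed

text \<open>Vitali's theorem fills U up to a null set with disjoint balls, and the image of each
  lies in a ball of B times the radius. Using balls keeps the constant exactly B^n, which must tend
  to 1 as B does in \<open>right_translation_measure_le\<close>.\<close>

lemma emeasure_Lipschitz_image_le:
  fixes f :: "'a::euclidean_space \<Rightarrow> 'a"
  assumes U: "open U" and B: "0 < B" and f: "\<And>x y. x \<in> U \<Longrightarrow> y \<in> U \<Longrightarrow> norm (f x - f y) \<le> B * norm (x - y)"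
    and img: "f ` U \<in> sets borel"
  shows "emeasure lborel (f ` U) \<le> ennreal (B ^ DIM('a)) * emeasure lborel U"
proof -
  define K where "K = {(x, r). 0 < r \<and> cball x r \<subseteq> U}"
  obtain C where C: "countable C" "C \<subseteq> K"
    "pairwise (\<lambda>i j. disjnt (cball (fst i) (snd i)) (cball (fst j) (snd j))) C"
    "negligible (U - (\<Union>i\<in>C. cball (fst i) (snd i)))"
  proof (rule Vitali_covering_theorem_cballs[of K snd U fst])
    show "0 < snd i" if "i \<in> K" for i using that by (auto simp: K_def)
    show "\<exists>i. i \<in> K \<and> x \<in> cball (fst i) (snd i) \<and> snd i < d" if xd: "x \<in> U" "0 < d" for x d
    proof -
      obtain e where e: "0 < e" "cball x e \<subseteq> U" using U xd(1) by (meson open_contains_cball)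
      have "cball x (min e (d / 2)) \<subseteq> U" using e by auto
      then show ?thesis using e xd by (intro exI[of _ "(x, min e (d / 2))"]) (auto simp: K_def)
    qed
  qed
  have KC: "0 < snd i \<and> cball (fst i) (snd i) \<subseteq> U" if "i \<in> C" for i
    using C(2) that by (cases i) (auto simp: K_def)
  define W where "W = U - (\<Union>i\<in>C. cball (fst i) (snd i))"
  have neg: "negligible (f ` W)"
  proof (rule negligible_locally_Lipschitz_image)
    show "negligible W" using C(4) by (simp add: W_def)
    show "\<exists>T Ba. open T \<and> x \<in> T \<and> (\<forall>y\<in>W \<inter> T. norm (f y - f x) \<le> Ba * norm (y - x))" if "x \<in> W" for x
      using f that by (intro exI[of _ UNIV] exI[of _ B]) (auto simp: W_def)
  qed simp
  have ball: "emeasure lborel (cball (f x) (B * r)) = ennreal (B ^ DIM('a)) * emeasure lborel (cball x r)"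
    if "0 < r" for x r
    using that B by (simp add: emeasure_cball power_mult_distrib ennreal_mult' mult_ac)
  have sub: "f ` U \<subseteq> f ` W \<union> (\<Union>i\<in>C. cball (f (fst i)) (B * snd i))"
  proof
    fix y assume "y \<in> f ` U"
    then obtain x where x: "x \<in> U" "y = f x" by auto
    show "y \<in> f ` W \<union> (\<Union>i\<in>C. cball (f (fst i)) (B * snd i))"
    proof (cases "x \<in> W")
      case False
      then obtain i where i: "i \<in> C" "x \<in> cball (fst i) (snd i)" using x by (auto simp: W_def)
      then have i': "0 < snd i" "cball (fst i) (snd i) \<subseteq> U" using KC by auto
      then have "fst i \<in> U" by auto
      then have "dist (f (fst i)) (f x) \<le> B * dist (fst i) x" using f x by (auto simp: dist_norm)
      also have "\<dots> \<le> B * snd i" using i B by (intro mult_left_mono) auto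
      finally have "f x \<in> cball (f (fst i)) (B * snd i)" by simp
      then show ?thesis using i x by blast
    qed (use x in auto)
  qed
  let ?V = "\<Union>i\<in>C. cball (f (fst i)) (B * snd i)"
  have V: "?V \<in> sets borel" using C(1) by (intro sets.countable_UN') auto
  then have V': "?V \<in> sets lebesgue" by simp
  have fW: "f ` W \<in> null_sets lebesgue" using neg by (simp add: negligible_iff_null_sets)
  then have fW': "f ` W \<in> sets lebesgue" by auto
  have "emeasure lborel (f ` U) = emeasure lebesgue (f ` U)" using img by simp
  also have "\<dots> \<le> emeasure lebesgue (f ` W \<union> ?V)"
    using fW' V' by (intro emeasure_mono sub) auto
  also have "\<dots> \<le> emeasure lebesgue (f ` W) + emeasure lebesgue ?V"
    using fW' V' by (rule emeasure_subadditive)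
  also have "emeasure lebesgue (f ` W) = 0" using fW by auto
  also have "emeasure lebesgue ?V = emeasure lborel ?V" using V by simp
  also have "0 + emeasure lborel (\<Union>i\<in>C. cball (f (fst i)) (B * snd i))
      \<le> (\<integral>\<^sup>+i. emeasure lborel (cball (f (fst i)) (B * snd i)) \<partial>count_space C)"
    using emeasure_UN_countable_le[OF C(1), of "\<lambda>i. cball (f (fst i)) (B * snd i)" lborel] by simp
  also have "\<dots> = (\<integral>\<^sup>+i. ennreal (B ^ DIM('a)) * emeasure lborel (cball (fst i) (snd i)) \<partial>count_space C)"
    using KC ball by (intro nn_integral_cong) auto
  also have "\<dots> = ennreal (B ^ DIM('a)) * (\<integral>\<^sup>+i. emeasure lborel (cball (fst i) (snd i)) \<partial>count_space C)"
    by (intro nn_integral_cmult) auto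
  also have "(\<integral>\<^sup>+i. emeasure lborel (cball (fst i) (snd i)) \<partial>count_space C) = emeasure lborel (\<Union>i\<in>C. cball (fst i) (snd i))"
    using C(1,3) by (intro emeasure_UN_countable[symmetric]) (auto simp: disjoint_family_on_def pairwise_def disjnt_def)
  also have "\<dots> \<le> emeasure lborel U"
    using KC U by (intro emeasure_mono) auto
  finally show ?thesis by (simp add: mult_left_mono)
qed

text \<open>Uniqueness of Haar measure: the double integral of 1_A (x + y) 1_B (y), with B the unit
  ball, is evaluated directly and, after exchanging the order and replacing y by y - x, a second
  time.\<close>

lemma translation_invariant_scale:
  fixes M :: "'a::euclidean_space measure"
  assumes sets: "sets M = sets borel" and inv: "\<And>A y. A \<in> sets borel \<Longrightarrow> emeasure M ((\<lambda>x. x + y) -` A) = emeasure M A"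
    and fin: "\<And>r. emeasure M (ball 0 r) < \<infinity>" and A: "A \<in> sets borel"
  shows "emeasure M A * emeasure lborel (ball (0::'a) 1) = emeasure lborel A * emeasure M (ball 0 1)"
proof -
  have sp: "space M = UNIV" using sets_eq_imp_space_eq[OF sets] by simp
  have "x \<in> (\<Union>n::nat. ball (0::'a) (real n))" for x :: 'a
    using reals_Archimedean2[of "norm x"] by auto
  then have "(\<Union>n::nat. ball (0::'a) (real n)) = UNIV" by blast
  then have "\<exists>A. countable A \<and> A \<subseteq> sets M \<and> \<Union> A = space M \<and> (\<forall>a\<in>A. emeasure M a \<noteq> \<infinity>)"
    using fin by (intro exI[of _ "range (\<lambda>n::nat. ball (0::'a) (real n))"]) (auto simp: sets sp less_top[symmetric])
  then interpret M: sigma_finite_measure M by (simp add: sigma_finite_measure_def)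
  interpret P: pair_sigma_finite lborel M ..
  let ?B = "ball (0::'a) 1"
  have [measurable]: "A \<in> sets borel" "A \<in> sets M" "?B \<in> sets M" using A sets by auto
  have [measurable_cong]: "sets M = sets borel" by (rule sets)
  have shiftM: "(\<integral>\<^sup>+x. indicator A (x + y) \<partial>M) = emeasure M A" for y
  proof -
    have "(\<integral>\<^sup>+x. indicator A (x + y) \<partial>M) = (\<integral>\<^sup>+x. indicator ((\<lambda>x. x + y) -` A) x \<partial>M)"
      by (intro nn_integral_cong) (auto simp: indicator_def)
    also have "\<dots> = emeasure M ((\<lambda>x. x + y) -` A)"
    proof (rule nn_integral_indicator)
      have "(\<lambda>x. x + y) \<in> borel_measurable borel" by measurable
      from measurable_sets[OF this A] show "(\<lambda>x. x + y) -` A \<in> sets M" by (simp add: sets)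
    qed
    finally show ?thesis using inv[OF A] by simp
  qed
  have refl: "(\<integral>\<^sup>+x. indicator ?B (y - x) \<partial>M) = emeasure M ?B" for y
  proof -
    have "(\<integral>\<^sup>+x. indicator ?B (y - x) \<partial>M) = (\<integral>\<^sup>+x. indicator ((\<lambda>x. x + (- y)) -` ?B) x \<partial>M)"
      by (intro nn_integral_cong) (auto simp: indicator_def norm_minus_commute)
    also have "\<dots> = emeasure M ((\<lambda>x. x + (- y)) -` ?B)"
    proof (rule nn_integral_indicator)
      have "(\<lambda>x. x + (- y)) \<in> borel_measurable borel" by measurable
      from measurable_sets[OF this, of ?B] show "(\<lambda>x. x + (- y)) -` ?B \<in> sets M" by (simp add: sets)
    qed
    also have "\<dots> = emeasure M ?B" by (rule inv) simp
    finally show ?thesis .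
  qed
  have "emeasure M A * emeasure lborel ?B = (\<integral>\<^sup>+y. emeasure M A * indicator ?B y \<partial>lborel)"
    by (subst nn_integral_cmult_indicator) auto
  also have "\<dots> = (\<integral>\<^sup>+y. (\<integral>\<^sup>+x. indicator A (x + y) * indicator ?B y \<partial>M) \<partial>lborel)"
  proof (rule nn_integral_cong)
    fix y
    have "(\<integral>\<^sup>+x. indicator A (x + y) * indicator ?B y \<partial>M) = (\<integral>\<^sup>+x. indicator A (x + y) \<partial>M) * indicator ?B y"
      by (rule nn_integral_multc) measurable
    then show "emeasure M A * indicator ?B y = (\<integral>\<^sup>+x. indicator A (x + y) * indicator ?B y \<partial>M)"
      by (simp add: shiftM)
  qed
  also have "\<dots> = (\<integral>\<^sup>+x. (\<integral>\<^sup>+y. indicator A (x + y) * indicator ?B y \<partial>lborel) \<partial>M)"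
    by (rule P.Fubini'[symmetric]) measurable
  also have "\<dots> = (\<integral>\<^sup>+x. (\<integral>\<^sup>+y. indicator A y * indicator ?B (y - x) \<partial>lborel) \<partial>M)"
  proof (rule nn_integral_cong)
    fix x
    have "(\<integral>\<^sup>+y. indicator A y * indicator ?B (y - x) \<partial>lborel)
       = (\<integral>\<^sup>+y. indicator A y * indicator ?B (y - x) \<partial>(distr lborel borel (\<lambda>y. x + y)))"
      by (subst lborel_distr_plus) simp
    also have "\<dots> = (\<integral>\<^sup>+y. indicator A (x + y) * indicator ?B (x + y - x) \<partial>lborel)"
      by (subst nn_integral_distr) auto
    finally show "(\<integral>\<^sup>+y. indicator A (x + y) * indicator ?B y \<partial>lborel)
       = (\<integral>\<^sup>+y. indicator A y * indicator ?B (y - x) \<partial>lborel)" by simp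
  qed
  also have "\<dots> = (\<integral>\<^sup>+y. (\<integral>\<^sup>+x. indicator A y * indicator ?B (y - x) \<partial>M) \<partial>lborel)"
    by (rule P.Fubini') measurable
  also have "\<dots> = (\<integral>\<^sup>+y. indicator A y * emeasure M ?B \<partial>lborel)"
  proof (rule nn_integral_cong)
    fix y
    have "(\<integral>\<^sup>+x. indicator A y * indicator ?B (y - x) \<partial>M) = indicator A y * (\<integral>\<^sup>+x. indicator ?B (y - x) \<partial>M)"
      by (rule nn_integral_cmult) measurable
    then show "(\<integral>\<^sup>+x. indicator A y * indicator ?B (y - x) \<partial>M) = indicator A y * emeasure M ?B"
      by (simp add: refl)
  qed
  also have "\<dots> = emeasure lborel A * emeasure M ?B"
    by (subst nn_integral_multc) auto
  finally show ?thesis .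
qed

text \<open>The transported measure is translation invariant and finite on balls, hence a multiple
  of Lebesgue measure. The factor stays unspecified because it cancels in the application to
  dilations.\<close>

lemma linear_scale:
  fixes T T' :: "'a::euclidean_space \<Rightarrow> 'a"
  assumes T: "linear T" "linear T'" and inv: "\<And>x. T' (T x) = x" "\<And>x. T (T' x) = x"
  obtains \<kappa> where "0 < \<kappa>" "\<And>A. A \<in> sets borel \<Longrightarrow> emeasure lborel (T ` A) = ennreal \<kappa> * emeasure lborel A"
proof -
  have bl: "bounded_linear T" "bounded_linear T'" using T linear_conv_bounded_linear by auto
  have ct: "continuous_on UNIV T" "continuous_on UNIV T'"
    using bl linear_continuous_on by auto
  have T'm: "T' \<in> borel_measurable borel" using ct(2) by (rule borel_measurable_continuous_onI)
  have im: "T ` A = T' -` A" for A using inv by (auto simp: image_iff) (metis inv(2))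
  define M where "M = distr lborel borel T'"
  have eM: "emeasure M A = emeasure lborel (T ` A)" if "A \<in> sets borel" for A
    using that T'm by (simp add: M_def emeasure_distr im)
  have inv': "emeasure M ((\<lambda>x. x + y) -` A) = emeasure M A" if A: "A \<in> sets borel" for A y
  proof -
    have m: "(\<lambda>x. x + y) -` A \<in> sets borel"
    proof -
      have "(\<lambda>x. x + y) \<in> borel_measurable borel" by measurable
      from measurable_sets[OF this A] show ?thesis by simp
    qed
    have "T ` ((\<lambda>x. x + y) -` A) = (\<lambda>x. T y + x) -` (T ` A)"
      unfolding im using T(2) inv by (auto simp: linear_add add.commute)
    moreover have "emeasure lborel ((\<lambda>x. T y + x) -` (T ` A)) = emeasure (distr lborel borel (\<lambda>x. T y + x)) (T ` A)"
      using measurable_sets[OF T'm A] by (subst emeasure_distr) (auto simp: im)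
    ultimately show ?thesis using eM[OF m] eM[OF A] by (simp add: lborel_distr_plus)
  qed
  have fin: "emeasure M (ball 0 r) < \<infinity>" for r
  proof -
    have "bounded (T ` ball 0 r)" using bl(1) by (intro bounded_linear_image) auto
    then show ?thesis using eM[of "ball 0 r"] emeasure_bounded_finite by (simp add: less_top)
  qed
  have sc: "emeasure M A * emeasure lborel (ball (0::'a) 1) = emeasure lborel A * emeasure M (ball 0 1)"
    if "A \<in> sets borel" for A
    by (rule translation_invariant_scale[OF _ inv' fin that]) (simp add: M_def)
  define b where "b = measure lborel (ball (0::'a) 1)"
  have b: "emeasure lborel (ball (0::'a) 1) = ennreal b" "0 < b"
  proof -
    show "emeasure lborel (ball (0::'a) 1) = ennreal b" unfolding b_def
      using emeasure_bounded_finite[of "ball (0::'a) 1"] by (intro emeasure_eq_ennreal_measure) auto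
    show "0 < b" unfolding b_def by simp
  qed
  define m where "m = measure M (ball 0 1)"
  have m: "emeasure M (ball 0 1) = ennreal m" unfolding m_def
    using fin[of 1] by (intro emeasure_eq_ennreal_measure) auto
  have "0 < emeasure M (ball 0 1)"
  proof -
    have o: "open (T ` ball 0 1)" unfolding im using ct(2) by (intro open_vimage) auto
    have "T ` ball 0 1 \<noteq> {}" by auto
    then have "\<not> negligible (T ` ball 0 1)" using o open_not_negligible by blast
    then show ?thesis using eM[of "ball 0 1"] o
      by (auto simp: negligible_iff_null_sets null_sets_def zero_less_iff_neq_zero)
  qed
  then have "0 < m" using m by simp
  show thesis
  proof (rule that[of "m / b"])
    show "0 < m / b" using \<open>0 < m\<close> b by simp
    fix A :: "'a set" assume A: "A \<in> sets borel"
    have "emeasure lborel (T ` A) * ennreal b = emeasure lborel A * ennreal m"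
      using sc[OF A] eM[OF A] b m by simp
    then have "emeasure lborel (T ` A) * (ennreal b * ennreal (1 / b)) = emeasure lborel A * (ennreal m * ennreal (1 / b))"
      by (metis mult.assoc)
    then show "emeasure lborel (T ` A) = ennreal (m / b) * emeasure lborel A"
      using b \<open>0 < m\<close> by (simp add: ennreal_mult[symmetric] mult.commute)
  qed
qed

section \<open>Derivative of the group law, dilations and right translations\<close>

locale stratified =
  fixes N :: "('v::euclidean_space) strat_group"
  assumes strat: "stratified_lie_group N"
begin

abbreviation mul (infixl "\<cdot>" 70) where "x \<cdot> y \<equiv> op N x y"

lemma strat_smooth: "smooth (\<lambda>(x, y). op N x y)"
  and strat_group: "group (op N) 0 uminus"
  and strat_layers: "subspace (layer N j)" "j \<notin> {1..step N} \<Longrightarrow> layer N j = {0}"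
  and strat_decomp: "\<exists>!y. layer_decomp N x y"
  and strat_dil: "0 < a \<Longrightarrow> dil N a (op N x y) = op N (dil N a x) (dil N a y)"
  using strat unfolding stratified_lie_group_def by blast+

interpretation G: group "op N" 0 uminus by (rule strat_group)

lemma op_assoc: "(x \<cdot> y) \<cdot> z = x \<cdot> (y \<cdot> z)" by (rule G.assoc)
lemma op_0 [simp]: "0 \<cdot> x = x" "x \<cdot> 0 = x" by (rule G.left_neutral, rule G.right_neutral)
lemma op_minus [simp]: "(- x) \<cdot> x = 0" "x \<cdot> (- x) = 0" by (rule G.left_inverse, rule G.right_inverse)
lemma op_cancel [simp]: "(x \<cdot> y) \<cdot> (- y) = x" "(x \<cdot> (- y)) \<cdot> y = x"
  by (simp_all add: op_assoc)
lemma op_cancel_left [simp]: "(- x) \<cdot> (x \<cdot> y) = y"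
  by (simp flip: op_assoc)
lemma minus_op: "- (x \<cdot> y) = (- y) \<cdot> (- x)" by (rule G.inverse_distrib_swap)
lemma op_left_inj: "z \<cdot> x = z \<cdot> y \<longleftrightarrow> x = y" by (rule G.left_cancel)

definition "f2 = (\<lambda>(x, y). op N x y)"
definition "Df p = frechet_derivative f2 (at p)"

lemma f2_derivative: "(f2 has_derivative Df p) (at p)"
proof -
  have "Ck (Suc 0) f2" using strat_smooth unfolding smooth_def f2_def by blast
  then have "f2 differentiable (at p)" unfolding Ck.simps by blast
  then show ?thesis unfolding Df_def by (rule frechet_derivative_works[THEN iffD1])
qed

lemma Df_differentiable: "(\<lambda>p. Df p v) differentiable (at p)"
proof -
  have "Ck (Suc (Suc 0)) f2" using strat_smooth unfolding smooth_def f2_def by blast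
  then show ?thesis unfolding Df_def Ck.simps by blast
qed

lemma Df_continuous: "continuous_on UNIV (\<lambda>p. Df p v)"
  using Df_differentiable by (meson continuous_at_imp_continuous_on differentiable_imp_continuous_within)

lemma f2_continuous: "continuous_on UNIV f2"
  using f2_derivative by (meson continuous_at_imp_continuous_on has_derivative_continuous)

lemma Df_linear: "bounded_linear (Df p)"
  using f2_derivative by (rule has_derivative_bounded_linear)

lemma op_continuous [continuous_intros]:
  assumes "continuous_on S f" "continuous_on S g"
  shows "continuous_on S (\<lambda>x. f x \<cdot> g x)"
proof -
  have "continuous_on S (\<lambda>x. f2 (f x, g x))"
    by (rule continuous_on_compose2[OF f2_continuous]) (use assms in \<open>auto intro: continuous_intros\<close>)
  then show ?thesis by (simp add: f2_def)
qed

lemma op_has_derivative: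
  assumes "(f has_derivative f') (at x within S)" "(g has_derivative g') (at x within S)"
  shows "((\<lambda>x. f x \<cdot> g x) has_derivative (\<lambda>h. Df (f x, g x) (f' h, g' h))) (at x within S)"
proof -
  have "((\<lambda>x. f2 (f x, g x)) has_derivative (\<lambda>h. Df (f x, g x) (f' h, g' h))) (at x within S)"
    by (rule has_derivative_compose[OF has_derivative_Pair[OF assms] f2_derivative])
  then show ?thesis by (simp add: f2_def)
qed

lemma Df_right: "Df (x, 0) (h, 0) = h"
proof -
  have "((\<lambda>x. x \<cdot> 0) has_derivative (\<lambda>h. Df (x, 0) (h, 0))) (at x)"
    using op_has_derivative[of "\<lambda>x. x" "\<lambda>h. h" x UNIV "\<lambda>_. 0" "\<lambda>_. 0"] by auto
  moreover have "((\<lambda>x. x \<cdot> 0) has_derivative (\<lambda>h. h)) (at x)" by simp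
  ultimately have "(\<lambda>h. Df (x, 0) (h, 0)) = (\<lambda>h. h)" by (rule has_derivative_unique)
  then show ?thesis by meson
qed

lemma Df_left: "Df (0, y) (0, h) = h"
proof -
  have "((\<lambda>y. 0 \<cdot> y) has_derivative (\<lambda>h. Df (0, y) (0, h))) (at y)"
    using op_has_derivative[of "\<lambda>_. 0" "\<lambda>_. 0" y UNIV "\<lambda>x. x" "\<lambda>h. h"] by auto
  moreover have "((\<lambda>y. 0 \<cdot> y) has_derivative (\<lambda>h. h)) (at y)" by simp
  ultimately have "(\<lambda>h. Df (0, y) (0, h)) = (\<lambda>h. h)" by (rule has_derivative_unique)
  then show ?thesis by meson
qed

lemma Df_0: "Df (0, 0) (h, k) = h + k"
proof -
  have "Df (0, 0) ((h, 0) + (0, k)) = Df (0, 0) (h, 0) + Df (0, 0) (0, k)"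
    by (rule linear_simps(1)[OF Df_linear])
  then show ?thesis by (simp add: Df_right Df_left)
qed

definition "lay x = (THE y. layer_decomp N x y)"

lemma lay: "layer_decomp N x (lay x)"
  unfolding lay_def by (rule theI'[OF strat_decomp])

lemma lay_eqI: "layer_decomp N x y \<Longrightarrow> lay x = y"
  using strat_decomp lay by blast

lemma lay_in: "lay x j \<in> layer N j" and lay_sum: "(\<Sum>j=1..step N. lay x j) = x"
  using lay[of x] by (auto simp: layer_decomp_def)

lemma lay_add: "lay (x + y) j = lay x j + lay y j"
proof -
  have "layer_decomp N (x + y) (\<lambda>j. lay x j + lay y j)"
    using lay[of x] lay[of y] strat_layers(1) by (auto simp: layer_decomp_def subspace_add sum.distrib)
  from lay_eqI[OF this] show ?thesis by simp
qed

lemma lay_scale: "lay (c *\<^sub>R x) j = c *\<^sub>R lay x j"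
proof -
  have "layer_decomp N (c *\<^sub>R x) (\<lambda>j. c *\<^sub>R lay x j)"
    using lay_in strat_layers(1)
    by (simp add: layer_decomp_def subspace_scale lay_sum[unfolded One_nat_def] flip: scaleR_sum_right)
  from lay_eqI[OF this] show ?thesis by simp
qed

lemma lay_linear: "bounded_linear (\<lambda>x. lay x j)"
  by (intro linear_conv_bounded_linear[THEN iffD1] linearI) (auto simp: lay_add lay_scale)

lemma dil_eq: "dil N a x = (\<Sum>j=1..step N. a ^ j *\<^sub>R lay x j)"
  by (simp add: dil_def lay_def)

lemma lay_dil: "1 \<le> j \<Longrightarrow> j \<le> step N \<Longrightarrow> lay (dil N a x) j = a ^ j *\<^sub>R lay x j"
proof -
  assume j: "1 \<le> j" "j \<le> step N"
  have "layer_decomp N (dil N a x) (\<lambda>j. a ^ j *\<^sub>R lay x j)"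
    using strat_layers(1) lay_in by (auto simp: layer_decomp_def dil_eq subspace_scale)
  from lay_eqI[OF this] show ?thesis by simp
qed

lemma dil_dil: "dil N a (dil N b x) = dil N (a * b) x"
  unfolding dil_eq[of a "dil N b x"] dil_eq[of "a * b"]
  by (intro sum.cong) (auto simp: lay_dil power_mult_distrib)

lemma dil_1 [simp]: "dil N 1 x = x"
  by (simp add: dil_eq lay_sum[unfolded One_nat_def])

lemma dil_linear: "bounded_linear (dil N a)"
  unfolding dil_eq by (intro bounded_linear_sum bounded_linear_scaleR_right[THEN bounded_linear_compose] lay_linear)

lemma dil_minus: "dil N a (- x) = - dil N a x"
  and dil_zero [simp]: "dil N a 0 = 0"
  by (rule linear_simps[OF dil_linear])+

lemma dil_inverse: "0 < a \<Longrightarrow> dil N a (dil N (1 / a) x) = x" "0 < a \<Longrightarrow> dil N (1 / a) (dil N a x) = x"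
  by (simp_all add: dil_dil)

lemma dil_continuous [continuous_intros]:
  assumes "continuous_on S f" "continuous_on S g"
  shows "continuous_on S (\<lambda>x. dil N (f x) (g x))"
  unfolding dil_eq
  by (intro continuous_intros assms bounded_linear.continuous_on[OF lay_linear])

lemma dil_at_0: "dil N 0 x = 0"
  by (auto simp: dil_eq intro!: sum.neutral)

text \<open>Right translation by 0 is the identity, so by continuity the derivative of translation
  by a small w is close to the identity near 0; the mean value inequality on a ball does the
  rest.\<close>

lemma right_translation_near_identity:
  assumes e: "0 < e"
  shows "\<exists>\<rho>>0. \<forall>w x y. norm w < \<rho> \<longrightarrow> norm x < \<rho> \<longrightarrow> norm y < \<rho> \<longrightarrow>
    norm (x \<cdot> w - y \<cdot> w) \<le> (1 + e) * norm (x - y)"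
proof -
  \<comment> \<open>Continuity of the derivative is available only for each fixed direction. Summing
    over the basis gives a continuous bound for the operator norm of the difference to the
    identity.\<close>
  define S where "S p = (\<Sum>b\<in>Basis. norm (Df p (b, 0) - b))" for p
  have "continuous_on UNIV S" unfolding S_def
    by (intro continuous_intros Df_continuous)
  then have "isCont S 0" using continuous_on_eq_continuous_at[OF open_UNIV, of S] by blast
  moreover have "S 0 = 0" by (simp add: S_def zero_prod_def Df_right)
  ultimately obtain d where d: "0 < d" "\<And>p. dist p 0 < d \<Longrightarrow> dist (S p) 0 < e"
    unfolding continuous_at_eps_delta using e by metis
  define \<rho> where "\<rho> = d / 2"
  have "norm (x \<cdot> w - y \<cdot> w) \<le> (1 + e) * norm (x - y)" if w: "norm w < \<rho>" and xy: "norm x < \<rho>" "norm y < \<rho>" for w x y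
  proof (rule differentiable_bound[of "ball 0 \<rho>" "\<lambda>x. x \<cdot> w" "\<lambda>x h. Df (x, w) (h, 0)"])
    show "((\<lambda>x. x \<cdot> w) has_derivative (\<lambda>h. Df (z, w) (h, 0))) (at z within ball 0 \<rho>)" for z
      using op_has_derivative[of "\<lambda>x. x" "\<lambda>h. h" z "ball 0 \<rho>" "\<lambda>_. w" "\<lambda>_. 0"] by auto
    fix z :: 'v assume z: "z \<in> ball 0 \<rho>"
    have "norm (z, w) \<le> norm z + norm w" by (rule norm_Pair_le)
    then have "S (z, w) < e" using d(2)[of "(z, w)"] w z by (simp add: \<rho>_def dist_norm)
    then show "onorm (\<lambda>h. Df (z, w) (h, 0)) \<le> 1 + e"
    proof (intro onorm_bound)
      fix h :: 'v
      interpret L: bounded_linear "Df (z, w)" by (rule Df_linear)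
      have lin: "linear (\<lambda>h. Df (z, w) (h, 0) - h)"
      proof (rule linearI)
        show "Df (z, w) (b1 + b2, 0) - (b1 + b2) = Df (z, w) (b1, 0) - b1 + (Df (z, w) (b2, 0) - b2)" for b1 b2
          using L.add[of "(b1, 0)" "(b2, 0)"] by simp
        show "Df (z, w) (r *\<^sub>R b, 0) - r *\<^sub>R b = r *\<^sub>R (Df (z, w) (b, 0) - b)" for r b
          using L.scaleR[of r "(b, 0)"] by (simp add: scaleR_diff_right)
      qed
      have "Df (z, w) (h, 0) - h = (\<Sum>b\<in>Basis. (h \<bullet> b) *\<^sub>R (Df (z, w) (b, 0) - b))"
        using linear_sum[OF lin, of "\<lambda>b. (h \<bullet> b) *\<^sub>R b" Basis]
        by (simp add: euclidean_representation linear_cmul[OF lin])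
      also have "norm \<dots> \<le> (\<Sum>b\<in>Basis. norm h * norm (Df (z, w) (b, 0) - b))"
        by (rule sum_norm_le) (auto intro!: mult_right_mono Basis_le_norm)
      also have "\<dots> = norm h * S (z, w)" by (simp add: S_def sum_distrib_left)
      also have "\<dots> \<le> norm h * e" using \<open>S (z, w) < e\<close> by (intro mult_left_mono) auto
      finally have "norm (Df (z, w) (h, 0) - h) \<le> norm h * e" .
      moreover have "norm (Df (z, w) (h, 0)) \<le> norm (Df (z, w) (h, 0) - h) + norm h"
        using norm_triangle_ineq[of "Df (z, w) (h, 0) - h" h] by simp
      ultimately show "norm (Df (z, w) (h, 0)) \<le> (1 + e) * norm h" by (simp add: algebra_simps)
    qed (use e in simp)
  qed (use xy in auto)
  moreover have "0 < \<rho>" using d by (simp add: \<rho>_def)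
  ultimately show ?thesis by blast
qed

lemma right_translation_image: "(\<lambda>x. x \<cdot> w) ` E = (\<lambda>x. x \<cdot> (- w)) -` E"
  by (auto simp: image_iff) (metis op_cancel(2))

lemma right_translation_open: "open E \<Longrightarrow> open ((\<lambda>x. x \<cdot> w) ` E)"
  unfolding right_translation_image by (intro open_vimage continuous_intros)

text \<open>\<open>dil\<close> is continuous up to a = 0, where it vanishes, and uniformly so on
  compact sets.\<close>

lemma small_dil:
  assumes "bounded B" "0 < \<rho>"
  shows "\<exists>a>0. \<forall>x\<in>B. norm (dil N a x) < \<rho>"
proof -
  obtain K where K: "0 < K" "\<And>x. x \<in> B \<Longrightarrow> norm x \<le> K" using assms(1) bounded_pos by blast
  have "compact ({0..1::real} \<times> cball (0::'v) K)" by (intro compact_Times) auto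
  moreover have "continuous_on ({0..1::real} \<times> cball (0::'v) K) (\<lambda>p. dil N (fst p) (snd p))"
    by (intro continuous_intros)
  ultimately have "uniformly_continuous_on ({0..1::real} \<times> cball (0::'v) K) (\<lambda>p. dil N (fst p) (snd p))"
    using compact_uniformly_continuous by blast
  then obtain d where d: "0 < d" "\<And>p q. p \<in> {0..1} \<times> cball (0::'v) K \<Longrightarrow> q \<in> {0..1} \<times> cball 0 K \<Longrightarrow> dist q p < d \<Longrightarrow>
      dist (dil N (fst q) (snd q)) (dil N (fst p) (snd p)) < \<rho>"
    unfolding uniformly_continuous_on_def using assms(2) by metis
  define a where "a = min 1 (d / 2)"
  have a: "0 < a" "a \<le> 1" "a < d" using d by (auto simp: a_def)
  have "norm (dil N a x) < \<rho>" if "x \<in> B" for x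
    using d(2)[of "(0, x)" "(a, x)"] a K(2)[OF that] by (simp add: dist_Pair_Pair dil_at_0)
  then show ?thesis using a by blast
qed

text \<open>A small dilation conjugates the translation by \<open>w\<close> on \<open>E\<close> to one near the origin, where it is
  \<open>(1 + e)\<close>-Lipschitz; the factors by which the dilation changes the measure cancel.\<close>

lemma right_translation_measure_le:
  assumes E: "open E" "bounded E"
  shows "emeasure lborel ((\<lambda>x. x \<cdot> w) ` E) \<le> emeasure lborel E"
proof -
  have bound: "emeasure lborel ((\<lambda>x. x \<cdot> w) ` E) \<le> ennreal ((1 + e) ^ DIM('v)) * emeasure lborel E" if e: "0 < e" for e
  proof -
    obtain \<rho> where \<rho>: "0 < \<rho>" "\<And>w x y. norm w < \<rho> \<Longrightarrow> norm x < \<rho> \<Longrightarrow> norm y < \<rho> \<Longrightarrow>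
      norm (x \<cdot> w - y \<cdot> w) \<le> (1 + e) * norm (x - y)"
      using right_translation_near_identity[OF e] by blast
    obtain a where a: "0 < a" "\<And>x. x \<in> insert w E \<Longrightarrow> norm (dil N a x) < \<rho>"
      using small_dil[of "insert w E" \<rho>] \<rho>(1) E(2) by auto
    obtain \<kappa> where \<kappa>: "0 < \<kappa>" "\<And>A. A \<in> sets borel \<Longrightarrow> emeasure lborel (dil N a ` A) = ennreal \<kappa> * emeasure lborel A"
      using linear_scale[of "dil N a" "dil N (1 / a)"] dil_linear bounded_linear.linear dil_inverse[OF a(1)] by metis
    have im: "dil N a ` A = dil N (1 / a) -` A" for A
      using dil_inverse[OF a(1)] by (auto simp: image_iff) metis
    let ?U = "dil N a ` E"
    have oU: "open ?U" unfolding im by (intro open_vimage E continuous_intros)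
    have img: "(\<lambda>x. x \<cdot> dil N a w) ` ?U = dil N a ` ((\<lambda>x. x \<cdot> w) ` E)"
      using strat_dil[OF a(1)] by (auto simp: image_image)
    have "ennreal \<kappa> * emeasure lborel ((\<lambda>x. x \<cdot> w) ` E) = emeasure lborel ((\<lambda>x. x \<cdot> dil N a w) ` ?U)"
      using \<kappa>(2) right_translation_open[OF E(1)] by (simp add: img)
    also have "\<dots> \<le> ennreal ((1 + e) ^ DIM('v)) * emeasure lborel ?U"
      using oU e a(2) \<rho>(2) right_translation_open[OF oU]
      by (intro emeasure_Lipschitz_image_le) auto
    also have "\<dots> = ennreal \<kappa> * (ennreal ((1 + e) ^ DIM('v)) * emeasure lborel E)"
      using \<kappa>(2) E(1) by (simp add: mult_ac)
    finally have "ennreal (1 / \<kappa>) * (ennreal \<kappa> * emeasure lborel ((\<lambda>x. x \<cdot> w) ` E))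
      \<le> ennreal (1 / \<kappa>) * (ennreal \<kappa> * (ennreal ((1 + e) ^ DIM('v)) * emeasure lborel E))"
      by (rule mult_left_mono) simp
    moreover have "ennreal (1 / \<kappa>) * (ennreal \<kappa> * y) = y" for y
      using \<kappa>(1) by (simp flip: mult.assoc ennreal_mult)
    ultimately show ?thesis by simp
  qed
  define A where "A = measure lborel E"
  have A: "emeasure lborel E = ennreal A" unfolding A_def
    using emeasure_bounded_finite[OF E(2)] by (intro emeasure_eq_ennreal_measure) auto
  \<comment> \<open>The set has finite measure, so letting e tend to 0 removes the factor.\<close>
  have "((\<lambda>e. ennreal ((1 + e) ^ DIM('v) * A)) \<longlongrightarrow> ennreal ((1 + 0) ^ DIM('v) * A)) (at_right (0::real))"
    by (intro tendsto_intros)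
  moreover have "\<forall>\<^sub>F e in at_right (0::real). emeasure lborel ((\<lambda>x. x \<cdot> w) ` E) \<le> ennreal ((1 + e) ^ DIM('v) * A)"
    using bound A by (auto simp: eventually_at_filter ennreal_mult A_def)
  ultimately have "emeasure lborel ((\<lambda>x. x \<cdot> w) ` E) \<le> ennreal ((1 + 0) ^ DIM('v) * A)"
    by (rule tendsto_lowerbound) simp
  then show ?thesis using A by simp
qed

text \<open>The inequality for w and for - w together give equality on boxes, and these determine
  Lebesgue measure.\<close>

lemma lborel_right_translation: "distr lborel borel (\<lambda>x. x \<cdot> w) = lborel"
proof (rule sym, rule lborel_eqI)
  have m: "(\<lambda>x. x \<cdot> w) \<in> borel_measurable borel"
    by (intro borel_measurable_continuous_onI continuous_intros)
  fix l u :: 'v assume lu: "\<And>b. b \<in> Basis \<Longrightarrow> l \<bullet> b \<le> u \<bullet> b"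
  let ?E = "(\<lambda>x. x \<cdot> (- w)) ` box l u"
  have E: "?E = (\<lambda>x. x \<cdot> w) -` box l u" unfolding right_translation_image by simp
  have oE: "open ?E" by (intro right_translation_open) auto
  have "compact ((\<lambda>x. x \<cdot> (- w)) ` cbox l u)"
    by (intro compact_continuous_image continuous_intros) auto
  then have bE: "bounded ?E" using box_subset_cbox compact_imp_bounded by (metis bounded_subset image_mono)
  have "(\<lambda>x. x \<cdot> w) ` ?E = box l u" by (simp add: image_image)
  then have "emeasure lborel (box l u) \<le> emeasure lborel ?E"
    using right_translation_measure_le[OF oE bE, of w] by simp
  moreover have "emeasure lborel ?E \<le> emeasure lborel (box l u)"
    by (intro right_translation_measure_le) auto
  ultimately have "emeasure lborel ?E = emeasure lborel (box l u)" by simp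
  then show "emeasure (distr lborel borel (\<lambda>x. x \<cdot> w)) (box l u) = (\<Prod>b\<in>Basis. (u - l) \<bullet> b)"
    using m lu by (simp add: emeasure_distr E[symmetric])
qed simp

lemma nn_integral_right_translation:
  assumes "h \<in> borel_measurable borel"
  shows "(\<integral>\<^sup>+x. h (x \<cdot> w) \<partial>lborel) = (\<integral>\<^sup>+x. h x \<partial>lborel)"
proof -
  have m: "(\<lambda>x. x \<cdot> w) \<in> borel_measurable borel"
    by (intro borel_measurable_continuous_onI continuous_intros)
  have "(\<integral>\<^sup>+x. h x \<partial>(distr lborel borel (\<lambda>x. x \<cdot> w))) = (\<integral>\<^sup>+x. h (x \<cdot> w) \<partial>lborel)"
    using m assms by (intro nn_integral_distr) auto
  then show ?thesis by (simp add: lborel_right_translation)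
qed

end

section \<open>One-parameter subgroups and flow measures\<close>

text \<open>Under a = exp t the Haar measure da / a of A becomes dt. The substitution is made on
  compact intervals and extended by monotone convergence.\<close>

lemma nn_integral_exp_substitution:
  fixes F :: "real \<Rightarrow> ennreal"
  assumes [measurable]: "F \<in> borel_measurable borel"
  shows "(\<integral>\<^sup>+a. ennreal (1 / a) * F a * indicator {0<..} a \<partial>lborel) = (\<integral>\<^sup>+t. F (exp t) \<partial>lborel)"
proof -
  define f where "f a = ennreal (1 / a) * F a" for a
  have f[measurable]: "f \<in> borel_measurable borel" unfolding f_def by measurable
  \<comment> \<open>The shift by 1 keeps the interval nondegenerate for m = 0.\<close>
  define I where "I m = {exp (- real m - 1)..exp (real m + 1)}" for m
  define J where "J m = {- real m - 1..real m + 1}" for m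
  have eq: "(\<integral>\<^sup>+a. f a * indicator (I m) a \<partial>lborel) = (\<integral>\<^sup>+t. F (exp t) * indicator (J m) t \<partial>lborel)" for m
  proof -
    have "(\<integral>\<^sup>+a. f a * indicator (I m) a \<partial>lborel) = (\<integral>\<^sup>+t. f (exp t) * ennreal (exp t) * indicator (J m) t \<partial>lborel)"
      unfolding I_def J_def
      by (rule nn_integral_substitution_aux) (auto intro!: derivative_eq_intros continuous_intros)
    also have "\<dots> = (\<integral>\<^sup>+t. F (exp t) * indicator (J m) t \<partial>lborel)"
    proof (rule nn_integral_cong)
      fix t :: real
      have "f (exp t) * ennreal (exp t) = (ennreal (1 / exp t) * ennreal (exp t)) * F (exp t)"
        by (simp add: f_def mult_ac)
      also have "ennreal (1 / exp t) * ennreal (exp t) = 1" by (simp flip: ennreal_mult)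
      finally show "f (exp t) * ennreal (exp t) * indicator (J m) t = F (exp t) * indicator (J m) t" by simp
    qed
    finally show ?thesis .
  qed
  have "(\<lambda>m. \<integral>\<^sup>+a. f a * indicator (I m) a \<partial>lborel) \<longlonglongrightarrow> (\<integral>\<^sup>+a. f a * indicator {0<..} a \<partial>lborel)"
  proof (rule nn_integral_LIMSEQ)
    have "I m \<subseteq> I n" if "m \<le> n" for m n
      using that unfolding I_def by (intro atLeastatMost_subset_iff[THEN iffD2] disjI2) auto
    then show "incseq (\<lambda>m a. f a * indicator (I m) a)"
      by (auto simp: incseq_def le_fun_def intro!: mult_left_mono split: split_indicator)
    show "(\<lambda>a. f a * indicator (I m) a) \<in> borel_measurable lborel" for m
      unfolding I_def by measurable
    fix a :: real
    show "(\<lambda>m. f a * indicator (I m) a) \<longlonglongrightarrow> f a * indicator {0<..} a"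
    proof (cases "0 < a")
      case True
      obtain m0 :: nat where m0: "\<bar>ln a\<bar> < real m0" using reals_Archimedean2 by blast
      have "a \<in> I m" if "m \<ge> m0" for m
      proof -
        have "exp (- real m - 1) \<le> exp (ln a)" "exp (ln a) \<le> exp (real m + 1)"
          using m0 that by (auto simp del: exp_ln)
        then show ?thesis using True by (simp add: I_def)
      qed
      then have "\<forall>\<^sub>F m in sequentially. f a * indicator (I m) a = f a * indicator {0<..} a"
        unfolding eventually_sequentially using True by (intro exI[of _ m0]) auto
      then show ?thesis by (rule tendsto_eventually)
    next
      case False
      then have "a \<notin> I m" for m unfolding I_def using exp_gt_zero[of "- real m - 1"] by (auto simp del: exp_gt_zero)
      then show ?thesis using False by simp
    qed
  qed
  moreover have "(\<lambda>m. \<integral>\<^sup>+t. F (exp t) * indicator (J m) t \<partial>lborel) \<longlonglongrightarrow> (\<integral>\<^sup>+t. F (exp t) \<partial>lborel)"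
  proof (rule nn_integral_LIMSEQ)
    have "J m \<subseteq> J n" if "m \<le> n" for m n
      using that unfolding J_def by auto
    then show "incseq (\<lambda>m t. F (exp t) * indicator (J m) t)"
      by (auto simp: incseq_def le_fun_def intro!: mult_left_mono split: split_indicator)
    show "(\<lambda>t. F (exp t) * indicator (J m) t) \<in> borel_measurable lborel" for m
      unfolding J_def by measurable
    fix t :: real
    obtain m0 :: nat where m0: "\<bar>t\<bar> < real m0" using reals_Archimedean2 by blast
    then have "\<forall>\<^sub>F m in sequentially. F (exp t) * indicator (J m) t = F (exp t)"
      unfolding eventually_sequentially by (intro exI[of _ m0]) (auto simp: J_def indicator_def)
    then show "(\<lambda>m. F (exp t) * indicator (J m) t) \<longlonglongrightarrow> F (exp t)" by (rule tendsto_eventually)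
  qed
  ultimately show ?thesis
    unfolding f_def[symmetric] eq by (rule LIMSEQ_unique)
qed

section \<open>Slope-one subgroups as conjugates of the dilation subgroup\<close>

context stratified
begin

text \<open>The infinitesimal generator of the dilations, equal to j on the layer j;
  \<open>Ei\<close> below inverts it.\<close>

definition "Eu x = (\<Sum>j=1..step N. real j *\<^sub>R lay x j)"
definition "Ei x = (\<Sum>j=1..step N. (1 / real j) *\<^sub>R lay x j)"

lemma Eu_linear: "bounded_linear Eu" and Ei_linear: "bounded_linear Ei"
  unfolding Eu_def Ei_def
  by (intro bounded_linear_sum bounded_linear_scaleR_right[THEN bounded_linear_compose] lay_linear)+

lemma Eu_Ei: "Eu (Ei x) = x"
proof -
  have "layer_decomp N (Ei x) (\<lambda>j. (1 / real j) *\<^sub>R lay x j)"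
    using strat_layers(1) lay_in by (auto simp: layer_decomp_def Ei_def subspace_scale)
  from lay_eqI[OF this] have "lay (Ei x) = (\<lambda>j. (1 / real j) *\<^sub>R lay x j)" .
  then have "Eu (Ei x) = (\<Sum>j=1..step N. lay x j)"
    unfolding Eu_def by (intro sum.cong) auto
  then show ?thesis using lay_sum by simp
qed

lemma dil_exp_derivative: "((\<lambda>t. dil N (exp t) x) has_derivative (\<lambda>h. h *\<^sub>R Eu x)) (at 0)"
proof -
  have "((\<lambda>t. exp t ^ j *\<^sub>R lay x j) has_derivative (\<lambda>h. h *\<^sub>R real j *\<^sub>R lay x j)) (at 0)" for j
  proof -
    have "((\<lambda>t::real. exp t ^ j) has_real_derivative real j) (at 0)"
      by (auto intro!: derivative_eq_intros)
    then have "((\<lambda>t::real. exp t ^ j) has_derivative (\<lambda>h. real j * h)) (at 0)"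
      by (simp add: has_field_derivative_def)
    from has_derivative_scaleR_left[OF this, of "lay x j"] show ?thesis by (simp add: mult.commute)
  qed
  then have "((\<lambda>t. \<Sum>j=1..step N. exp t ^ j *\<^sub>R lay x j) has_derivative (\<lambda>h. \<Sum>j=1..step N. h *\<^sub>R real j *\<^sub>R lay x j)) (at 0)"
    by (intro has_derivative_sum)
  then show ?thesis by (simp add: dil_eq Eu_def scaleR_sum_right)
qed

text \<open>\<open>(flow m t, exp t)\<close> is the conjugate of \<open>(0, exp t)\<close> by \<open>(m, 1)\<close>; its initial velocity is
  \<open>(velocity m, 1)\<close>.\<close>

definition "flow m t = m \<cdot> dil N (exp t) (- m)"
definition "velocity m = Df (m, - m) (0, - Eu m)"

lemma flow_derivative: "(flow m has_derivative (\<lambda>h. h *\<^sub>R velocity m)) (at 0)"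
proof -
  interpret L: bounded_linear "Df (m, - m)" by (rule Df_linear)
  interpret E: bounded_linear Eu by (rule Eu_linear)
  have "((\<lambda>t. m \<cdot> dil N (exp t) (- m)) has_derivative (\<lambda>h. Df (m, dil N (exp 0) (- m)) (0, h *\<^sub>R Eu (- m)))) (at 0)"
    by (rule op_has_derivative[OF has_derivative_const dil_exp_derivative])
  moreover have "Df (m, - m) (0, h *\<^sub>R - Eu m) = h *\<^sub>R velocity m" for h
    using L.scaleR[of h "(0, - Eu m)"] by (simp add: velocity_def)
  ultimately show ?thesis by (simp add: flow_def[abs_def] linear_simps(4)[OF Eu_linear])
qed

lemma flow_add: "flow m (s + t) = flow m s \<cdot> dil N (exp s) (flow m t)"
proof -
  have "dil N (exp s) (flow m t) = dil N (exp s) m \<cdot> dil N (exp (s + t)) (- m)"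
    unfolding flow_def by (subst strat_dil) (simp_all add: dil_dil exp_add)
  then show ?thesis
    by (simp add: flow_def op_assoc dil_minus)
qed

lemma flow_continuous: "continuous_on UNIV (flow m)"
  unfolding flow_def[abs_def] by (intro continuous_intros)

lemma flow_dil: "0 < a \<Longrightarrow> flow (dil N a m) t = dil N a (flow m t)"
  unfolding flow_def by (simp add: strat_dil dil_dil dil_minus[symmetric] mult.commute)

lemma velocity_dil:
  assumes "0 < a"
  shows "velocity (dil N a m) = dil N a (velocity m)"
proof -
  have "((\<lambda>t. dil N a (flow m t)) has_derivative (\<lambda>h. dil N a (h *\<^sub>R velocity m))) (at 0)"
    by (rule bounded_linear.has_derivative[OF dil_linear flow_derivative])
  moreover have "((\<lambda>t. dil N a (flow m t)) has_derivative (\<lambda>h. h *\<^sub>R velocity (dil N a m))) (at 0)"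
    unfolding flow_dil[OF assms, symmetric] by (rule flow_derivative)
  ultimately have "(\<lambda>h. dil N a (h *\<^sub>R velocity m)) = (\<lambda>h. h *\<^sub>R velocity (dil N a m))"
    by (rule has_derivative_unique)
  from fun_cong[OF this, of 1] show ?thesis by simp
qed

text \<open>In \<open>velocity\<close> the point and the direction vary together. Expanding the
  direction in the basis reduces continuity and differentiability to those of \<open>Df\<close> in
  fixed directions.\<close>

lemma velocity_sum: "velocity m = (\<Sum>b\<in>Basis. ((- Eu m) \<bullet> b) *\<^sub>R Df (m, - m) (0, b))"
proof -
  interpret L: bounded_linear "Df (m, - m)" by (rule Df_linear)
  have lin: "linear (\<lambda>k. Df (m, - m) (0, k))"
  proof (rule linearI)
    show "Df (m, - m) (0, b1 + b2) = Df (m, - m) (0, b1) + Df (m, - m) (0, b2)" for b1 b2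
      using L.add[of "(0, b1)" "(0, b2)"] by simp
    show "Df (m, - m) (0, r *\<^sub>R b) = r *\<^sub>R Df (m, - m) (0, b)" for r b
      using L.scaleR[of r "(0, b)"] by simp
  qed
  have "velocity m = Df (m, - m) (0, \<Sum>b\<in>Basis. ((- Eu m) \<bullet> b) *\<^sub>R b)"
    unfolding velocity_def by (subst euclidean_representation) simp
  also have "\<dots> = (\<Sum>b\<in>Basis. Df (m, - m) (0, ((- Eu m) \<bullet> b) *\<^sub>R b))"
    by (rule linear_sum[OF lin])
  also have "\<dots> = (\<Sum>b\<in>Basis. ((- Eu m) \<bullet> b) *\<^sub>R Df (m, - m) (0, b))"
    by (simp only: linear_cmul[OF lin])
  finally show ?thesis .
qed

lemma velocity_continuous: "continuous_on UNIV velocity"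
proof -
  have "continuous_on UNIV (\<lambda>m. Df (m, - m) (0, b))" for b
    by (rule continuous_on_compose2[OF Df_continuous]) (auto intro!: continuous_intros)
  then show ?thesis unfolding velocity_sum[abs_def]
    by (intro continuous_intros bounded_linear.continuous_on[OF Eu_linear])
qed

text \<open>In the product rule the derivative of the \<open>Df\<close> factor drops out, since it
  is multiplied by Eu 0 = 0.\<close>

lemma velocity_derivative: "(velocity has_derivative (\<lambda>h. - Eu h)) (at 0)"
proof -
  interpret E: bounded_linear Eu by (rule Eu_linear)
  have "((\<lambda>m. ((- Eu m) \<bullet> b) *\<^sub>R Df (m, - m) (0, b)) has_derivative (\<lambda>h. ((- Eu h) \<bullet> b) *\<^sub>R b)) (at 0)" for b
  proof -
    obtain D where D: "((\<lambda>p. Df p (0, b)) has_derivative D) (at (0, - 0))"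
      using Df_differentiable[of "(0, b)" "(0, - 0)"] unfolding differentiable_def by blast
    have "((\<lambda>m. (m, - m)) has_derivative (\<lambda>h. (h, - h))) (at (0::'v))"
      by (auto intro!: derivative_eq_intros)
    from has_derivative_compose[OF this D]
    have g: "((\<lambda>m. Df (m, - m) (0, b)) has_derivative (\<lambda>h. D (h, - h))) (at 0)" .
    have "((\<lambda>m. (- Eu m) \<bullet> b) has_derivative (\<lambda>h. (- Eu h) \<bullet> b)) (at 0)"
      by (intro has_derivative_inner_left has_derivative_minus E.has_derivative has_derivative_ident)
    from has_derivative_scaleR[OF this g] show ?thesis by (simp add: E.zero Df_left)
  qed
  then have "((\<lambda>m. \<Sum>b\<in>Basis. ((- Eu m) \<bullet> b) *\<^sub>R Df (m, - m) (0, b)) has_derivative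
      (\<lambda>h. \<Sum>b\<in>Basis. ((- Eu h) \<bullet> b) *\<^sub>R b)) (at 0)"
    by (intro has_derivative_sum)
  then show ?thesis by (simp only: velocity_sum[abs_def] euclidean_representation)
qed

text \<open>\<open>velocity\<close> has an invertible derivative at 0, so its range is a neighbourhood of 0, and it commutes
  with dilations.\<close>

lemma velocity_surj: "\<exists>m. velocity m = z"
proof -
  interpret E: bounded_linear Eu by (rule Eu_linear)
  have "velocity 0 \<in> interior (velocity ` UNIV)"
  proof (rule sussmann_open_mapping[of UNIV])
    show "bounded_linear (\<lambda>h. - Ei h)" using Ei_linear by (rule bounded_linear_minus)
    show "(\<lambda>h. - Eu h) \<circ> (\<lambda>h. - Ei h) = id" by (auto simp: fun_eq_iff linear_simps(4)[OF Eu_linear] Eu_Ei)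
  qed (use velocity_continuous velocity_derivative in auto)
  moreover have "velocity 0 = 0" by (simp add: velocity_sum E.zero)
  ultimately obtain e where e: "0 < e" "ball 0 e \<subseteq> range velocity"
    by (auto simp: mem_interior)
  obtain a where a: "0 < a" "norm (dil N a z) < e" using small_dil[of "{z}" e] e by auto
  then have "dil N a z \<in> range velocity" using e by auto
  then obtain m where "dil N a z = velocity m" by auto
  then have "z = velocity (dil N (1 / a) m)"
    using velocity_dil[of "1 / a" m] dil_inverse(2)[OF a(1), of z] a(1) by simp
  then show ?thesis by blast
qed

lemma one_param_snd:
  assumes "one_param_subgroup N (z, b) c"
  shows "snd (c t) = exp (b * t)"
proof -
  define \<alpha> where "\<alpha> t = snd (c t)" for t
  have pos: "0 < \<alpha> t" for t using assms by (auto simp: one_param_subgroup_def G_carrier_def \<alpha>_def mem_Times_iff)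
  have add: "\<alpha> (s + t) = \<alpha> s * \<alpha> t" for s t using assms by (simp add: one_param_subgroup_def G_op_def \<alpha>_def)
  have "(c has_derivative (\<lambda>h. h *\<^sub>R (z, b))) (at 0)"
    using assms by (simp add: one_param_subgroup_def has_vector_derivative_def)
  from has_derivative_snd[OF this] have d0: "(\<alpha> has_real_derivative b) (at 0)"
    by (simp add: \<alpha>_def[abs_def] has_field_derivative_def mult_commute_abs)
  have d: "(\<alpha> has_real_derivative \<alpha> t * b) (at t)" for t
  proof -
    have "((\<lambda>s. \<alpha> (- t + s)) has_real_derivative b * 1) (at t)"
      by (rule DERIV_chain2[where f = \<alpha> and g = "\<lambda>s. - t + s"]) (use d0 in \<open>auto intro!: derivative_eq_intros\<close>)
    then have "((\<lambda>s. \<alpha> t * \<alpha> (- t + s)) has_real_derivative \<alpha> t * (b * 1)) (at t)"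
      by (rule DERIV_cmult)
    moreover have "\<alpha> t * \<alpha> (- t + s) = \<alpha> s" for s using add[of t "- t + s"] by simp
    ultimately show ?thesis by simp
  qed
  have "((\<lambda>t. \<alpha> t * exp (- (b * t))) has_real_derivative 0) (at t)" for t
    by (rule derivative_eq_intros d refl | simp)+
  then have "\<alpha> t * exp (- (b * t)) = \<alpha> 0 * exp (- (b * 0))"
    by (intro DERIV_isconst_all) auto
  moreover have "\<alpha> 0 = 1" using add[of 0 0] pos[of 0] by simp
  ultimately have "\<alpha> t * (exp (- (b * t)) * exp (b * t)) = exp (b * t)" by (simp only: mult.assoc[symmetric]) simp
  then show ?thesis by (simp add: \<alpha>_def flip: exp_add)
qed

text \<open>The quotient \<open>p\<close> of the \<open>N\<close>-components has derivative 0 at 0, and \<open>p (t + h)\<close> is a smooth function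
  of \<open>p h\<close>.\<close>

lemma one_param_unique:
  assumes c: "one_param_subgroup N Z c" and c': "one_param_subgroup N Z c'"
  shows "c = c'"
proof -
  obtain z b where Z: "Z = (z, b)" by fastforce
  define w where "w t = fst (c t)" for t
  define w' where "w' t = fst (c' t)" for t
  have s: "snd (c t) = exp (b * t)" "snd (c' t) = exp (b * t)" for t
    using one_param_snd c c' Z by auto
  have add: "w (s + t) = w s \<cdot> dil N (exp (b * s)) (w t)" "w' (s + t) = w' s \<cdot> dil N (exp (b * s)) (w' t)" for s t
    using c c' s by (simp_all add: one_param_subgroup_def G_op_def w_def w'_def)
  have zero: "w 0 = 0" "w' 0 = 0"
    using add[of 0 0] op_left_inj[of "w 0" "w 0" 0] op_left_inj[of "w' 0" "w' 0" 0] by simp_all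
  have "(c has_derivative (\<lambda>h. h *\<^sub>R (z, b))) (at 0)" "(c' has_derivative (\<lambda>h. h *\<^sub>R (z, b))) (at 0)"
    using c c' Z by (simp_all add: one_param_subgroup_def has_vector_derivative_def)
  from this[THEN has_derivative_fst]
  have dw: "(w has_derivative (\<lambda>h. h *\<^sub>R z)) (at 0)" "(w' has_derivative (\<lambda>h. h *\<^sub>R z)) (at 0)"
    by (simp_all add: w_def[abs_def] w'_def[abs_def])
  define p where "p t = w t \<cdot> (- w' t)" for t
  have p0: "(p has_derivative (\<lambda>h. 0)) (at 0)"
    using op_has_derivative[OF dw(1) has_derivative_minus[OF dw(2)]]
    by (simp add: p_def[abs_def] zero Df_0)
  have padd: "p (t + h) = w t \<cdot> dil N (exp (b * t)) (p h) \<cdot> (- w' t)" for t h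
    unfolding p_def add minus_op by (subst strat_dil) (simp_all add: op_assoc dil_minus)
  have dp: "(p has_derivative (\<lambda>h. 0)) (at t)" for t
  proof -
    let ?a = "exp (b * t)"
    have "((\<lambda>h. w t \<cdot> dil N ?a (p h) \<cdot> (- w' t)) has_derivative
      (\<lambda>h. Df (w t \<cdot> dil N ?a (p 0), - w' t) (Df (w t, dil N ?a (p 0)) (0, dil N ?a 0), 0))) (at 0)"
      by (intro op_has_derivative has_derivative_const bounded_linear.has_derivative[OF dil_linear p0])
    then have q: "((\<lambda>h. p (t + h)) has_derivative (\<lambda>h. 0)) (at (t - t))"
      using linear_simps(3)[OF Df_linear] by (simp add: padd[symmetric] zero_prod_def[symmetric])
    have "((\<lambda>s. s - t) has_derivative (\<lambda>h. h)) (at t)" by (auto intro!: derivative_eq_intros)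
    from has_derivative_compose[OF this q] show ?thesis by simp
  qed
  have "p t = p 0" for t
    using has_derivative_zero_constant[of UNIV p] dp by (metis UNIV_I convex_UNIV)
  then have "p t = 0" for t by (simp add: p_def zero)
  then have "w t = w' t" for t using op_cancel(2)[of "w t" "w' t"] by (simp add: p_def)
  then show "c = c'" using s by (auto simp: fun_eq_iff prod_eq_iff w_def w'_def)
qed

text \<open>\<open>representation\<close> is 0 for a dependent family and off the span, so \<open>unit_slope\<close> excludes both.\<close>

lemma unit_slope_snd:
  assumes "Z \<in> unit_slope N"
  shows "snd Z = 1"
proof -
  let ?B = "g_basis N" and ?r = "representation (g_basis N)"
  have 1: "(\<Sum>e\<in>?B. ?r Z e * ?r X0 e) = 1" using assms by (simp add: unit_slope_def g_inner_def)
  have ind: "independent ?B"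
    using 1 by (rule contrapos_pp) (simp add: representation_def)
  have "Z \<in> span ?B"
    using 1 by (rule contrapos_pp) (simp add: representation_def)
  have fin: "finite ?B" using 1 by (rule contrapos_pp) simp
  have X0: "X0 \<in> ?B" by (simp add: g_basis_def)
  have rX: "?r X0 e = (if e = X0 then 1 else 0)" for e
    using representation_basis[OF ind X0] by simp
  have rZ: "?r Z X0 = 1" using 1 fin X0 by (simp add: rX if_distrib cong: if_cong)
  have "Z = (\<Sum>e\<in>?B. ?r Z e *\<^sub>R e)"
    using sum_representation_eq[OF ind \<open>Z \<in> span ?B\<close> fin] by simp
  then have "snd Z = snd (\<Sum>e\<in>?B. ?r Z e *\<^sub>R e)" by (rule arg_cong)
  also have "\<dots> = (\<Sum>e\<in>?B. ?r Z e * snd e)" by (simp add: snd_sum)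
  also have "\<dots> = (\<Sum>e\<in>?B. if e = X0 then ?r Z e else 0)"
    by (intro sum.cong) (auto simp: g_basis_def X0_def)
  also have "\<dots> = 1" using fin X0 rZ by simp
  finally show ?thesis .
qed

lemma G_exp_eq:
  assumes "Z \<in> unit_slope N" "velocity m = fst Z"
  shows "G_exp N (t *\<^sub>R Z) = (flow m t, exp t)"
proof -
  have Z: "Z = (velocity m, 1)" using assms unit_slope_snd by (simp add: prod_eq_iff)
  have "one_param_subgroup N (t *\<^sub>R Z) (\<lambda>s. (flow m (t * s), exp (t * s)))"
    unfolding one_param_subgroup_def
  proof (intro conjI allI)
    show "(flow m (t * s), exp (t * s)) \<in> G_carrier" for s by (simp add: G_carrier_def)
    show "(flow m (t * (s + s')), exp (t * (s + s'))) =
      G_op N (flow m (t * s), exp (t * s)) (flow m (t * s'), exp (t * s'))" for s s'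
      by (simp add: G_op_def distrib_left flow_add exp_add)
    have "((\<lambda>s. t * s) has_derivative (\<lambda>h. t * h)) (at 0)" by (auto intro!: derivative_eq_intros)
    moreover have "(flow m has_derivative (\<lambda>h. h *\<^sub>R velocity m)) (at (t * 0))" using flow_derivative by simp
    ultimately have f: "((\<lambda>s. flow m (t * s)) has_derivative (\<lambda>h. (t * h) *\<^sub>R velocity m)) (at 0)"
      by (rule has_derivative_compose)
    have "((\<lambda>s. exp (t * s)) has_real_derivative t) (at 0)" by (auto intro!: derivative_eq_intros)
    then have "((\<lambda>s. exp (t * s)) has_derivative (\<lambda>h. t * h)) (at 0)" by (simp add: has_field_derivative_def)
    from has_derivative_Pair[OF f this]
    show "((\<lambda>s. (flow m (t * s), exp (t * s))) has_vector_derivative t *\<^sub>R Z) (at 0)"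
      by (simp add: has_vector_derivative_def Z mult.commute)
  qed
  then have "(THE c. one_param_subgroup N (t *\<^sub>R Z) c) = (\<lambda>s. (flow m (t * s), exp (t * s)))"
    using one_param_unique by (intro the_equality) auto
  then show ?thesis by (simp add: G_exp_def)
qed

end

section \<open>Flow coordinates and the measure of cylinders\<close>

lemma sets_flow_measure: "sets (flow_measure \<phi>) = sets (restrict_space borel (G_carrier :: ('v::euclidean_space \<times> real) set))"
proof -
  have "sets (flow_measure \<phi>) = sets (restrict_space lborel (G_carrier :: ('v \<times> real) set))"
    by (simp add: flow_measure_def right_haar_def)
  also have "\<dots> = sets (restrict_space borel (G_carrier :: ('v \<times> real) set))"
    by (intro sets_restrict_space_cong) simp
  finally show ?thesis .
qed

lemma open_G_carrier: "open (G_carrier :: ('v::euclidean_space \<times> real) set)"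
  unfolding G_carrier_def by (intro open_Times) auto

lemma G_carrier_borel: "(G_carrier :: ('v::euclidean_space \<times> real) set) \<in> sets borel"
  using open_G_carrier by (rule borel_open)

lemma sets_flow_measure_iff:
  "A \<in> sets (flow_measure \<phi>) \<longleftrightarrow> A \<in> sets borel \<and> A \<subseteq> (G_carrier :: ('v::euclidean_space \<times> real) set)"
  unfolding sets_flow_measure using G_carrier_borel by (subst sets_restrict_space_iff) auto

lemma space_flow_measure: "space (flow_measure \<phi>) = (G_carrier :: ('v::euclidean_space \<times> real) set)"
  using sets_eq_imp_space_eq[OF sets_flow_measure[of \<phi>]] by (simp add: space_restrict_space)

lemma open_sets_flow_measure: "open A \<Longrightarrow> A \<subseteq> G_carrier \<Longrightarrow> A \<in> sets (flow_measure \<phi>)"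
  by (simp add: sets_flow_measure_iff borel_open)

locale flow_system = stratified +
  fixes Z :: "'a \<times> real" and \<phi> :: "'a \<times> real \<Rightarrow> real"
  assumes Z: "Z \<in> unit_slope N" and density: "flow_density N Z \<phi>"
begin

text \<open>Conjugation by \<open>(base, 1)\<close> carries the one-parameter subgroup of X0 to that
  of Z.\<close>

definition "base = (SOME m. velocity m = fst Z)"
abbreviation "W t \<equiv> flow base t"

lemma velocity_base: "velocity base = fst Z"
  unfolding base_def using velocity_surj by (rule someI_ex)

lemma G_exp_Z: "G_exp N (t *\<^sub>R Z) = (W t, exp t)"
  by (rule G_exp_eq[OF Z velocity_base])

definition \<Phi> :: "'a \<times> real \<Rightarrow> 'a \<times> real" where
  "\<Phi> p = (op N (fst p) (W (snd p)), exp (snd p))"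

definition \<Psi> :: "'a \<times> real \<Rightarrow> 'a \<times> real" where
  "\<Psi> x = (op N (fst x) (- W (ln (snd x))), ln (snd x))"

lemma Phi_eq: "G_op N (n, 1) (G_exp N (t *\<^sub>R Z)) = \<Phi> (n, t)"
  by (simp add: G_op_def G_exp_Z \<Phi>_def)

lemma W_continuous [continuous_intros]: "continuous_on S f \<Longrightarrow> continuous_on S (\<lambda>x. W (f x))"
  by (rule continuous_on_compose2[OF flow_continuous]) auto

lemma Phi_continuous: "continuous_on UNIV \<Phi>"
  unfolding \<Phi>_def[abs_def] by (intro continuous_intros)

lemma Psi_continuous: "continuous_on G_carrier \<Psi>"
  unfolding \<Psi>_def[abs_def] G_carrier_def by (intro continuous_intros) auto

lemma Psi_Phi: "\<Psi> (\<Phi> p) = p"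
  by (simp add: \<Psi>_def \<Phi>_def op_assoc prod_eq_iff)

lemma Phi_Psi: "x \<in> G_carrier \<Longrightarrow> \<Phi> (\<Psi> x) = x"
  by (auto simp: \<Psi>_def \<Phi>_def op_assoc prod_eq_iff G_carrier_def)

lemma Phi_carrier: "\<Phi> p \<in> G_carrier"
  by (auto simp: \<Phi>_def G_carrier_def)

lemma Phi_image: "\<Phi> ` A = G_carrier \<inter> \<Psi> -` A"
proof
  show "\<Phi> ` A \<subseteq> G_carrier \<inter> \<Psi> -` A" by (auto simp: Psi_Phi Phi_carrier)
  show "G_carrier \<inter> \<Psi> -` A \<subseteq> \<Phi> ` A"
  proof
    fix x assume "x \<in> G_carrier \<inter> \<Psi> -` A"
    then show "x \<in> \<Phi> ` A" using Phi_Psi[of x] by (intro image_eqI[of _ _ "\<Psi> x"]) auto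
  qed
qed

lemma Phi_image_iff: "\<Phi> p \<in> \<Phi> ` A \<longleftrightarrow> p \<in> A"
proof
  assume "\<Phi> p \<in> \<Phi> ` A"
  then obtain q where q: "q \<in> A" "\<Phi> p = \<Phi> q" by blast
  have "p = \<Psi> (\<Phi> q)" using q(2) Psi_Phi[of p] by simp
  then show "p \<in> A" using q(1) by (simp add: Psi_Phi)
qed simp

lemma open_Phi_image: "open A \<Longrightarrow> open (\<Phi> ` A)"
  unfolding Phi_image using continuous_open_preimage[OF Psi_continuous open_G_carrier] by blast

lemma cylinder_eq: "cylinder N Z r E a = \<Phi> ` (E \<times> {ln (a / r)<..<ln (a * r)})"
proof -
  have "cylinder N Z r E a = {\<Phi> (n, t) | n t. n \<in> E \<and> t \<in> {ln (a / r)<..<ln (a * r)}}"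
    unfolding cylinder_def Phi_eq ..
  also have "\<dots> = \<Phi> ` (E \<times> {ln (a / r)<..<ln (a * r)})" by blast
  finally show ?thesis .
qed

lemma phi_flow: "\<phi> (\<Phi> (n, t)) = \<phi> (n, 1)"
proof -
  have "(n, 1) \<in> G_carrier" by (simp add: G_carrier_def)
  then show ?thesis using density by (auto simp: flow_density_def Phi_eq[symmetric])
qed

lemma phi_borel: "(\<lambda>x. ennreal (\<phi> x) * indicator G_carrier x) \<in> borel_measurable borel"
proof -
  have "\<phi> \<in> borel_measurable (restrict_space lborel G_carrier)"
    using density by (simp add: flow_density_def right_haar_def)
  then have "(\<lambda>x. ennreal (\<phi> x)) \<in> borel_measurable (restrict_space lborel G_carrier)" by measurable
  then show ?thesis
    using G_carrier_borel by (subst (asm) borel_measurable_restrict_space_iff_ennreal) auto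
qed

lemma phi_slice: "(\<lambda>n. ennreal (\<phi> (n, 1))) \<in> borel_measurable borel"
proof -
  have "(\<lambda>n::'a. (n, 1::real)) \<in> borel_measurable borel"
    by (intro borel_measurable_continuous_onI continuous_intros)
  from measurable_compose[OF this phi_borel] show ?thesis by (simp add: G_carrier_def)
qed

lemma emeasure_flow_measure:
  assumes A: "A \<in> sets (flow_measure \<phi>)"
  shows "emeasure (flow_measure \<phi>) A =
    (\<integral>\<^sup>+t. (\<integral>\<^sup>+n. ennreal (\<phi> (n, 1)) * indicator A (\<Phi> (n, t)) \<partial>lborel) \<partial>lborel)"
proof -
  have AG: "A \<subseteq> G_carrier" using sets.sets_into_space[OF A] by (simp add: space_flow_measure)
  have Ab [measurable]: "A \<in> sets borel"
    using A unfolding sets_flow_measure_iff by simp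
  have [measurable]: "snd \<in> borel_measurable (borel :: ('a \<times> real) measure)"
    by (intro borel_measurable_continuous_onI continuous_intros)
  have swap: "(\<lambda>x::real \<times> 'a. (snd x, fst x)) \<in> borel_measurable borel"
    by (intro borel_measurable_continuous_onI continuous_intros)
  define p where "p x = ennreal (\<phi> x) * indicator G_carrier x" for x
  have [measurable]: "p \<in> borel_measurable borel" unfolding p_def by (rule phi_borel)
  have G: "(G_carrier :: ('a \<times> real) set) \<inter> space lborel \<in> sets lborel" using G_carrier_borel by auto
  have phim: "(\<lambda>x. ennreal (\<phi> x)) \<in> borel_measurable (restrict_space lborel G_carrier)"
    unfolding borel_measurable_restrict_space_iff_ennreal[OF G] using phi_borel by simp
  have AR: "A \<in> sets (restrict_space lborel G_carrier)" using Ab AG G by (simp add: sets_restrict_space_iff)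
  have inv: "(\<lambda>x. ennreal (1 / snd x)) \<in> borel_measurable (restrict_space lborel (G_carrier :: ('a \<times> real) set))"
    by (rule measurable_restrict_space1) measurable
  have "emeasure (flow_measure \<phi>) A = (\<integral>\<^sup>+x. ennreal (\<phi> x) * indicator A x \<partial>right_haar)"
    unfolding flow_measure_def using phim AR by (subst emeasure_density) (auto simp: right_haar_def)
  also have "\<dots> = (\<integral>\<^sup>+x. ennreal (1 / snd x) * (ennreal (\<phi> x) * indicator A x) \<partial>restrict_space lborel G_carrier)"
    unfolding right_haar_def using phim AR inv by (subst nn_integral_density) auto
  also have "\<dots> = (\<integral>\<^sup>+x. ennreal (1 / snd x) * (ennreal (\<phi> x) * indicator A x) * indicator G_carrier x \<partial>lborel)"
    by (rule nn_integral_restrict_space[OF G])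
  also have "\<dots> = (\<integral>\<^sup>+x. ennreal (1 / snd x) * (p x * indicator A x) * indicator {0<..} (snd x) \<partial>lborel)"
    using AG by (intro nn_integral_cong) (auto simp: p_def G_carrier_def split: split_indicator)
  also have "\<dots> = (\<integral>\<^sup>+x. ennreal (1 / snd x) * (p x * indicator A x) * indicator {0<..} (snd x) \<partial>(lborel \<Otimes>\<^sub>M lborel))"
    by (simp add: lborel_prod)
  also have "\<dots> = (\<integral>\<^sup>+a. (\<integral>\<^sup>+y. ennreal (1 / a) * (p (y, a) * indicator A (y, a)) * indicator {0<..} a \<partial>lborel) \<partial>lborel)"
    by (subst lborel_pair.nn_integral_snd[symmetric]) (simp_all add: lborel_prod)
  also have "\<dots> = (\<integral>\<^sup>+a. ennreal (1 / a) * (\<integral>\<^sup>+y. p (y, a) * indicator A (y, a) \<partial>lborel) * indicator {0<..} a \<partial>lborel)"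
    by (intro nn_integral_cong) (simp add: nn_integral_cmult nn_integral_multc)
  \<comment> \<open>The density 1 / a of the right Haar measure is absorbed by the substitution a =
    exp t.\<close>
  also have "\<dots> = (\<integral>\<^sup>+t. (\<integral>\<^sup>+y. p (y, exp t) * indicator A (y, exp t) \<partial>lborel) \<partial>lborel)"
  proof (rule nn_integral_exp_substitution)
    have "(\<lambda>x. p (snd x, fst x) * indicator A (snd x, fst x)) \<in> borel_measurable (lborel \<Otimes>\<^sub>M lborel)"
    proof -
      have "(\<lambda>x. p x * indicator A x) \<in> borel_measurable borel" by measurable
      from measurable_compose[OF swap this] show ?thesis by (simp add: lborel_prod)
    qed
    then show "(\<lambda>a. \<integral>\<^sup>+y. p (y, a) * indicator A (y, a) \<partial>lborel) \<in> borel_measurable borel"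
      using lborel.borel_measurable_nn_integral[of "\<lambda>a y. p (y, a) * indicator A (y, a)" lborel] by (simp add: split_beta')
  qed
  also have "\<dots> = (\<integral>\<^sup>+t. (\<integral>\<^sup>+n. ennreal (\<phi> (n, 1)) * indicator A (\<Phi> (n, t)) \<partial>lborel) \<partial>lborel)"
  proof (rule nn_integral_cong)
    fix t :: real
    have "(\<integral>\<^sup>+y. p (y, exp t) * indicator A (y, exp t) \<partial>lborel)
      = (\<integral>\<^sup>+n. p (op N n (W t), exp t) * indicator A (op N n (W t), exp t) \<partial>lborel)"
    proof (rule nn_integral_right_translation[symmetric])
      show "(\<lambda>y. p (y, exp t) * indicator A (y, exp t)) \<in> borel_measurable borel"
      proof -
        have m: "(\<lambda>y::'a. (y, exp t)) \<in> borel_measurable borel"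
          by (intro borel_measurable_continuous_onI continuous_intros)
        have "(\<lambda>x. p x * indicator A x) \<in> borel_measurable borel" by measurable
        from measurable_compose[OF m this] show ?thesis .
      qed
    qed
    also have "\<dots> = (\<integral>\<^sup>+n. ennreal (\<phi> (n, 1)) * indicator A (\<Phi> (n, t)) \<partial>lborel)"
      using phi_flow by (intro nn_integral_cong) (auto simp: p_def \<Phi>_def G_carrier_def)
    finally show "(\<integral>\<^sup>+y. p (y, exp t) * indicator A (y, exp t) \<partial>lborel) =
      (\<integral>\<^sup>+n. ennreal (\<phi> (n, 1)) * indicator A (\<Phi> (n, t)) \<partial>lborel)" .
  qed
  finally show ?thesis .
qed

lemma emeasure_cylinder:
  assumes E: "open E" and I: "open I"
  shows "\<Phi> ` (E \<times> I) \<in> sets (flow_measure \<phi>)"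
    "emeasure (flow_measure \<phi>) (\<Phi> ` (E \<times> I)) = emeasure (trace_measure \<phi>) E * emeasure lborel I"
proof -
  show s: "\<Phi> ` (E \<times> I) \<in> sets (flow_measure \<phi>)"
    by (intro open_sets_flow_measure open_Phi_image open_Times E I) (auto simp: Phi_carrier)
  have Em: "emeasure (trace_measure \<phi>) E = (\<integral>\<^sup>+n. ennreal (\<phi> (n, 1)) * indicator E n \<partial>lborel)"
    unfolding trace_measure_def using phi_slice E by (subst emeasure_density) auto
  have "emeasure (flow_measure \<phi>) (\<Phi> ` (E \<times> I)) =
    (\<integral>\<^sup>+t. (\<integral>\<^sup>+n. ennreal (\<phi> (n, 1)) * indicator E n * indicator I t \<partial>lborel) \<partial>lborel)"
    unfolding emeasure_flow_measure[OF s]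
    by (intro nn_integral_cong) (auto simp: indicator_def Phi_image_iff)
  also have "\<dots> = (\<integral>\<^sup>+t. emeasure (trace_measure \<phi>) E * indicator I t \<partial>lborel)"
    unfolding Em using phi_slice E by (intro nn_integral_cong) (simp add: nn_integral_multc)
  also have "\<dots> = emeasure (trace_measure \<phi>) E * emeasure lborel I"
    using I by (subst nn_integral_cmult_indicator) auto
  finally show "emeasure (flow_measure \<phi>) (\<Phi> ` (E \<times> I)) = emeasure (trace_measure \<phi>) E * emeasure lborel I" .
qed

text \<open>By the product formula, null sets of N and countable sets of times both lift to null
  sets of G.\<close>

lemma AE_flow_measure:
  assumes Gs: "Gs \<in> sets borel" "AE n in trace_measure \<phi>. n \<in> Gs" and T: "countable T"
  shows "AE x in flow_measure \<phi>. x \<in> \<Phi> ` (Gs \<times> (- T))"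
proof -
  let ?A = "G_carrier \<inter> \<Psi> -` (- (Gs \<times> (- T)))"
  have Tb: "T \<in> sets borel" by (rule sets.countable[OF _ T]) auto
  have cb: "- (Gs \<times> (- T)) \<in> sets borel"
  proof -
    have "Gs \<times> (- T) \<in> sets (borel \<Otimes>\<^sub>M borel)" using Gs(1) Tb by auto
    then have "Gs \<times> (- T) \<in> sets borel" unfolding borel_prod .
    then show ?thesis by auto
  qed
  have "\<Psi> \<in> borel_measurable (restrict_space borel G_carrier)"
    by (rule borel_measurable_continuous_on_restrict[OF Psi_continuous])
  from measurable_sets[OF this cb]
  have A: "?A \<in> sets (flow_measure \<phi>)" by (simp add: sets_flow_measure space_restrict_space Int_commute)
  have "emeasure (flow_measure \<phi>) ?A =
    (\<integral>\<^sup>+t. (\<integral>\<^sup>+n. ennreal (\<phi> (n, 1)) * indicator ?A (\<Phi> (n, t)) \<partial>lborel) \<partial>lborel)"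
    by (rule emeasure_flow_measure[OF A])
  also have "\<dots> = (\<integral>\<^sup>+t. 0 \<partial>(lborel :: real measure))"
  proof (rule nn_integral_cong_AE)
    have "AE t in lborel. t \<notin> T" using T by (intro AE_not_in countable_imp_null_set_lborel)
    then show "AE t in lborel. (\<integral>\<^sup>+n. ennreal (\<phi> (n, 1)) * indicator ?A (\<Phi> (n, t)) \<partial>lborel) = 0"
    proof eventually_elim
      case (elim t)
      have "AE n in lborel. 0 < ennreal (\<phi> (n, 1)) \<longrightarrow> n \<in> Gs"
        using Gs(2) phi_slice unfolding trace_measure_def by (subst (asm) AE_density) auto
      then have "AE n in lborel. ennreal (\<phi> (n, 1)) * indicator ?A (\<Phi> (n, t)) = 0"
        by eventually_elim (use elim in \<open>auto simp: indicator_def Psi_Phi not_less ennreal_neg\<close>)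
      then show ?case by (subst nn_integral_cong_AE[where v = "\<lambda>_. 0"]) auto
    qed
  qed
  finally have "?A \<in> null_sets (flow_measure \<phi>)" using A by auto
  then have "AE x in flow_measure \<phi>. x \<notin> ?A" by (rule AE_not_in)
  then show ?thesis using AE_space
    by eventually_elim (auto simp: space_flow_measure Phi_image)
qed

end

section \<open>Small Carnot--Caratheodory balls\<close>

lemma curve_increment_bound:
  fixes c :: "real \<Rightarrow> 'a::euclidean_space"
  assumes c: "continuous_on {0..1} c" and F: "finite F"
    and d: "\<And>t. t \<in> {0..1} - F \<Longrightarrow> (c has_vector_derivative v t) (at t within {0..1})"
    and w: "w integrable_on {0..1}" "\<And>t. 0 \<le> w t" and M: "0 \<le> M"
    and T: "0 \<le> T" "T \<le> 1" and b: "\<And>t. t \<in> {0..T} - F \<Longrightarrow> norm (v t) \<le> M * w t"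
  shows "norm (c T - c 0) \<le> M * integral {0..1} w"
proof -
  define v' where "v' t = (if t \<in> F then 0 else v t)" for t
  have I: "(v' has_integral (c T - c 0)) {0..T}"
  proof (rule fundamental_theorem_of_calculus_interior_strong[OF F T(1)])
    fix t assume t: "t \<in> {0<..<T} - F"
    then have "(c has_vector_derivative v t) (at t within {0..1})" using T by (intro d) auto
    moreover have "at t within {0..1} = at t" using t T by (intro at_within_Icc_at) auto
    ultimately show "(c has_vector_derivative v' t) (at t)" using t by (simp add: v'_def)
  qed (use T in \<open>auto intro: continuous_on_subset[OF c]\<close>)
  have w': "w integrable_on {0..T}" using T by (intro integrable_on_subinterval[OF w(1)]) auto
  have "norm (c T - c 0) = norm (integral {0..T} v')" using I by (simp add: integral_unique)
  also have "\<dots> \<le> integral {0..T} (\<lambda>t. M * w t)"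
  proof (rule integral_norm_bound_integral)
    show "v' integrable_on {0..T}" using I by auto
    show "(\<lambda>t. M * w t) integrable_on {0..T}" using w' by (rule integrable_on_mult_right)
    show "norm (v' t) \<le> M * w t" if "t \<in> {0..T}" for t
      using b[of t] that M w(2) by (auto simp: v'_def)
  qed
  also have "\<dots> = M * integral {0..T} w" by simp
  also have "\<dots> \<le> M * integral {0..1} w"
    using w w' T M by (intro mult_left_mono integral_subset_le) auto
  finally show ?thesis .
qed

text \<open>The speed bound holds only within distance \<rho> of the start. Up to the first time T
  of reaching that distance it applies, and the increment up to T is then too small.\<close>

lemma short_curve_stays:
  fixes c :: "real \<Rightarrow> 'a::euclidean_space"
  assumes c: "continuous_on {0..1} c" and F: "finite F"
    and d: "\<And>t. t \<in> {0..1} - F \<Longrightarrow> (c has_vector_derivative v t) (at t within {0..1})"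
    and w: "w integrable_on {0..1}" "\<And>t. 0 \<le> w t" and M: "0 \<le> M"
    and b: "\<And>t. t \<in> {0..1} - F \<Longrightarrow> norm (c t - c 0) \<le> \<rho> \<Longrightarrow> norm (v t) \<le> M * w t"
    and L: "M * integral {0..1} w < \<rho>"
  shows "norm (c 1 - c 0) < \<rho>"
proof (rule ccontr)
  assume far: "\<not> norm (c 1 - c 0) < \<rho>"
  define S where "S = {t\<in>{0..1}. \<rho> \<le> norm (c t - c 0)}"
  have "continuous_on {0..1} (\<lambda>t. norm (c t - c 0))" by (intro continuous_intros c)
  then have "closed ({0..1} \<inter> (\<lambda>t. norm (c t - c 0)) -` {\<rho>..})"
    by (rule continuous_closed_preimage) auto
  moreover have "S = {0..1} \<inter> (\<lambda>t. norm (c t - c 0)) -` {\<rho>..}" by (auto simp: S_def)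
  ultimately have clS: "closed S" by simp
  have ne: "S \<noteq> {}" using far by (auto simp: S_def intro!: exI[of _ 1])
  have bd: "bdd_below S" by (auto simp: S_def bdd_below_def)
  define T where "T = Inf S"
  have TS: "T \<in> S" unfolding T_def by (rule closed_contains_Inf[OF ne bd clS])
  have before: "norm (c t - c 0) < \<rho>" if "t \<in> {0..1}" "t < T" for t
    using that cInf_lower[OF _ bd, of t] by (fastforce simp: S_def T_def not_le)
  have T01: "0 \<le> T" "T \<le> 1" using TS by (auto simp: S_def)
  have "norm (c T - c 0) \<le> M * integral {0..1} w"
  \<comment> \<open>T joins the exceptional set because \<open>before\<close> controls only the
    times before T.\<close>
  proof (rule curve_increment_bound[where F = "insert T F" and v = v])
    show "norm (v t) \<le> M * w t" if "t \<in> {0..T} - insert T F" for t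
      using before[of t] that T01 by (intro b) auto
  qed (use c F d w M T01 in auto)
  then show False using TS L by (auto simp: S_def)
qed

section \<open>Horizontal curves and the size of their balls\<close>

context stratified
begin

definition hvel :: "(real \<Rightarrow> 'v \<Rightarrow> real) \<Rightarrow> real \<Rightarrow> 'v \<Rightarrow> 'v" where
  "hvel u t x = (\<Sum>X\<in>frame N 1. u t X *\<^sub>R left_field N X x)"

lemma horizontal_iff:
  "horizontal N c u \<longleftrightarrow> c piecewise_C1_differentiable_on {0..1} \<and>
     (\<exists>F. finite F \<and> (\<forall>t\<in>{0..1} - F. (c has_vector_derivative hvel u t (c t)) (at t within {0..1}))) \<and>
     speed N u integrable_on {0..1}"
  by (simp add: horizontal_def hvel_def)

definition curve :: "'v \<Rightarrow> 'v \<Rightarrow> real \<Rightarrow> bool" where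
  "curve x y l \<longleftrightarrow> (\<exists>c u. horizontal N c u \<and> c 0 = x \<and> c 1 = y \<and> l = integral {0..1} (speed N u))"

lemma cc_dist_eq: "cc_dist N x y = Inf {l. curve x y l}"
  unfolding cc_dist_def curve_def by (intro arg_cong[where f = Inf]) auto

lemma speed_nonneg: "0 \<le> speed N u t"
  by (simp add: speed_def sum_nonneg)

lemma curve_nonneg: "curve x y l \<Longrightarrow> 0 \<le> l"
  unfolding curve_def horizontal_iff using speed_nonneg by (auto intro!: integral_nonneg)

lemma cc_dist_less:
  assumes "curve x y l0" "cc_dist N x y < r"
  shows "\<exists>l<r. curve x y l"
proof -
  have "{l. curve x y l} \<noteq> {}" using assms by auto
  moreover have "bdd_below {l. curve x y l}" using curve_nonneg by (auto intro!: bdd_belowI)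
  ultimately show ?thesis using assms(2) by (auto simp: cc_dist_eq cInf_less_iff)
qed

lemma horizontal_cont: "horizontal N c u \<Longrightarrow> continuous_on {0..1} c"
  by (auto simp: horizontal_def piecewise_C1_differentiable_on_def)

lemma curve_sym:
  assumes "curve x y l"
  shows "curve y x l"
proof -
  obtain c u F where h: "c piecewise_C1_differentiable_on {0..1}" "finite F"
    "\<And>t. t \<in> {0..1} - F \<Longrightarrow> (c has_vector_derivative hvel u t (c t)) (at t within {0..1})"
    "speed N u integrable_on {0..1}" and e: "c 0 = x" "c 1 = y" "l = integral {0..1} (speed N u)"
    using assms unfolding curve_def horizontal_iff by blast
  define c' where "c' t = c (1 - t)" for t
  define u' where "u' t X = - u (1 - t) X" for t X
  have sp: "speed N u' t = speed N u (1 - t)" for t by (simp add: speed_def u'_def)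
  have im: "(\<lambda>x. (1 / (- 1)) *\<^sub>R x + - ((1 / (- 1)) *\<^sub>R 1)) ` cbox 0 (1::real) = {0..1}"
  proof -
    have "(\<lambda>x. (1 / (- 1)) *\<^sub>R x + - ((1 / (- 1)) *\<^sub>R 1)) = (\<lambda>x::real. 1 - x)" by auto
    then show ?thesis by simp
  qed
  have "(speed N u has_integral l) (cbox 0 1)" using h(4) e(3) by (simp add: integrable_integral)
  from has_integral_affinity[OF this, of "- 1" 1]
  have I: "(speed N u' has_integral l) {0..1}" unfolding im by (simp add: sp[abs_def])
  have "horizontal N c' u'" unfolding horizontal_iff
  proof (intro conjI exI[of _ "(\<lambda>t. 1 - t) ` F"] ballI)
    have "valid_path (reversepath c)" using h(1) by (simp add: valid_path_def[symmetric] valid_path_imp_reverse)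
    then show "c' piecewise_C1_differentiable_on {0..1}"
      by (simp add: valid_path_def reversepath_def[abs_def] c'_def[abs_def])
    show "finite ((\<lambda>t. 1 - t) ` F)" using h(2) by simp
    show "speed N u' integrable_on {0..1}" using I by auto
    fix t assume t: "t \<in> {0..1} - (\<lambda>t. 1 - t) ` F"
    then have t': "1 - t \<in> {0..1} - F" by (auto simp: image_iff)
    have im': "(\<lambda>t. 1 - t) ` {0..1} = {0..1::real}" by simp
    have "((\<lambda>t. 1 - t) has_vector_derivative (- 1)) (at t within {0..1})"
      by (auto intro!: derivative_eq_intros)
    from vector_diff_chain_within[OF this, of c "hvel u (1 - t) (c (1 - t))"]
    show "(c' has_vector_derivative hvel u' t (c' t)) (at t within {0..1})"
      using h(3)[OF t'] by (simp add: im' o_def c'_def[abs_def] hvel_def u'_def sum_negf)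
  qed
  moreover have "c' 0 = y" "c' 1 = x" using e by (auto simp: c'_def)
  moreover have "l = integral {0..1} (speed N u')" by (rule integral_unique[OF I, symmetric])
  ultimately show ?thesis unfolding curve_def by blast
qed

lemma hvel_affine:
  assumes "(c has_vector_derivative hvel u (k * t + b) (c (k * t + b))) (at (k * t + b))"
  shows "((\<lambda>s. c (k * s + b)) has_vector_derivative hvel (\<lambda>s X. k * u (k * s + b) X) t (c (k * t + b))) (at t)"
proof -
  have "((\<lambda>s. k * s + b) has_vector_derivative k) (at t)" by (auto intro!: derivative_eq_intros)
  from vector_diff_chain_at[OF this assms] show ?thesis
    by (simp add: o_def hvel_def scaleR_sum_right)
qed

lemma curve_trans:
  assumes "curve x y l1" "curve y z l2"
  shows "\<exists>l. curve x z l"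
proof -
  obtain c1 u1 F1 where h1: "c1 piecewise_C1_differentiable_on {0..1}" "finite F1"
    "\<And>t. t \<in> {0..1} - F1 \<Longrightarrow> (c1 has_vector_derivative hvel u1 t (c1 t)) (at t within {0..1})"
    "speed N u1 integrable_on {0..1}" and e1: "c1 0 = x" "c1 1 = y"
    using assms(1) unfolding curve_def horizontal_iff by blast
  obtain c2 u2 F2 where h2: "c2 piecewise_C1_differentiable_on {0..1}" "finite F2"
    "\<And>t. t \<in> {0..1} - F2 \<Longrightarrow> (c2 has_vector_derivative hvel u2 t (c2 t)) (at t within {0..1})"
    "speed N u2 integrable_on {0..1}" and e2: "c2 0 = y" "c2 1 = z"
    using assms(2) unfolding curve_def horizontal_iff by blast
  define c where "c = c1 +++ c2"
  define u where "u t X = (if t < 1/2 then 2 * u1 (2 * t) X else 2 * u2 (2 * t - 1) X)" for t X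
  have sp: "speed N u t = (if t < 1/2 then 2 * speed N u1 (2 * t) else 2 * speed N u2 (2 * t - 1))" for t
    by (simp add: speed_def u_def power_mult_distrib sum_distrib_left[symmetric] real_sqrt_mult)
  have s1: "(\<lambda>t. speed N u1 (2 * t)) integrable_on {0..1/2}"
    using integrable_on_affinity[of 2 "speed N u1" 0 1 0] h1(4) by simp
  have s2: "(\<lambda>t. speed N u2 (2 * t - 1)) integrable_on {1/2..1}"
  proof -
    have "(\<lambda>x. (1 / 2) *\<^sub>R x - (1 / 2) *\<^sub>R (- 1)) ` cbox 0 (1::real) = {1/2..1}"
      using image_affinity_atLeastAtMost[of "1/2" "1/2" 0 "1::real"] by simp
    then show ?thesis using integrable_on_affinity[of 2 "speed N u2" 0 1 "- 1"] h2(4) by simp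
  qed
  have "horizontal N c u" unfolding horizontal_iff
  \<comment> \<open>The junction is exceptional, and so are the endpoints, so that all remaining
    derivatives are two-sided.\<close>
  proof (intro conjI exI[of _ "{0, 1/2, 1} \<union> (\<lambda>t. t / 2) ` F1 \<union> (\<lambda>t. (t + 1) / 2) ` F2"] ballI)
    have "valid_path (c1 +++ c2)"
      using h1(1) h2(1) e1 e2 by (intro valid_path_join) (auto simp: valid_path_def pathfinish_def pathstart_def)
    then show "c piecewise_C1_differentiable_on {0..1}" by (simp add: valid_path_def c_def)
    show "finite ({0, 1/2, 1} \<union> (\<lambda>t. t / 2) ` F1 \<union> (\<lambda>t. (t + 1) / 2) ` F2)" using h1(2) h2(2) by simp
    show "speed N u integrable_on {0..1}"
    proof (rule Henstock_Kurzweil_Integration.integrable_combine[where a = 0 and c = "1/2" and b = 1])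
      show "speed N u integrable_on {0..1/2}"
        by (rule integrable_spike_finite[of "{1/2}" _ _ "\<lambda>t. 2 * speed N u1 (2 * t)"])
           (auto simp: sp intro!: integrable_on_mult_right s1)
      show "speed N u integrable_on {1/2..1}"
        by (rule integrable_eq[of "\<lambda>t. 2 * speed N u2 (2 * t - 1)"])
           (auto simp: sp intro!: integrable_on_mult_right s2)
    qed auto
    fix t :: real assume t: "t \<in> {0..1} - ({0, 1/2, 1} \<union> (\<lambda>t. t / 2) ` F1 \<union> (\<lambda>t. (t + 1) / 2) ` F2)"
    have interior: "at s within {0..1} = at s" if "0 < s" "s < 1" for s :: real
      using that by (intro at_within_Icc_at) auto
    have "(c has_vector_derivative hvel u t (c t)) (at t)"
    proof (cases "t < 1/2")
      case True
      then have t01: "0 < 2 * t" "2 * t < 1" using t by auto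
      have "2 * t / 2 \<notin> (\<lambda>t. t / 2) ` F1" using t by simp
      then have "2 * t \<notin> F1" by blast
      then have d: "(c1 has_vector_derivative hvel u1 (2 * t + 0) (c1 (2 * t + 0))) (at (2 * t + 0))"
        using t01 h1(3)[of "2 * t"] by (simp add: interior)
      have "((\<lambda>s. c1 (2 * s + 0)) has_vector_derivative hvel u t (c t)) (at t)"
        using hvel_affine[OF d] True by (simp add: hvel_def u_def c_def joinpaths_def)
      then show ?thesis
        by (rule has_vector_derivative_transform_within_open[of _ _ _ "{..<1/2}"]) (use True in \<open>auto simp: c_def joinpaths_def\<close>)
    next
      case False
      then have t01: "0 < 2 * t + - 1" "2 * t + - 1 < 1" using t by auto
      have "(2 * t + - 1 + 1) / 2 \<notin> (\<lambda>t. (t + 1) / 2) ` F2" using t by simp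
      then have "2 * t + - 1 \<notin> F2" by blast
      then have d: "(c2 has_vector_derivative hvel u2 (2 * t + - 1) (c2 (2 * t + - 1))) (at (2 * t + - 1))"
        using t01 h2(3)[of "2 * t + - 1"] interior[OF t01] by simp
      have "((\<lambda>s. c2 (2 * s + - 1)) has_vector_derivative hvel u t (c t)) (at t)"
        using hvel_affine[OF d] t01 by (simp add: hvel_def u_def c_def joinpaths_def)
      then show ?thesis
        by (rule has_vector_derivative_transform_within_open[of _ _ _ "{1/2<..}"]) (use t01 in \<open>auto simp: c_def joinpaths_def\<close>)
    qed
    then show "(c has_vector_derivative hvel u t (c t)) (at t within {0..1})"
      by (rule has_vector_derivative_at_within)
  qed
  moreover have "c 0 = x" "c 1 = z" using e1 e2 by (auto simp: c_def joinpaths_def)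
  ultimately show ?thesis unfolding curve_def by blast
qed

lemma left_field_eq: "left_field N X x = Df (x, 0) (0, X)"
proof -
  have "((\<lambda>t. t *\<^sub>R X) has_derivative (\<lambda>h. h *\<^sub>R X)) (at (0::real))" by (auto intro!: derivative_eq_intros)
  from op_has_derivative[OF has_derivative_const this, of x]
  have "((\<lambda>t. x \<cdot> (t *\<^sub>R X)) has_derivative (\<lambda>h. Df (x, 0) (0, h *\<^sub>R X))) (at 0)" by simp
  moreover have "Df (x, 0) (0, h *\<^sub>R X) = h *\<^sub>R Df (x, 0) (0, X)" for h
    using linear_simps(5)[OF Df_linear, of "(x, 0)" h "(0, X)"] by simp
  ultimately have "((\<lambda>t. x \<cdot> (t *\<^sub>R X)) has_vector_derivative Df (x, 0) (0, X)) (at 0)"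
    by (simp add: has_vector_derivative_def)
  then show ?thesis unfolding left_field_def by (rule vector_derivative_at)
qed

lemma left_field_continuous: "continuous_on UNIV (left_field N X)"
  unfolding left_field_eq[abs_def]
  by (rule continuous_on_compose2[OF Df_continuous]) (auto intro!: continuous_intros)

lemma horizontal_velocity_bound:
  "norm (hvel u t x) \<le> (\<Sum>X\<in>frame N 1. norm (left_field N X x)) * speed N u t"
proof -
  have "independent (frame N 1)" using strat by (auto simp: stratified_lie_group_def)
  then have fin: "finite (frame N 1)" by (rule independent_imp_finite)
  have u: "\<bar>u t X\<bar> \<le> speed N u t" if "X \<in> frame N 1" for X
  proof -
    have "(u t X)\<^sup>2 \<le> (\<Sum>X\<in>frame N 1. (u t X)\<^sup>2)" using fin that by (intro member_le_sum) auto
    then have "sqrt ((u t X)\<^sup>2) \<le> speed N u t" unfolding speed_def by (rule real_sqrt_le_mono)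
    then show ?thesis by simp
  qed
  have "norm (hvel u t x) \<le> (\<Sum>X\<in>frame N 1. norm (left_field N X x) * speed N u t)"
    unfolding hvel_def using u by (intro sum_norm_le) (auto simp: mult.commute intro!: mult_right_mono)
  then show ?thesis by (simp add: sum_distrib_right)
qed

text \<open>A curve of Euclidean displacement at most 1 starting in \<open>cball n 1\<close> stays
  in \<open>cball n 2\<close>, where the horizontal frame is bounded by M; so the displacement is at
  most M times the length, uniformly in the starting point.\<close>

lemma curve_small:
  assumes \<rho>: "0 < \<rho>"
  shows "\<exists>\<epsilon>>0. \<forall>x\<in>cball n 1. \<forall>y l. curve x y l \<longrightarrow> l < \<epsilon> \<longrightarrow> norm (y - x) < \<rho>"
proof -
  define \<sigma> where "\<sigma> = min \<rho> 1"
  have \<sigma>: "0 < \<sigma>" "\<sigma> \<le> \<rho>" "\<sigma> \<le> 1" using \<rho> by (auto simp: \<sigma>_def)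
  define S where "S x = (\<Sum>X\<in>frame N 1. norm (left_field N X x))" for x
  have "continuous_on (cball n 2) S" unfolding S_def
    using left_field_continuous by (intro continuous_intros) (auto intro: continuous_on_subset)
  then have "bounded (S ` cball n 2)" using compact_cball compact_continuous_image compact_imp_bounded by blast
  then obtain M where M: "0 < M" "\<And>x. x \<in> cball n 2 \<Longrightarrow> \<bar>S x\<bar> \<le> M"
    unfolding bounded_pos by auto
  have "norm (y - x) < \<rho>" if x: "x \<in> cball n 1" and cv: "curve x y l" and l: "l < \<sigma> / M" for x y l
  proof -
    obtain c u F where h: "horizontal N c u" "finite F"
      "\<And>t. t \<in> {0..1} - F \<Longrightarrow> (c has_vector_derivative hvel u t (c t)) (at t within {0..1})"
      "speed N u integrable_on {0..1}" and e: "c 0 = x" "c 1 = y" "l = integral {0..1} (speed N u)"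
      using cv unfolding curve_def horizontal_iff by blast
    have "norm (c 1 - c 0) < \<sigma>"
    proof (rule short_curve_stays[OF horizontal_cont[OF h(1)] h(2) h(3) h(4) speed_nonneg])
      show "0 \<le> M" using M by simp
      show "M * integral {0..1} (speed N u) < \<sigma>" using l M(1) by (simp add: e(3) field_simps)
      fix t assume "t \<in> {0..1} - F" and near: "norm (c t - c 0) \<le> \<sigma>"
      have "dist n (c t) \<le> dist n x + dist x (c t)" by (rule dist_triangle)
      also have "\<dots> \<le> 1 + 1" using x near \<sigma> e(1) by (intro add_mono) (auto simp: dist_norm norm_minus_commute)
      finally have "\<bar>S (c t)\<bar> \<le> M" by (intro M(2)) simp
      then have "S (c t) * speed N u t \<le> M * speed N u t" by (intro mult_right_mono speed_nonneg) auto
      then show "norm (hvel u t (c t)) \<le> M * speed N u t"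
        using horizontal_velocity_bound[of u t "c t"] by (simp add: S_def)
    qed
    then show ?thesis using e \<sigma> by simp
  qed
  then show ?thesis using \<sigma> M by (intro exI[of _ "\<sigma> / M"]) auto
qed

text \<open>For a pair of points that no horizontal curve connects, \<open>cc_dist\<close> is the unspecified value \<open>Inf {}\<close>.\<close>

lemma unreachable_balls:
  assumes "\<And>l. \<not> curve x y l" "Inf ({} :: real set) \<le> 0" "0 < r"
  shows "cc_ball N x r \<union> cc_ball N y r = UNIV"
proof -
  have "z \<in> cc_ball N x r \<union> cc_ball N y r" for z
  proof (cases "\<exists>l. curve x z l")
    case True
    then have "\<And>l. \<not> curve y z l" using curve_trans curve_sym assms(1) by blast
    then have "cc_dist N y z = Inf {}" by (simp add: cc_dist_eq)
    then show ?thesis using assms by (simp add: cc_ball_def)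
  next
    case False
    then have "cc_dist N x z = Inf {}" by (simp add: cc_dist_eq)
    then show ?thesis using assms by (simp add: cc_ball_def)
  qed
  then show ?thesis by blast
qed

text \<open>The center m is not known to be near n. The curve from m to n is therefore reversed
  first, to start at n; this places m in the unit ball around n, where the curve from m to y is
  controlled as well.\<close>

lemma cc_balls_shrink:
  assumes "(\<forall>x y. \<exists>l. curve x y l) \<or> 0 < Inf ({} :: real set)" and \<eta>: "0 < \<eta>"
  shows "\<exists>r0>0. \<forall>m r. r \<le> r0 \<longrightarrow> n \<in> cc_ball N m r \<longrightarrow> cc_ball N m r \<subseteq> ball n \<eta>"
proof -
  define \<rho> where "\<rho> = min 1 (\<eta> / 2)"
  have \<rho>: "0 < \<rho>" "\<rho> \<le> 1" "2 * \<rho> \<le> \<eta>" using \<eta> by (auto simp: \<rho>_def)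
  obtain \<epsilon> where \<epsilon>: "0 < \<epsilon>" "\<And>x y l. x \<in> cball n 1 \<Longrightarrow> curve x y l \<Longrightarrow> l < \<epsilon> \<Longrightarrow> norm (y - x) < \<rho>"
    using curve_small[OF \<rho>(1), of n] by blast
  \<comment> \<open>Below r1 a distance is attained by actual curves: unconnected pairs are at
    distance \<open>Inf {}\<close>, which serves as r1 when it is positive.\<close>
  obtain r1 where r1: "0 < r1" "\<And>x y r. r \<le> r1 \<Longrightarrow> cc_dist N x y < r \<Longrightarrow> \<exists>l<r. curve x y l"
  proof (cases "\<forall>x y. \<exists>l. curve x y l")
    case True
    then show thesis using cc_dist_less by (intro that[of 1]) (auto, metis)
  next
    case False
    then have p: "0 < Inf ({} :: real set)" using assms(1) by auto
    show thesis
    proof (rule that[OF p])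
      fix x y r assume r: "r \<le> Inf {}" "cc_dist N x y < r"
      have "\<exists>l. curve x y l"
      proof (rule ccontr)
        assume "\<not> ?thesis"
        then have "cc_dist N x y = Inf {}" by (simp add: cc_dist_eq)
        then show False using r by simp
      qed
      then show "\<exists>l<r. curve x y l" using cc_dist_less r by blast
    qed
  qed
  have "cc_ball N m r \<subseteq> ball n \<eta>" if r: "r \<le> min r1 \<epsilon>" and n: "n \<in> cc_ball N m r" for m r
  proof
    fix y assume y: "y \<in> cc_ball N m r"
    obtain l where l: "l < r" "curve m n l" using n r r1(2)[of r m n] by (auto simp: cc_ball_def)
    have nm: "norm (m - n) < \<rho>" using \<epsilon>(2)[OF _ curve_sym[OF l(2)]] l(1) r by simp
    obtain l' where l': "l' < r" "curve m y l'" using y r r1(2)[of r m y] by (auto simp: cc_ball_def)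
    have "norm (y - m) < \<rho>" using \<epsilon>(2)[OF _ l'(2)] l'(1) r nm \<rho> by (simp add: dist_norm norm_minus_commute)
    then have "dist n y < \<rho> + \<rho>"
      using nm dist_triangle[of n y m] by (simp add: dist_norm norm_minus_commute)
    then show "y \<in> ball n \<eta>" using \<rho> by simp
  qed
  then show ?thesis using r1 \<epsilon> by (intro exI[of _ "min r1 \<epsilon>"]) auto
qed

end

section \<open>The decomposition\<close>

locale cz_setting = flow_system +
  fixes \<Q> :: "int \<Rightarrow> 'a set set" and \<delta> C1 c gam lam :: real and P0 :: "'a cyl"
  assumes doubling: "doubling N (trace_measure \<phi>)"
    and christ_dec: "christ_cubes N (trace_measure \<phi>) \<Q> \<delta> C1 c"
    and gam5: "5 \<le> gam"
    and lam3: "exp 3 / \<delta> < lam"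
    and large: "large_admissible \<Q> \<delta> gam lam P0"
begin

abbreviation "\<nu> \<equiv> trace_measure \<phi>"

lemma sets_trace: "sets \<nu> = sets borel"
  by (simp add: trace_measure_def)

lemma cc_ball_measure:
  assumes "0 < r"
  shows "cc_ball N x r \<in> sets \<nu>" "0 < emeasure \<nu> (cc_ball N x r)" "emeasure \<nu> (cc_ball N x r) < \<infinity>"
proof -
  show p: "0 < emeasure \<nu> (cc_ball N x r)" "emeasure \<nu> (cc_ball N x r) < \<infinity>"
    using doubling assms unfolding doubling_def by blast+
  \<comment> \<open>A set outside the sigma-algebra has \<open>emeasure\<close> 0 by convention, so
    positivity forces measurability.\<close>
  then show "cc_ball N x r \<in> sets \<nu>" using emeasure_notin_sets[of "cc_ball N x r" \<nu>] by force
qed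

lemma christ_balls:
  "\<forall>k. \<forall>E\<in>\<Q> k. \<exists>n\<in>E. cc_ball N n (c * \<delta> powi k) \<subseteq> E \<and> E \<subseteq> cc_ball N n (C1 * \<delta> powi k)"
  and christ_cover: "\<forall>k. emeasure \<nu> (UNIV - \<Union>(\<Q> k)) = 0"
  and christ_open: "\<forall>k. countable (\<Q> k) \<and> disjoint (\<Q> k) \<and> (\<forall>E\<in>\<Q> k. open E)"
  and christ_pos: "0 < \<delta>" "0 < c" "3 \<le> C1"
  using christ_dec unfolding christ_cubes_def by - (elim conjE, assumption)+

lemma cube_emeasure:
  assumes E: "E \<in> \<Q> k"
  shows "0 < emeasure \<nu> E \<and> emeasure \<nu> E < \<infinity>"
proof -
  obtain n where n: "cc_ball N n (c * \<delta> powi k) \<subseteq> E" "E \<subseteq> cc_ball N n (C1 * \<delta> powi k)"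
    using christ_balls E by blast
  have r: "0 < c * \<delta> powi k" "0 < C1 * \<delta> powi k" using christ_pos by auto
  have "open E" using christ_open E by blast
  then have Es: "E \<in> sets \<nu>" by (simp add: sets_trace)
  show ?thesis
    using less_le_trans[OF cc_ball_measure(2)[OF r(1)] emeasure_mono[OF n(1) Es]]
      le_less_trans[OF emeasure_mono[OF n(2) cc_ball_measure(1)[OF r(2)]] cc_ball_measure(3)[OF r(2)]]
    by (rule conjI)
qed

sublocale cyl: cylinder_chain N \<nu> \<Q> \<delta> C1 c gam lam P0
  by unfold_locales (use christ_dec sets_trace cube_emeasure gam5 lam3 large in auto)

lemma nu_infinite: "emeasure \<nu> UNIV = \<infinity>"
proof (rule ccontr)
  assume fin: "emeasure \<nu> UNIV \<noteq> \<infinity>"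
  obtain r k E a where Pe: "P0 = (r, (k, E), a)" by (rule cyl_cases)
  have E: "E \<in> \<Q> k" using large by (simp add: Pe large_admissible_def)
  have "\<exists>R\<in>\<Q> (k - int m). cyl.\<theta> ^ m * measure \<nu> E \<le> measure \<nu> R" for m
  proof (induction m)
    case 0
    then show ?case using E by auto
  next
    case (Suc m)
    then obtain R where R: "R \<in> \<Q> (k - int m)" "cyl.\<theta> ^ m * measure \<nu> E \<le> measure \<nu> R" by blast
    have "cyl.\<theta> ^ Suc m * measure \<nu> E \<le> cyl.\<theta> * measure \<nu> R"
      using R(2) cyl.theta(1) mult_left_mono[of _ "measure \<nu> R" cyl.\<theta>] by (simp add: mult.assoc)
    also have "\<dots> \<le> measure \<nu> (cyl.par (k - int m) R)" by (rule cyl.par_growth[OF R(1)])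
    finally have "cyl.\<theta> ^ Suc m * measure \<nu> E \<le> measure \<nu> (cyl.par (k - int m) R)" .
    moreover have "cyl.par (k - int m) R \<in> \<Q> (k - int (Suc m))"
      using cyl.par(1)[OF R(1)] by (simp add: algebra_simps)
    ultimately show ?case by blast
  qed
  moreover have "measure \<nu> R \<le> measure \<nu> UNIV" if "R \<in> \<Q> i" for R i
    using fin cyl.cube_sets[OF that]
    by (intro measure_mono_fmeasurable) (auto simp: fmeasurable_def less_top sets_trace)
  ultimately have b: "cyl.\<theta> ^ m * measure \<nu> E \<le> measure \<nu> UNIV" for m by (meson order_trans)
  obtain m where "measure \<nu> UNIV / measure \<nu> E < cyl.\<theta> ^ m"
    using real_arch_pow[OF cyl.theta(1)] by blast
  then show False using b[of m] cyl.cube_measure(1)[OF E] by (simp add: field_simps)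
qed

text \<open>If \<open>Inf {} \<le> 0\<close> and some pair of points is not connected, then two balls of finite measure cover \<open>N\<close>,
  which has infinite measure because parents of cubes grow by the factor \<open>\<theta>\<close>.\<close>

lemma reachable: "(\<forall>x y. \<exists>l. curve x y l) \<or> 0 < Inf ({} :: real set)"
proof (rule ccontr)
  assume "\<not> ?thesis"
  then obtain x y where "\<And>l. \<not> curve x y l" "Inf ({} :: real set) \<le> 0" by (auto simp: not_less)
  then have "cc_ball N x 1 \<union> cc_ball N y 1 = UNIV" by (intro unreachable_balls) auto
  then have "emeasure \<nu> UNIV \<le> emeasure \<nu> (cc_ball N x 1) + emeasure \<nu> (cc_ball N y 1)"
    using emeasure_subadditive[OF cc_ball_measure(1) cc_ball_measure(1), of 1 1 x y] by simp
  also have "\<dots> < \<infinity>" using cc_ball_measure(3)[of 1] by simp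
  finally show False using nu_infinite by simp
qed

section \<open>Cylinders as a system of nested partitions of G\<close>

abbreviation "cset \<equiv> cyl_set N Z"

lemma cset_eq: "cset P = \<Phi> ` cyl_box P"
proof -
  obtain r k E a where Pe: "P = (r, (k, E), a)" by (rule cyl_cases)
  show ?thesis by (simp add: Pe cyl_set_def cylinder_eq cyl_box_def tint_def)
qed

lemma cset_measure:
  assumes "cyl.valid P"
  shows "cset P \<in> sets (flow_measure \<phi>)" "emeasure (flow_measure \<phi>) (cset P) = ennreal (cyl.weight P)"
    "0 < cyl.weight P" "measure (flow_measure \<phi>) (cset P) = cyl.weight P"
proof -
  obtain r k E a where Pe: "P = (r, (k, E), a)" by (rule cyl_cases)
  have v: "E \<in> \<Q> k" "1 < r" "0 < a" using assms by (auto simp: cyl.valid_def Pe)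
  have o: "open E" "open (tint P)" using cyl.cubes(3)[OF v(1)] by (auto simp: tint_def)
  show "cset P \<in> sets (flow_measure \<phi>)"
    unfolding cset_eq cyl_box_def using emeasure_cylinder(1)[OF o] by (simp add: Pe)
  have t: "tint P = {ln a - ln r<..<ln a + ln r}" unfolding Pe using v by (intro tint_eq) auto
  have "emeasure (flow_measure \<phi>) (cset P) = emeasure \<nu> E * emeasure lborel (tint P)"
    unfolding cset_eq cyl_box_def using emeasure_cylinder(2)[OF o] by (simp add: Pe)
  also have "emeasure lborel (tint P) = ennreal (2 * ln r)" using v by (simp add: t)
  also have "emeasure \<nu> E * ennreal (2 * ln r) = ennreal (cyl.weight P)"
    using cyl.cube_measure[OF v(1)] v by (simp add: cyl.weight_def Pe ennreal_mult)
  finally show e: "emeasure (flow_measure \<phi>) (cset P) = ennreal (cyl.weight P)" .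
  show w: "0 < cyl.weight P" using cyl.cube_measure[OF v(1)] v by (simp add: cyl.weight_def Pe)
  show "measure (flow_measure \<phi>) (cset P) = cyl.weight P" using e w by (simp add: measure_def)
qed

lemma good_borel: "cyl.good \<in> sets borel" and AE_good: "AE n in \<nu>. n \<in> cyl.good"
proof -
  have o: "open (\<Union>(\<Q> k))" for k using christ_open by blast
  then show "cyl.good \<in> sets borel" unfolding cyl.good_def by (intro sets.countable_INT'') auto
  have "AE n in \<nu>. n \<in> \<Union>(\<Q> k)" for k
  proof -
    have "UNIV - \<Union>(\<Q> k) \<in> sets borel" using o[of k] by (simp add: borel_open borel_comp Compl_eq_Diff_UNIV[symmetric])
    then have "UNIV - \<Union>(\<Q> k) \<in> null_sets \<nu>" using christ_cover by (auto simp: null_sets_def sets_trace)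
    then have "AE n in \<nu>. n \<notin> UNIV - \<Union>(\<Q> k)" by (rule AE_not_in)
    then show ?thesis by eventually_elim blast
  qed
  then have "AE n in \<nu>. \<forall>k. n \<in> \<Union>(\<Q> k)" by (simp add: AE_all_countable)
  then show "AE n in \<nu>. n \<in> cyl.good" by eventually_elim (auto simp: cyl.good_def)
qed

lemma box_shrink:
  assumes p: "\<And>i. \<exists>P\<in>cyl.D i. p \<in> cyl_box P" and U: "open U" "p \<in> U"
  shows "\<exists>i. \<exists>P\<in>cyl.D i. p \<in> cyl_box P \<and> cyl_box P \<subseteq> U"
proof -
  obtain A B where AB: "open A" "open B" "p \<in> A \<times> B" "A \<times> B \<subseteq> U" using open_prod_elim[OF U] by blast
  obtain \<eta>1 \<eta>2 where \<eta>12: "0 < \<eta>1" "ball (fst p) \<eta>1 \<subseteq> A" "0 < \<eta>2" "ball (snd p) \<eta>2 \<subseteq> B"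
    using AB by (metis mem_Times_iff open_contains_ball)
  obtain r0 where r0: "0 < r0" "\<And>m r. r \<le> r0 \<Longrightarrow> fst p \<in> cc_ball N m r \<Longrightarrow> cc_ball N m r \<subseteq> ball (fst p) \<eta>1"
    using cc_balls_shrink[OF reachable \<eta>12(1), of "fst p"] by blast
  \<comment> \<open>The time interval has length 2 ln (rad P), and the cell lies in a ball of radius
    C1 times the scale.\<close>
  define e where "e = min (\<eta>2 / 2) (r0 / C1)"
  have e: "0 < e" "e \<le> \<eta>2 / 2" "C1 * e \<le> r0" using \<eta>12 r0 christ_pos by (auto simp: e_def field_simps min_def)
  obtain i P where P: "P \<in> cyl.D i" "p \<in> cyl_box P" "ln (rad P) < e" "\<delta> powi gen P < e"
    using cyl.D_shrink[OF p e(1)] by blast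
  have v: "cell P \<in> \<Q> (gen P)" "1 < rad P" "0 < cen P" using cyl.D_valid[OF P(1)] by (auto simp: cyl.valid_def)
  have pm: "fst p \<in> cell P" "snd p \<in> tint P" using P(2) by (auto simp: cyl_box_def)
  obtain m where m: "cell P \<subseteq> cc_ball N m (C1 * \<delta> powi gen P)" using christ_balls v(1) by blast
  have "C1 * \<delta> powi gen P \<le> C1 * e" using P(4) christ_pos by (intro mult_left_mono) auto
  then have "cc_ball N m (C1 * \<delta> powi gen P) \<subseteq> ball (fst p) \<eta>1" using m pm e(3) by (intro r0(2)) auto
  then have 1: "cell P \<subseteq> A" using m \<eta>12(2) by blast
  have "tint P \<subseteq> ball (snd p) \<eta>2"
    using pm(2) P(3) e(2) v by (auto simp: tint_def ln_mult ln_div dist_real_def)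
  then have "cyl_box P \<subseteq> U" using 1 \<eta>12(4) AB(4) unfolding cyl_box_def by blast
  then show ?thesis using P by blast
qed

lemma cyl_set_shrink:
  "AE x in flow_measure \<phi>. \<forall>U. open U \<longrightarrow> x \<in> U \<longrightarrow> (\<exists>i. \<exists>P\<in>cset ` cyl.D i. x \<in> P \<and> P \<subseteq> U)"
proof -
  have "\<forall>i. \<exists>T. countable T \<and> (\<forall>n\<in>cyl.good. \<forall>t\<in>UNIV - T. \<exists>P\<in>cyl.D i. (n, t) \<in> cyl_box P)"
    using cyl.tiling_D unfolding cyl.tiling_def by blast
  then obtain T where T: "\<And>i. countable (T i)"
    "\<And>i n t. n \<in> cyl.good \<Longrightarrow> t \<in> UNIV - T i \<Longrightarrow> \<exists>P\<in>cyl.D i. (n, t) \<in> cyl_box P" by metis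
  have "countable (\<Union>i. T i)" using T(1) by auto
  from AE_flow_measure[OF good_borel AE_good this] show ?thesis
  proof eventually_elim
    case (elim x)
    then obtain p where p: "x = \<Phi> p" "fst p \<in> cyl.good" "snd p \<in> - (\<Union>i. T i)" by auto
    have cov: "\<exists>P\<in>cyl.D i. p \<in> cyl_box P" for i using T(2)[OF p(2), of "snd p" i] p(3) by auto
    show ?case
    proof (intro allI impI)
      fix U assume U: "open U" "x \<in> U"
      have "open (\<Phi> -` U)" using Phi_continuous U(1) by (simp add: open_vimage)
      then obtain i P where P: "P \<in> cyl.D i" "p \<in> cyl_box P" "cyl_box P \<subseteq> \<Phi> -` U"
        using box_shrink[OF cov, of "\<Phi> -` U"] U(2) p(1) by auto
      have "x \<in> cset P" "cset P \<subseteq> U" using P p(1) by (auto simp: cset_eq)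
      then show "\<exists>i. \<exists>P\<in>cset ` cyl.D i. x \<in> P \<and> P \<subseteq> U" using P(1) by blast
    qed
  qed
qed

sublocale dy: dyadic_system "flow_measure \<phi>" G_carrier "\<lambda>i. cset ` cyl.D i" C1 cyl.\<theta>
proof
  show "G_carrier \<in> sets borel" by (rule G_carrier_borel)
  show "sets (flow_measure \<phi>) = sets (restrict_space borel G_carrier)" by (rule sets_flow_measure)
  show "countable (cset ` cyl.D i)" for i using cyl.tiling_D[of i] by (simp add: cyl.tiling_def)
  show "disjoint (cset ` cyl.D i)" for i
  proof (rule disjointI)
    fix A B assume "A \<in> cset ` cyl.D i" "B \<in> cset ` cyl.D i" "A \<noteq> B"
    then obtain P R where PR: "A = cset P" "B = cset R" "P \<in> cyl.D i" "R \<in> cyl.D i" "P \<noteq> R" by blast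
    then have "cyl_box P \<inter> cyl_box R = {}" using cyl.tiling_D[of i] unfolding cyl.tiling_def by blast
    moreover have "inj \<Phi>" by (metis injI Psi_Phi)
    ultimately show "A \<inter> B = {}" using image_Int[of \<Phi> "cyl_box P" "cyl_box R"] PR by (simp add: cset_eq)
  qed
  fix A i assume A: "A \<in> cset ` cyl.D i"
  then obtain P where P: "A = cset P" "P \<in> cyl.D i" by blast
  note v = cyl.D_valid[OF P(2)]
  show "A \<in> sets (flow_measure \<phi>)" "0 < emeasure (flow_measure \<phi>) A" "emeasure (flow_measure \<phi>) A < \<infinity>"
    using cset_measure[OF v] P by simp_all
  obtain R where R: "R \<in> cyl.D (i - 1)" "cyl.refines P R" using cyl.D_refine[OF P(2)] by blast
  show "\<exists>R\<in>cset ` cyl.D (i - 1). A \<subseteq> R \<and> cyl.\<theta> * measure (flow_measure \<phi>) A \<le> measure (flow_measure \<phi>) R \<and>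
      measure (flow_measure \<phi>) R \<le> C1 * measure (flow_measure \<phi>) A"
    unfolding P(1)
  proof (intro bexI[of _ "cset R"] conjI imageI R(1))
    show "cset P \<subseteq> cset R" unfolding cset_eq using R(2) by (intro image_mono) (simp add: cyl.refines_def)
  qed (use R(2) cset_measure(4)[OF v] cset_measure(4)[OF cyl.D_valid[OF R(1)]] in \<open>simp_all add: cyl.refines_def\<close>)
next
  show "1 < cyl.\<theta>" by (rule cyl.theta)
  show "AE x in flow_measure \<phi>. \<forall>U. open U \<longrightarrow> x \<in> U \<longrightarrow> (\<exists>i. \<exists>P\<in>cset ` cyl.D i. x \<in> P \<and> P \<subseteq> U)"
    by (rule cyl_set_shrink)
qed

lemma DD_eq: "dy.DD = DZ N Z \<Q> \<delta> gam lam P0"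
  unfolding dy.DD_def DZ_def by (simp only: image_UN)

end

text \<open>\<open>E\<close> is chosen before f and respects equality almost everywhere, so it is a
  function on the space L^1. The scalars \<open>'k\<close> cover the real and the complex case. The
  L^1 norms of the functions b are summed in \<open>ennreal\<close>, so the estimate includes their
  summability.\<close>

theorem theorem3p10:
  fixes N :: "('v::euclidean_space) strat_group"
    and Z :: "'v \<times> real"
    and \<phi> :: "'v \<times> real \<Rightarrow> real"
    and \<mu> :: "('v \<times> real) measure"
    and \<Q> :: "int \<Rightarrow> 'v set set"
    and \<delta> C1 c gam lam r0 :: real
    and q0 :: "'v cube"
  assumes "stratified_lie_group N"
    and "Z \<in> unit_slope N"
    and "flow_density N Z \<phi>"
    and "\<mu> = flow_measure \<phi>"
    and "doubling N (trace_measure \<phi>)"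
    and "christ_cubes N (trace_measure \<phi>) \<Q> \<delta> C1 c"
    and "5 \<le> gam"
    and "exp 3 / \<delta> < lam"
    and "large_admissible \<Q> \<delta> gam lam (r0, q0, 1)"
  shows "\<exists>E :: ('v \<times> real \<Rightarrow> 'k::{real_normed_field, banach, second_countable_topology}) \<Rightarrow> real \<Rightarrow>
               ('v \<times> real) set set.
    (\<forall>f \<alpha>. integrable \<mu> f \<and> 0 < \<alpha> \<longrightarrow>
       E f \<alpha> \<subseteq> DZ N Z \<Q> \<delta> gam lam (r0, q0, 1) \<and> disjoint (E f \<alpha>) \<and>
       (\<exists>g b. g \<in> borel_measurable \<mu> \<and> (\<forall>P\<in>E f \<alpha>. integrable \<mu> (b P)) \<and>
          (AE x in \<mu>. f x = g x + (\<Sum>\<^sub>\<infinity>P\<in>E f \<alpha>. b P x)) \<and>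
          (AE x in \<mu>. norm (g x) \<le> C1 * \<alpha>) \<and>
          (\<forall>P\<in>E f \<alpha>. (\<forall>x\<in>space \<mu> - P. b P x = 0) \<and> (LINT x:P|\<mu>. b P x) = 0) \<and>
          (\<Sum>\<^sub>\<infinity>P\<in>E f \<alpha>. \<integral>\<^sup>+x. ennreal (norm (b P x)) \<partial>\<mu>)
            \<le> ennreal (2 * C1) * (\<integral>\<^sup>+x. ennreal (norm (f x)) \<partial>\<mu>))) \<and>
    (\<forall>f f' \<alpha>. integrable \<mu> f \<and> integrable \<mu> f' \<and> 0 < \<alpha> \<and> (AE x in \<mu>. f x = f' x) \<longrightarrow>
       E f \<alpha> = E f' \<alpha>) \<and>
    (\<forall>P\<in>DZ N Z \<Q> \<delta> gam lam (r0, q0, 1). \<exists>f \<alpha>. integrable \<mu> f \<and> 0 < \<alpha> \<and> P \<in> E f \<alpha>)"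
proof -
  interpret cz_setting N Z \<phi> \<Q> \<delta> C1 c gam lam "(r0, q0, 1)"
    by unfold_locales (use assms in auto)
  have C: "1 \<le> C1" using christ_pos by simp
  have th: "0 < 1 / cyl.\<theta>" using cyl.theta by simp
  show ?thesis unfolding \<open>\<mu> = flow_measure \<phi>\<close> DD_eq[symmetric]
  proof (rule exI[of _ dy.stop], rule conjI[OF _ conjI], goal_cases)
    case 1
    show ?case by (intro allI impI, elim conjE, rule dy.CZ_decomposition[OF _ _ C])
  next
    case 2
    show ?case by (intro allI impI, elim conjE, rule dy.stop_cong_AE)
  next
    case 3
    show ?case
    proof
      fix P assume "P \<in> dy.DD"
      from dy.stop_converse[OF this, where 'k = 'k] th
      show "\<exists>(f :: 'v \<times> real \<Rightarrow> 'k) \<alpha>. integrable (flow_measure \<phi>) f \<and> 0 < \<alpha> \<and> P \<in> dy.stop f \<alpha>" by blast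
    qed
  qed
qed

end
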